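(* Let $G$ be a finite $2$-group of nilpotency class $2$ and let $r\ge 1$. Then $N_{x^{2^r},G}$ is a character of $G$ if and only if $G$ has no epimorphic image isomorphic to a group of the form $\mathcal{D}_{2^{3r_1}}*\cdots*\mathcal{D}_{2^{3r_n}}*\mathcal{Q}_{2^{3r}}$ with $n\geq 0$ and $r_1\leq\dots\leq r_n\leq r$.
   Context: For $g\in G$, $N_{x^{n},G}(g)=|\{h\in G\mid h^{n}=g\}|$. "Character" means a genuine complex character (a linear combination of irreducible complex characters with non-negative integer coefficients). For $s\geq 1$ define groups of order $2^{3s}$ by $$\mathcal{D}_{2^{3s}}=\langle x,z_1,y\mid x^{2^s}=z_1^{2^s}=y^{2^s}=1,\ [x,z_1]=1,\ [x,y]=z_1,\ [z_1,y]=1\rangle,$$ $$\mathcal{Q}_{2^{3s}}=\langle x,z_1,y\mid z_1^{2^s}=1,\ x^{2^s}=z_1^{2^{s-1}}=y^{2^s},\ [x,z_1]=1,\ [x,y]=z_1,\ [z_1,y]=1\rangle.$$ Each of these has center $\langle z_1\rangle$, cyclic of order $2^s$. All indices $r_i$ are integers $\ge 1$. If $T$ and $H$ are $2$-groups with cyclic centers and $|Z(T)|\leq|Z(H)|$, $T*H$ denotes the central product of $T$ and $H$ in which $Z(T)$ is amalgamated (identified) with the subgroup of $Z(H)$ of the same order; for $T=\mathcal{D}_{2^{3s}}$ or $\mathcal{Q}_{2^{3s}}$ it is unique up to isomorphism. Its center is (the image of) $Z(H)$. Products with more factors are iterated: $T_1*T_2*\cdots*T_m=T_1*(T_2*(\cdots*T_m))$.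 When $n=0$ the product is just $\mathcal{Q}_{2^{3r}}$. *)

theory Defs
  imports
    Complex_Main
    "HOL-Algebra.Algebra"
    "Jordan_Normal_Form.VS_Connect"
begin

section \<open>Centre and nilpotency class\<close>

definition center :: "('a, 'b) monoid_scheme \<Rightarrow> 'a set" where
  "center G = {z \<in> carrier G. \<forall>g\<in>carrier G. z \<otimes>\<^bsub>G\<^esub> g = g \<otimes>\<^bsub>G\<^esub> z}"

definition commutator_subgroup ::
  "('a, 'b) monoid_scheme \<Rightarrow> 'a set \<Rightarrow> 'a set \<Rightarrow> 'a set" where
  "commutator_subgroup G H K =
     generate G (\<Union>h\<in>H. \<Union>k\<in>K. {inv\<^bsub>G\<^esub> h \<otimes>\<^bsub>G\<^esub> inv\<^bsub>G\<^esub> k \<otimes>\<^bsub>G\<^esub> h \<otimes>\<^bsub>G\<^esub> k})"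

text \<open>The lower central series, numbered from \<open>0\<close>: term \<open>i\<close> is what is usually called
  \<open>\<gamma>\<close> with index \<open>i + 1\<close>.\<close>

primrec lower_central :: "('a, 'b) monoid_scheme \<Rightarrow> nat \<Rightarrow> 'a set" where
  "lower_central G 0 = carrier G"
| "lower_central G (Suc i) = commutator_subgroup G (lower_central G i) (carrier G)"

definition has_nilpotency_class :: "('a, 'b) monoid_scheme \<Rightarrow> nat \<Rightarrow> bool" where
  "has_nilpotency_class G c \<longleftrightarrow>
     lower_central G c = {\<one>\<^bsub>G\<^esub>} \<and> (\<forall>i<c. lower_central G i \<noteq> {\<one>\<^bsub>G\<^esub>})"


section \<open>Complex characters\<close>

text \<open>\<open>units_of (ring_mat TYPE(complex) n ())\<close> is the group of invertible complex
  \<open>n\<close> by \<open>n\<close> matrices.\<close>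

definition representation ::
  "('a, 'b) monoid_scheme \<Rightarrow> nat \<Rightarrow> ('a \<Rightarrow> complex mat) \<Rightarrow> bool" where
  "representation G n \<rho> \<longleftrightarrow> \<rho> \<in> hom G (units_of (ring_mat TYPE(complex) n ()))"

definition irreducible_representation ::
  "('a, 'b) monoid_scheme \<Rightarrow> nat \<Rightarrow> ('a \<Rightarrow> complex mat) \<Rightarrow> bool" where
  "irreducible_representation G n \<rho> \<longleftrightarrow>
     representation G n \<rho> \<and> n > 0 \<and>
     (\<forall>W. subspace class_ring W (module_vec TYPE(complex) n) \<longrightarrow>
          (\<forall>g\<in>carrier G. \<forall>w\<in>W. \<rho> g *\<^sub>v w \<in> W) \<longrightarrow>
          W = {0\<^sub>v n} \<or> W = carrier_vec n)"

definition mat_trace :: "complex mat \<Rightarrow> complex" where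
  "mat_trace A = (\<Sum>i<dim_row A. A $$ (i, i))"

text \<open>Irreducible characters are made \<open>undefined\<close> off the carrier, so that each of them
  occurs exactly once in this set.\<close>

definition irreducible_characters :: "('a, 'b) monoid_scheme \<Rightarrow> ('a \<Rightarrow> complex) set" where
  "irreducible_characters G =
     {restrict (\<lambda>g. mat_trace (\<rho> g)) (carrier G) | n \<rho>. irreducible_representation G n \<rho>}"

definition is_character :: "('a, 'b) monoid_scheme \<Rightarrow> ('a \<Rightarrow> complex) \<Rightarrow> bool" where
  "is_character G \<chi> \<longleftrightarrow>
     (\<exists>S c. finite S \<and> S \<subseteq> irreducible_characters G \<and>
        (\<forall>g\<in>carrier G. \<chi> g = (\<Sum>\<psi>\<in>S. of_nat (c \<psi> :: nat) * \<psi> g)))"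

definition power_count :: "('a, 'b) monoid_scheme \<Rightarrow> nat \<Rightarrow> 'a \<Rightarrow> nat" where
  "power_count G n g = card {h \<in> carrier G. h [^]\<^bsub>G\<^esub> n = g}"


section \<open>Groups given by presentations\<close>

text \<open>A letter \<open>(a, True)\<close> stands for the generator \<open>a\<close> and \<open>(a, False)\<close> for its inverse.
  All elements of the type \<open>'x\<close> are generators; a presentation is then a set of
  relations, each being a pair of words.\<close>

type_synonym 'x word = "('x \<times> bool) list"

inductive word_eq :: "('x word \<times> 'x word) set \<Rightarrow> 'x word \<Rightarrow> 'x word \<Rightarrow> bool"
  for R :: "('x word \<times> 'x word) set" where
  refl: "word_eq R u u"
| sym: "word_eq R u v \<Longrightarrow> word_eq R v u"
| trans: "word_eq R u v \<Longrightarrow> word_eq R v w \<Longrightarrow> word_eq R u w"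
| cancel: "word_eq R (u @ [(a, b), (a, \<not> b)] @ v) (u @ v)"
| relation: "(l, r) \<in> R \<Longrightarrow> word_eq R (u @ l @ v) (u @ r @ v)"

definition presented_group :: "('x word \<times> 'x word) set \<Rightarrow> 'x word set monoid" where
  "presented_group R =
     \<lparr>carrier = UNIV // {(u, v). word_eq R u v},
      monoid.mult = (\<lambda>A B. {w. \<exists>u\<in>A. \<exists>v\<in>B. word_eq R (u @ v) w}),
      one = {w. word_eq R [] w}\<rparr>"

definition word_pow :: "'x word \<Rightarrow> nat \<Rightarrow> 'x word" where
  "word_pow w n = concat (replicate n w)"

definition word_inv :: "'x word \<Rightarrow> 'x word" where
  "word_inv w = rev (map (\<lambda>(a, b). (a, \<not> b)) w)"

definition word_comm :: "'x word \<Rightarrow> 'x word \<Rightarrow> 'x word" where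
  "word_comm u v = word_inv u @ word_inv v @ u @ v"


section \<open>The groups D and Q and their central products\<close>

datatype gen = Gen_x | Gen_z1 | Gen_y

abbreviation gx :: "gen word" where "gx \<equiv> [(Gen_x, True)]"
abbreviation gz :: "gen word" where "gz \<equiv> [(Gen_z1, True)]"
abbreviation gy :: "gen word" where "gy \<equiv> [(Gen_y, True)]"

text \<open>The parameter is \<open>s\<close>, not the order \<open>2^(3s)\<close> of the group; both definitions are meant
  for \<open>s \<ge> 1\<close>.\<close>

definition D_group :: "nat \<Rightarrow> gen word set monoid" where
  "D_group s = presented_group
     {(word_pow gx (2 ^ s), []), (word_pow gz (2 ^ s), []), (word_pow gy (2 ^ s), []),
      (word_comm gx gz, []), (word_comm gx gy, gz), (word_comm gz gy, [])}"

definition Q_group :: "nat \<Rightarrow> gen word set monoid" where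
  "Q_group s = presented_group
     {(word_pow gz (2 ^ s), []),
      (word_pow gx (2 ^ s), word_pow gz (2 ^ (s - 1))),
      (word_pow gz (2 ^ (s - 1)), word_pow gy (2 ^ s)),
      (word_comm gx gz, []), (word_comm gx gy, gz), (word_comm gz gy, [])}"

text \<open>\<open>central_product T H P\<close>: the group \<open>P\<close> is isomorphic to a quotient of \<open>T \<times> H\<close> in which
  each \<open>z\<close> in the centre of \<open>T\<close> is identified with \<open>\<phi> z\<close>, where \<open>\<phi>\<close> is an isomorphism from
  the centre of \<open>T\<close> onto a subgroup of the centre of \<open>H\<close>. The latter subgroup has the
  order of the centre of \<open>T\<close>, and is determined by this when the centre of \<open>H\<close> is cyclic.\<close>

definition central_product ::
  "('a, 'm) monoid_scheme \<Rightarrow> ('b, 'n) monoid_scheme \<Rightarrow> ('c, 'k) monoid_scheme \<Rightarrow> bool" where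
  "central_product T H P \<longleftrightarrow> group P \<and>
     (\<exists>K \<phi>. subgroup K H \<and> K \<subseteq> center H \<and>
        \<phi> \<in> iso (T\<lparr>carrier := center T\<rparr>) (H\<lparr>carrier := K\<rparr>) \<and>
        (T \<times>\<times> H) Mod {(z, inv\<^bsub>H\<^esub> (\<phi> z)) | z. z \<in> center T} \<cong> P)"

text \<open>\<open>DQ_product [r\<^sub>1, \<dots>, r\<^sub>n] r P\<close>: the group \<open>P\<close> is isomorphic to the iterated central
  product of the groups \<open>D_group r\<^sub>i\<close> and \<open>Q_group r\<close>, bracketed to the right. The groups
  involved are finite, so every isomorphism type is represented on \<open>nat\<close>; using one fixed
  type of elements is what makes the iteration typeable.\<close>

primrec DQ_product :: "nat list \<Rightarrow> nat \<Rightarrow> nat monoid \<Rightarrow> bool" where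
  "DQ_product [] r P \<longleftrightarrow> group P \<and> Q_group r \<cong> P"
| "DQ_product (s # ss) r P \<longleftrightarrow>
     (\<exists>H :: nat monoid. DQ_product ss r H \<and> central_product (D_group s) H P)"

end

theory Submission
  imports Defs "Jordan_Normal_Form.Schur_Decomposition"
begin

text \<open>
Write \<open>n = 2 ^ r\<close>. In class two the irreducible characters are indexed by the pairs \<open>(\<kappa>, \<mu>)\<close>, where
\<open>\<kappa>\<close> is a linear character of the centre and \<open>\<mu>\<close> extends \<open>\<kappa>\<close> to the radical \<open>R\<close> of the form
\<open>\<kappa> [g, h]\<close>; the character is \<open>d \<mu>\<close> on \<open>R\<close> and zero outside, with \<open>d\<^sup>2 = |G : R|\<close>. Its multiplicity
in the power-counting function is a multiple of the Gauss sum of \<open>\<mu> (h ^ n)\<close> over all \<open>h\<close> with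
\<open>h ^ n \<in> R\<close>, which may be computed in the quotient \<open>P\<close> of \<open>G\<close> by the kernel of \<open>\<mu>\<close>, a group with a
faithful central character. If the sum is non-zero then \<open>h \<mapsto> \<mu> (h ^ n)\<close> is a quadratic form on \<open>P\<close>
with values \<open>\<plusminus>1\<close> that is trivial on the radical of its polar form; hence the square of the multiplicity
is an integer and its sign is the Arf invariant. A negative sign allows one to split off a factor
\<open>Q\<close> from \<open>P\<close> and then, always choosing a commutator of maximal order, only factors \<open>D\<close>. Conversely, the
Gauss sum is multiplicative over central products, positive for \<open>D\<close> and negative for \<open>Q\<close>, whereas it is
non-negative if the power-counting function is a character.\<close>

section \<open>Commutators in groups of class two\<close>

text \<open>The list of irreducible characters is never shown to be complete. The expansion of the
  power-counting function is instead verified by exchanging sums, using only orthogonality for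
  linear characters of abelian sections, so the functions \<open>d \<mu>\<close> merely have to be
  irreducible. In the other direction no inner product of characters enters either: averaging a
  representation over \<open>R\<close> against a linear character gives an idempotent, whose trace
  is a natural number. The signs come from
  \<open>2 ^ r choose 2 = 2 ^ (r - 1) * (2 ^ r - 1)\<close>: in class two, the failure of
  \<open>h \<mapsto> h ^ n\<close> to be multiplicative is a commutator raised to this number. A
  negative sum therefore needs a pair with \<open>lam ([x, y] ^ (2 ^ (r - 1))) = -1\<close>, that
  is, a commutator of full order \<open>2 ^ r\<close>. This is why the factor \<open>Q\<close> has
  parameter exactly \<open>r\<close>, whereas \<open>D\<close> factors may be smaller. Faithfulness
  makes the centre of \<open>P\<close> cyclic, so that exponents can be corrected by central
  elements and every splitting is amalgamated over the centre.\<close>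

definition commut :: "('a, 'b) monoid_scheme \<Rightarrow> 'a \<Rightarrow> 'a \<Rightarrow> 'a" where
  "commut G g h = inv\<^bsub>G\<^esub> g \<otimes>\<^bsub>G\<^esub> inv\<^bsub>G\<^esub> h \<otimes>\<^bsub>G\<^esub> g \<otimes>\<^bsub>G\<^esub> h"

lemma center_sub: "z \<in> center G \<Longrightarrow> z \<in> carrier G"
  by (simp add: center_def)

lemma center_comm: "z \<in> center G \<Longrightarrow> g \<in> carrier G \<Longrightarrow> z \<otimes>\<^bsub>G\<^esub> g = g \<otimes>\<^bsub>G\<^esub> z"
  by (simp add: center_def)

context group
begin

lemma commut_closed [simp]:
  "g \<in> carrier G \<Longrightarrow> h \<in> carrier G \<Longrightarrow> commut G g h \<in> carrier G"
  by (simp add: commut_def)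

lemma commut_swap:
  assumes "g \<in> carrier G" "h \<in> carrier G"
  shows "g \<otimes> h = h \<otimes> g \<otimes> commut G g h"
  using assms by (simp add: commut_def m_assoc) (simp flip: m_assoc)

lemma commutI:
  assumes "g \<in> carrier G" "h \<in> carrier G" "u \<in> carrier G" "g \<otimes> h = h \<otimes> g \<otimes> u"
  shows "commut G g h = u"
  using commut_swap[of g h] assms by (metis commut_closed l_cancel m_closed)

lemma commut_one_iff:
  assumes "g \<in> carrier G" "h \<in> carrier G"
  shows "commut G g h = \<one> \<longleftrightarrow> g \<otimes> h = h \<otimes> g"
  using commut_swap[of g h] commutI[of g h \<one>] assms by auto

lemma commut_self [simp]: "g \<in> carrier G \<Longrightarrow> commut G g g = \<one>"
  by (simp add: commut_one_iff)

lemma conj_eq_commut: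
  assumes "g \<in> carrier G" "t \<in> carrier G"
  shows "inv t \<otimes> g \<otimes> t = g \<otimes> commut G g t"
  using assms by (simp add: commut_def m_assoc) (simp flip: m_assoc)

lemma subgroup_center: "subgroup (center G) G"
proof (rule subgroupI)
  show "center G \<noteq> {}" by (auto simp: center_def intro!: exI[of _ \<one>])
next
  fix a assume a: "a \<in> center G"
  then have ac: "a \<in> carrier G" by (rule center_sub)
  have "inv a \<otimes> g = g \<otimes> inv a" if g: "g \<in> carrier G" for g
  proof -
    have "a \<otimes> inv g = inv g \<otimes> a" using center_comm[OF a] g by simp
    then have "inv (a \<otimes> inv g) = inv (inv g \<otimes> a)" by simp
    then show ?thesis using ac g by (simp add: inv_mult_group)
  qed
  then show "inv a \<in> center G" using ac by (simp add: center_def)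
next
  fix a b assume ab: "a \<in> center G" "b \<in> center G"
  have "a \<otimes> b \<otimes> g = g \<otimes> (a \<otimes> b)" if g: "g \<in> carrier G" for g
    using ab[THEN center_comm, OF g] ab[THEN center_sub] g by (metis m_assoc)
  then show "a \<otimes> b \<in> center G" using ab[THEN center_sub] by (simp add: center_def)
qed (auto simp: center_def)

lemma center_one [simp]: "\<one> \<in> center G"
  using subgroup_center by (rule subgroup.one_closed)

lemma center_mult: "a \<in> center G \<Longrightarrow> b \<in> center G \<Longrightarrow> a \<otimes> b \<in> center G"
  using subgroup_center by (rule subgroup.m_closed)

lemma center_inv: "a \<in> center G \<Longrightarrow> inv a \<in> center G"
  using subgroup_center by (rule subgroup.m_inv_closed)

lemma center_pow: "a \<in> center G \<Longrightarrow> a [^] (k::nat) \<in> center G"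
  by (induction k) (auto intro: center_mult)

lemma commut_central:
  assumes "z \<in> center G" "g \<in> carrier G"
  shows "commut G z g = \<one>" "commut G g z = \<one>"
  using assms by (simp_all add: commut_one_iff center_sub center_comm)

lemma centerI:
  assumes "z \<in> carrier G" "\<And>g. g \<in> carrier G \<Longrightarrow> commut G z g = \<one>"
  shows "z \<in> center G"
  using assms by (auto simp: center_def commut_one_iff)

end

text \<open>Abelian groups are included on purpose: in this form the condition passes to the
  quotients and direct products on which Gauss sums are computed, without keeping track of the exact
  class.\<close>

locale class2_group = group G for G (structure) +
  assumes commut_center: "g \<in> carrier G \<Longrightarrow> h \<in> carrier G \<Longrightarrow> commut G g h \<in> center G"
begin

lemma center_left_commute:
  assumes "z \<in> center G" "a \<in> carrier G" "b \<in> carrier G"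
  shows "a \<otimes> (z \<otimes> b) = z \<otimes> (a \<otimes> b)"
  using assms center_comm[OF assms(1,2)] by (metis center_sub m_assoc)

text \<open>Central commutators can be moved out of the way, so the commutator is a bimultiplicative
  form with values in the centre. All later arguments on orthogonality rest on this.\<close>

lemma commut_mult_right:
  assumes g: "g \<in> carrier G" and h: "h \<in> carrier G" and k: "k \<in> carrier G"
  shows "commut G g (h \<otimes> k) = commut G g h \<otimes> commut G g k"
proof (rule commutI)
  let ?a = "commut G g h" let ?b = "commut G g k"
  have a: "?a \<in> center G" and b: "?b \<in> center G" using assms by (simp_all add: commut_center)
  have [simp]: "?a \<in> carrier G" "?b \<in> carrier G" using assms by simp_all
  have "g \<otimes> (h \<otimes> k) = (h \<otimes> g \<otimes> ?a) \<otimes> k"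
    using assms commut_swap[OF g h] by (metis m_assoc)
  also have "\<dots> = h \<otimes> (g \<otimes> k) \<otimes> ?a"
    using assms center_comm[OF a k] by (simp add: m_assoc)
  also have "\<dots> = h \<otimes> (k \<otimes> g \<otimes> ?b) \<otimes> ?a"
    using commut_swap[OF g k] by simp
  also have "\<dots> = h \<otimes> k \<otimes> g \<otimes> (?a \<otimes> ?b)"
    using assms center_comm[OF a, of ?b] by (simp add: m_assoc)
  finally show "g \<otimes> (h \<otimes> k) = h \<otimes> k \<otimes> g \<otimes> (?a \<otimes> ?b)" .
qed (use assms in auto)

lemma commut_inv:
  assumes g: "g \<in> carrier G" and h: "h \<in> carrier G"
  shows "commut G h g = inv (commut G g h)"
  using assms by (simp add: commut_def inv_mult_group m_assoc)

lemma commut_mult_left: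
  assumes g: "g \<in> carrier G" and h: "h \<in> carrier G" and k: "k \<in> carrier G"
  shows "commut G (h \<otimes> k) g = commut G h g \<otimes> commut G k g"
proof -
  have "commut G (h \<otimes> k) g = inv (commut G g h \<otimes> commut G g k)"
    using assms by (simp add: commut_inv[of g] commut_mult_right)
  also have "\<dots> = inv (commut G g k) \<otimes> inv (commut G g h)"
    using assms by (simp add: inv_mult_group)
  also have "\<dots> = commut G k g \<otimes> commut G h g"
    using assms by (simp add: commut_inv[of g])
  also have "\<dots> = commut G h g \<otimes> commut G k g"
    using assms by (intro center_comm commut_center) auto
  finally show ?thesis .
qed

lemma commut_pow_left:
  assumes "g \<in> carrier G" "h \<in> carrier G"
  shows "commut G (g [^] (k::nat)) h = commut G g h [^] k"
  using assms
  by (induction k) (simp_all add: commut_mult_left commut_central)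

lemma commut_pow_right:
  assumes "g \<in> carrier G" "h \<in> carrier G"
  shows "commut G g (h [^] (k::nat)) = commut G g h [^] k"
  using assms
  by (induction k) (simp_all add: commut_mult_right commut_central)

lemma center_pow_mult:
  assumes "a \<in> center G" "b \<in> carrier G"
  shows "(a \<otimes> b) [^] (k::nat) = a [^] k \<otimes> b [^] k"
proof -
  have "a \<otimes> b = b \<otimes> a" using assms by (intro center_comm)
  then show ?thesis using assms by (intro pow_mult_distrib) (auto intro: center_sub)
qed

text \<open>Collecting the factors \<open>g\<close> on the left moves an \<open>h\<close> past a
  \<open>g\<close> once for each pair of positions, whence \<open>n choose 2\<close> copies of the
  central commutator.\<close>

lemma pow_mult_commut:
  assumes g: "g \<in> carrier G" and h: "h \<in> carrier G"
  shows "(g \<otimes> h) [^] (n::nat) = g [^] n \<otimes> h [^] n \<otimes> commut G h g [^] (n choose 2)"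
proof (induction n)
  case 0 then show ?case by (simp add: binomial_eq_0)
next
  case (Suc n)
  let ?c = "commut G h g" let ?m = "n choose 2"
  have c: "?c \<in> center G" using assms by (simp add: commut_center)
  have cm: "?c [^] ?m \<in> center G" "?c [^] n \<in> center G" using c by (simp_all add: center_pow)
  have [simp]: "?c \<in> carrier G" using assms by simp
  have sw: "h [^] n \<otimes> g = g \<otimes> h [^] n \<otimes> ?c [^] n"
    using assms commut_swap[of "h [^] n" g] by (simp add: commut_pow_left)
  have "(g \<otimes> h) [^] Suc n = g [^] n \<otimes> h [^] n \<otimes> ?c [^] ?m \<otimes> (g \<otimes> h)"
    using Suc by simp
  also have "\<dots> = g [^] n \<otimes> h [^] n \<otimes> (g \<otimes> h) \<otimes> ?c [^] ?m"
    using assms center_comm[OF cm(1), of "g \<otimes> h"] by (simp add: m_assoc)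
  also have "\<dots> = g [^] n \<otimes> (h [^] n \<otimes> g) \<otimes> h \<otimes> ?c [^] ?m"
    using assms by (simp add: m_assoc)
  also have "\<dots> = g [^] n \<otimes> (g \<otimes> h [^] n \<otimes> ?c [^] n) \<otimes> h \<otimes> ?c [^] ?m"
    by (simp add: sw)
  also have "\<dots> = g [^] n \<otimes> g \<otimes> (h [^] n \<otimes> h) \<otimes> (?c [^] n \<otimes> ?c [^] ?m)"
    using assms center_comm[OF cm(2), of h] by (simp add: m_assoc center_left_commute[OF cm(2)])
  also have "\<dots> = g [^] Suc n \<otimes> h [^] Suc n \<otimes> ?c [^] (Suc n choose 2)"
    by (simp add: nat_pow_mult numeral_2_eq_2)
  finally show ?case .
qed

lemma commut_central_left:
  assumes "z \<in> center G" "g \<in> carrier G" "h \<in> carrier G"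
  shows "commut G (z \<otimes> g) h = commut G g h" "commut G h (z \<otimes> g) = commut G h g"
  using assms by (simp_all add: commut_mult_left commut_mult_right center_sub commut_central)

end

section \<open>Gauss sums over groups with a faithful central character\<close>

lemma sum_lessThan_double:
  fixes f :: "nat \<Rightarrow> 'b :: comm_monoid_add"
  shows "sum f {..<2 * M} = (\<Sum>k<M. f (2 * k) + f (Suc (2 * k)))"
  by (induction M) (simp_all add: ac_simps)

text \<open>Sorted by the value of the power, this is \<open>card R\<close> times the inner product
  on \<open>R\<close> of the power-counting function with the conjugate of \<open>\<mu>\<close>.
  Powers outside \<open>R\<close> are excluded, so the values of \<open>\<mu>\<close> there do not
  enter.\<close>

definition gauss_sum :: "('a, 'b) monoid_scheme \<Rightarrow> 'a set \<Rightarrow> ('a \<Rightarrow> complex) \<Rightarrow> nat \<Rightarrow> complex" where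
  "gauss_sum G R \<mu> n = (\<Sum>g | g \<in> carrier G \<and> g [^]\<^bsub>G\<^esub> n \<in> R. \<mu> (g [^]\<^bsub>G\<^esub> n))"

text \<open>An injective \<open>lam\<close> embeds the centre into the non-zero complex numbers,
  hence makes it cyclic, and reduces equality of central elements to equality of numbers.\<close>

locale faithful_group = class2_group G for G (structure) +
  fixes lam :: "'a \<Rightarrow> complex"
  assumes fin: "finite (carrier G)"
    and lam_one [simp]: "lam \<one> = 1"
    and lam_mult: "a \<in> center G \<Longrightarrow> b \<in> center G \<Longrightarrow> lam (a \<otimes> b) = lam a * lam b"
    and lam_inj: "inj_on lam (center G)"
begin

lemma lam_pow: "z \<in> center G \<Longrightarrow> lam (z [^] (k::nat)) = lam z ^ k"
  by (induction k) (simp_all add: lam_mult center_pow)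

lemma lam_eq_1_iff: "z \<in> center G \<Longrightarrow> lam z = 1 \<longleftrightarrow> z = \<one>"
  using lam_inj by (metis inj_onD center_one lam_one)

end

text \<open>The bound on the exponent of the centre makes all \<open>2 ^ r\<close>-th powers
  central, so that the Gauss sum runs over the whole group.\<close>

locale gauss_group = faithful_group G lam for G (structure) and lam +
  fixes r :: nat
  assumes r_pos: "r \<ge> 1"
    and center_exp: "z \<in> center G \<Longrightarrow> z [^] (2 ^ r :: nat) = \<one>"
begin

definition q :: "'a \<Rightarrow> complex" where "q h = lam (h [^] (2 ^ r :: nat))"
text \<open>The polar form of the quadratic form \<open>q\<close>. The exponent is the power of two
  in \<open>2 ^ r choose 2\<close>; the remaining odd factor has no effect on the values 1 and
  -1.\<close>

definition eps :: "'a \<Rightarrow> 'a \<Rightarrow> complex" where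
  "eps g h = lam (commut G g h [^] (2 ^ (r - 1) :: nat))"

lemma two_pow_r: "(2::nat) ^ r = 2 ^ (r - 1) * 2"
  using r_pos by (cases r) auto

lemma pow_n_center:
  assumes "h \<in> carrier G"
  shows "h [^] (2 ^ r :: nat) \<in> center G"
  using assms by (intro centerI) (simp_all add: commut_pow_left center_exp commut_center)

lemma gauss_sum_eq: "gauss_sum G (center G) lam (2 ^ r) = (\<Sum>g\<in>carrier G. q g)"
  by (simp add: gauss_sum_def q_def pow_n_center conj_absorb cong: conj_cong)

lemma eps_cases:
  assumes "g \<in> carrier G" "h \<in> carrier G"
  shows "eps g h = 1 \<or> eps g h = -1"
proof -
  have "eps g h ^ 2 = lam (commut G g h [^] (2 ^ r :: nat))"
    using assms unfolding eps_def two_pow_r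
    by (simp add: lam_pow commut_center power_mult)
  also have "\<dots> = 1" using assms by (simp add: center_exp commut_center)
  finally show ?thesis by (simp add: power2_eq_1_iff)
qed

lemma eps_self [simp]: "g \<in> carrier G \<Longrightarrow> eps g g = 1"
  by (simp add: eps_def)

lemma eps_one [simp]: "g \<in> carrier G \<Longrightarrow> eps \<one> g = 1" "g \<in> carrier G \<Longrightarrow> eps g \<one> = 1"
  by (simp_all add: eps_def commut_central)

lemma eps_mult_left:
  assumes "g \<in> carrier G" "h \<in> carrier G" "k \<in> carrier G"
  shows "eps (h \<otimes> k) g = eps h g * eps k g"
  using assms
  by (simp add: eps_def commut_mult_left center_pow_mult commut_center lam_mult center_pow)

lemma eps_mult_right:
  assumes "g \<in> carrier G" "h \<in> carrier G" "k \<in> carrier G"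
  shows "eps g (h \<otimes> k) = eps g h * eps g k"
  using assms
  by (simp add: eps_def commut_mult_right center_pow_mult commut_center lam_mult center_pow)

lemma eps_commute_one:
  assumes "commut G g h = \<one>"
  shows "eps g h = 1"
  using assms by (simp add: eps_def)

lemma eps_sym:
  assumes "g \<in> carrier G" "h \<in> carrier G"
  shows "eps g h = eps h g"
proof -
  have "eps g h * eps h g = eps (g \<otimes> h) (g \<otimes> h)"
    using assms by (simp add: eps_mult_left eps_mult_right del: eps_self) simp
  also have "\<dots> = 1" using assms by simp
  finally have "eps g h * eps h g = 1" .
  then show ?thesis using eps_cases[OF assms] eps_cases[OF assms(2,1)] by auto
qed

lemma q_mult:
  assumes "g \<in> carrier G" "h \<in> carrier G"
  shows "q (g \<otimes> h) = q g * q h * eps g h"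
proof -
  let ?c = "commut G h g"
  have c: "?c \<in> center G" using assms by (simp add: commut_center)
  have ch: "(2::nat) ^ r choose 2 = 2 ^ (r - 1) * (2 ^ r - 1)"
    by (simp add: choose_two two_pow_r)
  \<comment> \<open>The commutator is raised to \<open>2 ^ (r - 1)\<close> times an odd number, and
    an odd power of 1 or -1 is the number itself.\<close>
  have "odd ((2::nat) ^ r - 1)" using r_pos by simp
  then have "lam (?c [^] ((2::nat) ^ r choose 2)) = eps h g"
    using eps_cases[OF assms(2,1)] unfolding ch
    by (auto simp: lam_pow c power_mult eps_def simp flip: nat_pow_pow)
  then show ?thesis
    unfolding q_def using assms eps_sym[OF assms]
    by (simp add: pow_mult_commut lam_mult pow_n_center center_mult center_pow c)
qed

lemma q_one [simp]: "q \<one> = 1"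
  by (simp add: q_def)

lemma q_central: "z \<in> center G \<Longrightarrow> q z = 1"
  by (simp add: q_def center_exp)

lemma q_pow:
  assumes "g \<in> carrier G"
  shows "q (g [^] (k::nat)) = q g ^ k"
proof -
  have "(g [^] k) [^] (2 ^ r :: nat) = (g [^] (2 ^ r :: nat)) [^] k"
    using assms by (simp add: nat_pow_pow mult.commute)
  then show ?thesis by (simp add: q_def lam_pow pow_n_center assms)
qed

lemma eps_pow_left:
  "g \<in> carrier G \<Longrightarrow> h \<in> carrier G \<Longrightarrow> eps (g [^] (k::nat)) h = eps g h ^ k"
  by (induction k) (simp_all add: eps_mult_left)

lemma eps_pow_right:
  "g \<in> carrier G \<Longrightarrow> h \<in> carrier G \<Longrightarrow> eps g (h [^] (k::nat)) = eps g h ^ k"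
  by (induction k) (simp_all add: eps_mult_right)

section \<open>Gauss sums of planes and orthogonal splitting\<close>

lemma q_plane:
  assumes "x \<in> carrier G" "y \<in> carrier G"
  shows "q (x [^] (a::nat) \<otimes> y [^] (b::nat)) = q x ^ a * q y ^ b * eps x y ^ (a * b)"
  using assms by (simp add: q_mult q_pow eps_pow_left eps_pow_right flip: power_mult)

text \<open>If \<open>eps x y = -1\<close>, the sum over \<open>b\<close> is \<open>N\<close> for
  even \<open>a\<close> and cancels for odd \<open>a\<close>, so half of the rows survive and the
  total is \<open>M * N\<close>.\<close>

lemma plane_sum_pos:
  fixes N :: nat
  assumes xy: "x \<in> carrier G" "y \<in> carrier G" and "q x = 1" "q y = 1" and N: "even N" "N > 0"
  shows "\<exists>p>0. (\<Sum>a<N. \<Sum>b<N. q (x [^] a \<otimes> y [^] b)) = complex_of_real p"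
proof -
  obtain M where M: "N = 2 * M" using N by blast
  have eq: "(\<Sum>a<N. \<Sum>b<N. q (x [^] a \<otimes> y [^] b)) = (\<Sum>a<N. \<Sum>b<N. eps x y ^ (a * b))"
    using assms by (simp add: q_plane)
  show ?thesis
  proof (cases "eps x y = 1")
    case True
    then show ?thesis unfolding eq using N by (intro exI[of _ "real (N * N)"]) simp
  next
    case False
    then have "eps x y = -1" using eps_cases[OF xy] by auto
    then have "(\<Sum>a<N. \<Sum>b<N. eps x y ^ (a * b)) = of_nat (M * N)"
      by (simp add: M sum_lessThan_double power_add power_mult)
    then show ?thesis unfolding eq using M N by (intro exI[of _ "real (M * N)"]) auto
  qed
qed

text \<open>The summand is \<open>(-1) ^ (a + b + a * b)\<close>, which is 1 only if both exponents
  are even: a plane of Arf invariant one. Even rows cancel and odd rows give \<open>- N\<close>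
  each.\<close>

lemma plane_sum_neg:
  fixes N :: nat
  assumes xy: "x \<in> carrier G" "y \<in> carrier G"
    and "q x = -1" "q y = -1" "eps x y = -1" and N: "even N" "N > 0"
  shows "\<exists>p>0. (\<Sum>a<N. \<Sum>b<N. q (x [^] a \<otimes> y [^] b)) = - complex_of_real p"
proof -
  obtain M where M: "N = 2 * M" using N by blast
  have "(\<Sum>a<N. \<Sum>b<N. q (x [^] a \<otimes> y [^] b)) = - of_nat (M * N)"
    using assms by (simp add: q_plane M sum_lessThan_double power_add power_mult)
  then show ?thesis using M N by (intro exI[of _ "real (M * N)"]) auto
qed

lemma subgroup_pow_closed:
  assumes "subgroup C G" "x \<in> C"
  shows "x [^] (k::nat) \<in> C"
  using assms by (induction k) (auto intro: subgroup.m_closed subgroup.one_closed)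

definition plane_perp :: "'a set \<Rightarrow> 'a \<Rightarrow> 'a \<Rightarrow> 'a set" where
  "plane_perp C x y = {c \<in> C. commut G c x = \<one> \<and> commut G c y = \<one>}"

context
  fixes C x y z N
  assumes C: "subgroup C G" and x: "x \<in> C" and y: "y \<in> C"
    and z: "z = commut G x y" and N: "N = ord z"
    and Cy: "\<And>c. c \<in> C \<Longrightarrow> \<exists>i::nat. commut G c y = z [^] i"
    and Cx: "\<And>c. c \<in> C \<Longrightarrow> \<exists>i::nat. commut G c x = z [^] i"
begin

lemma Csub: "c \<in> C \<Longrightarrow> c \<in> carrier G"
  using C subgroup.mem_carrier by metis

lemma xy_carrier: "x \<in> carrier G" "y \<in> carrier G"
  using x y by (simp_all add: Csub)

lemma z_center: "z \<in> center G"
  by (simp add: z commut_center xy_carrier)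

lemma z_carrier: "z \<in> carrier G" using z_center by (rule center_sub)

lemma plane_perp_comm:
  assumes "c \<in> plane_perp C x y"
  shows "commut G (x [^] (a::nat) \<otimes> y [^] (b::nat)) c = \<one>"
proof -
  have c: "c \<in> carrier G" "commut G x c = \<one>" "commut G y c = \<one>"
    using assms commut_inv[of c x] commut_inv[of c y]
    by (auto simp: plane_perp_def Csub xy_carrier)
  then show ?thesis by (simp add: commut_mult_left commut_pow_left xy_carrier)
qed

lemma commut_xyc:
  assumes "c \<in> carrier G"
  shows "commut G (x [^] (a::nat) \<otimes> y [^] (b::nat) \<otimes> c) y = z [^] a \<otimes> commut G c y"
    "commut G (x [^] (a::nat) \<otimes> y [^] (b::nat) \<otimes> c) x = inv (z [^] b) \<otimes> commut G c x"
  using assms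
  by (simp_all add: commut_mult_left commut_pow_left xy_carrier z commut_inv[of x y] nat_pow_inv)

lemma z_pow_cong:
  assumes "z [^] (a::nat) = z [^] (a'::nat)" "a < N" "a' < N"
  shows "a = a'"
  using ord_inj[OF z_carrier] assms by (auto simp: inj_on_def N)

lemma z_pow_mod: "z [^] (i mod N) = z [^] i"
proof -
  have "z [^] i = z [^] (N * (i div N) + i mod N)" by simp
  also have "\<dots> = (z [^] N) [^] (i div N) \<otimes> z [^] (i mod N)"
    using z_carrier by (simp only: nat_pow_mult nat_pow_pow)
  also have "\<dots> = z [^] (i mod N)"
    using z_carrier by (simp add: N pow_ord_eq_1)
  finally show ?thesis by simp
qed

lemma N_pos: "N > 0"
  using ord_ge_1[OF fin z_carrier] by (simp add: N)

text \<open>The commutators of \<open>g\<close> with \<open>y\<close> and \<open>x\<close> determine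
  the exponents \<open>a\<close> and \<open>b\<close> modulo \<open>N\<close>. As both are powers of
  \<open>z\<close>, suitable exponents exist, and dividing by
  \<open>x [^] a \<otimes> y [^] b\<close> leaves an element of the complement.\<close>

lemma plane_bij:
  "bij_betw (\<lambda>((a, b), c). x [^] a \<otimes> y [^] b \<otimes> c) (({..<N} \<times> {..<N}) \<times> plane_perp C x y) C"
  unfolding bij_betw_def
proof
  show "inj_on (\<lambda>((a, b), c). x [^] a \<otimes> y [^] b \<otimes> c) (({..<N} \<times> {..<N}) \<times> plane_perp C x y)"
  proof (rule inj_onI)
    fix u v
    assume u: "u \<in> ({..<N} \<times> {..<N}) \<times> plane_perp C x y" and v: "v \<in> ({..<N} \<times> {..<N}) \<times> plane_perp C x y"
      and eq: "(\<lambda>((a, b), c). x [^] a \<otimes> y [^] b \<otimes> c) u =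
         (\<lambda>((a, b), c). x [^] a \<otimes> y [^] b \<otimes> c) v"
    obtain a b c where u': "u = ((a, b), c)" by (metis prod.collapse)
    obtain a' b' c' where v': "v = ((a', b'), c')" by (metis prod.collapse)
    have e: "x [^] a \<otimes> y [^] b \<otimes> c = x [^] a' \<otimes> y [^] b' \<otimes> c'"
      using eq by (simp add: u' v')
    have c: "c \<in> carrier G" "c' \<in> carrier G" "commut G c x = \<one>" "commut G c y = \<one>"
        "commut G c' x = \<one>" "commut G c' y = \<one>"
      using u v by (auto simp: u' v' plane_perp_def Csub)
    have "z [^] a = z [^] a'" "inv (z [^] b) = inv (z [^] b')"
      using arg_cong[OF e, of "\<lambda>w. commut G w y"] arg_cong[OF e, of "\<lambda>w. commut G w x"] c
      by (simp_all add: commut_xyc z_carrier)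
    then have ab: "a = a'" "b = b'" using u v z_carrier
      by (auto simp: u' v' intro!: z_pow_cong)
    then have "c = c'" using e c by (simp add: xy_carrier)
    then show "u = v" using ab by (simp add: u' v')
  qed
next
  show "(\<lambda>((a, b), c). x [^] a \<otimes> y [^] b \<otimes> c) ` (({..<N} \<times> {..<N}) \<times> plane_perp C x y) = C"
  proof (intro equalityI subsetI)
    fix g assume "g \<in> (\<lambda>((a, b), c). x [^] a \<otimes> y [^] b \<otimes> c) ` (({..<N} \<times> {..<N}) \<times> plane_perp C x y)"
    then show "g \<in> C" using x y
      by (auto simp: plane_perp_def intro!: subgroup.m_closed[OF C] subgroup_pow_closed C)
  next
    fix g assume g: "g \<in> C"
    obtain i j :: nat where i: "commut G g y = z [^] i" and j: "commut G g x = z [^] j"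
      using Cx Cy g by blast
    define a where "a = i mod N"
    \<comment> \<open>A representative of \<open>- j\<close> modulo \<open>N\<close>, because
      \<open>y [^] b\<close> contributes the inverse of \<open>z [^] b\<close> to the commutator
      with \<open>x\<close>.\<close>
    define b where "b = (N - j mod N) mod N"
    define c where "c = inv (x [^] a \<otimes> y [^] b) \<otimes> g"
    have gc: "g \<in> carrier G" using g by (rule Csub)
    have cC: "c \<in> C" unfolding c_def using g x y
      by (intro subgroup.m_closed[OF C] subgroup.m_inv_closed[OF C]) (auto intro: subgroup_pow_closed C)
    have cc: "c \<in> carrier G" using cC by (rule Csub)
    have geq: "g = x [^] a \<otimes> y [^] b \<otimes> c"
      using gc by (simp add: c_def xy_carrier m_assoc[symmetric] del: inv_mult_group)
    have "z [^] a \<otimes> commut G c y = z [^] a \<otimes> \<one>"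
    proof -
      have "z [^] a = commut G g y" unfolding a_def i by (rule z_pow_mod)
      also have "\<dots> = z [^] a \<otimes> commut G c y"
        by (subst geq) (rule commut_xyc(1)[OF cc])
      finally show ?thesis using z_carrier by simp
    qed
    then have 1: "commut G c y = \<one>" using z_carrier cc xy_carrier
      by (subst (asm) l_cancel) auto
    have "z [^] b \<otimes> z [^] j = z [^] (b + j)" using z_carrier by (simp add: nat_pow_mult)
    also have "\<dots> = z [^] ((b + j) mod N)" by (simp add: z_pow_mod)
    also have "(b + j) mod N = 0"
    proof -
      have "(b + j) mod N = ((N - j mod N) + j mod N) mod N"
        unfolding b_def by (metis mod_add_left_eq mod_add_right_eq)
      also have "\<dots> = 0" using mod_less_divisor[OF N_pos, of j] by simp
      finally show ?thesis .
    qed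
    finally have "z [^] b \<otimes> z [^] j = \<one>" by simp
    then have "z [^] j = inv (z [^] b)" using z_carrier
      by (metis inv_equality inv_inv nat_pow_closed)
    then have "inv (z [^] b) \<otimes> commut G c x = inv (z [^] b) \<otimes> \<one>"
    proof -
      assume "z [^] j = inv (z [^] b)"
      then have "inv (z [^] b) = commut G g x" using j by simp
      also have "\<dots> = inv (z [^] b) \<otimes> commut G c x"
        by (subst geq) (rule commut_xyc(2)[OF cc])
      finally show ?thesis using z_carrier by simp
    qed
    then have 2: "commut G c x = \<one>" using z_carrier cc xy_carrier
      by (subst (asm) l_cancel) auto
    have "((a, b), c) \<in> ({..<N} \<times> {..<N}) \<times> plane_perp C x y"
      using N_pos cC 1 2 by (simp add: a_def b_def plane_perp_def)
    then show "g \<in> (\<lambda>((a, b), c). x [^] a \<otimes> y [^] b \<otimes> c) ` (({..<N} \<times> {..<N}) \<times> plane_perp C x y)"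
      by (rule rev_image_eqI) (use geq in simp)
  qed
qed

text \<open>Elements of the complement commute with the plane, so \<open>eps\<close> is 1 between
  the two and \<open>q\<close> is multiplicative along the decomposition of
  \<open>plane_bij\<close>.\<close>

lemma plane_split_sum:
  "(\<Sum>g\<in>C. q g) = (\<Sum>a<N. \<Sum>b<N. q (x [^] a \<otimes> y [^] b)) * (\<Sum>c\<in>plane_perp C x y. q c)"
proof -
  have "(\<Sum>g\<in>C. q g) =
      (\<Sum>((a, b), c)\<in>({..<N} \<times> {..<N}) \<times> plane_perp C x y. q (x [^] a \<otimes> y [^] b \<otimes> c))"
    by (subst sum.reindex_bij_betw[OF plane_bij, symmetric]) (simp add: case_prod_unfold)
  also have "\<dots> = (\<Sum>((a, b), c)\<in>({..<N} \<times> {..<N}) \<times> plane_perp C x y. q (x [^] a \<otimes> y [^] b) * q c)"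
    by (intro sum.cong refl)
       (auto simp: q_mult xy_carrier Csub plane_perp_comm eps_commute_one plane_perp_def)
  also have "\<dots> = (\<Sum>a<N. \<Sum>b<N. q (x [^] a \<otimes> y [^] b)) * (\<Sum>c\<in>plane_perp C x y. q c)"
    by (simp only: sum.cartesian_product sum_product) (simp add: case_prod_unfold)
  finally show ?thesis .
qed

lemma subgroup_plane_perp: "subgroup (plane_perp C x y) G"
proof (rule subgroupI)
  show "plane_perp C x y \<subseteq> carrier G" by (auto simp: plane_perp_def Csub)
  show "plane_perp C x y \<noteq> {}" using subgroup.one_closed[OF C]
    by (auto simp: plane_perp_def commut_central xy_carrier intro!: exI[of _ \<one>])
next
  fix a assume a: "a \<in> plane_perp C x y"
  then have ac: "a \<in> carrier G" "a \<in> C" by (auto simp: plane_perp_def Csub)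
  have "commut G (inv a) h = \<one>" if "commut G a h = \<one>" "h \<in> carrier G" for h
    using that ac commut_mult_left[of h a "inv a"] by (simp add: commut_central)
  then show "inv a \<in> plane_perp C x y"
    using a ac subgroup.m_inv_closed[OF C] by (auto simp: plane_perp_def xy_carrier)
next
  fix a b assume "a \<in> plane_perp C x y" "b \<in> plane_perp C x y"
  then show "a \<otimes> b \<in> plane_perp C x y"
    using subgroup.m_closed[OF C]
    by (auto simp: plane_perp_def xy_carrier Csub commut_mult_left)
qed

end

end

section \<open>Presented groups\<close>

lemma word_eq_context: "word_eq R u v \<Longrightarrow> word_eq R (a @ u @ b) (a @ v @ b)"
proof (induction rule: word_eq.induct)
  case (cancel u c d v)
  show ?case using word_eq.cancel[of R "a @ u" c d "v @ b"] by simp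
next
  case (relation l r u v)
  then show ?case using word_eq.relation[of l r R "a @ u" "v @ b"] by simp
qed (blast intro: word_eq.refl word_eq.sym word_eq.trans)+

lemma word_eq_append:
  assumes "word_eq R u u'" "word_eq R v v'"
  shows "word_eq R (u @ v) (u' @ v')"
  using word_eq_context[OF assms(1), of "[]" v] word_eq_context[OF assms(2), of u' "[]"]
  by (auto intro: word_eq.trans)

definition word_class :: "('x word \<times> 'x word) set \<Rightarrow> 'x word \<Rightarrow> 'x word set" where
  "word_class R w = {v. word_eq R w v}"

lemma word_class_eq_iff: "word_class R u = word_class R v \<longleftrightarrow> word_eq R u v"
  unfolding word_class_def
  by (auto intro: word_eq.refl word_eq.trans word_eq.sym)

lemma carrier_presented_group: "carrier (presented_group R) = range (word_class R)"
  by (auto simp: presented_group_def quotient_def word_class_def)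

lemma mult_presented_group:
  "word_class R u \<otimes>\<^bsub>presented_group R\<^esub> word_class R v = word_class R (u @ v)"
proof -
  have "(\<exists>u'\<in>word_class R u. \<exists>v'\<in>word_class R v. word_eq R (u' @ v') w) \<longleftrightarrow> word_eq R (u @ v) w" for w
  proof
    assume "\<exists>u'\<in>word_class R u. \<exists>v'\<in>word_class R v. word_eq R (u' @ v') w"
    then obtain u' v' where "word_eq R u u'" "word_eq R v v'" "word_eq R (u' @ v') w"
      by (auto simp: word_class_def)
    then show "word_eq R (u @ v) w" by (metis word_eq.trans word_eq_append)
  next
    assume "word_eq R (u @ v) w"
    then show "\<exists>u'\<in>word_class R u. \<exists>v'\<in>word_class R v. word_eq R (u' @ v') w"
      by (intro bexI[of _ u] bexI[of _ v]) (auto simp: word_class_def intro: word_eq.refl)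
  qed
  then show ?thesis by (simp add: presented_group_def) (simp add: word_class_def)
qed

lemma one_presented_group: "\<one>\<^bsub>presented_group R\<^esub> = word_class R []"
  by (simp add: presented_group_def word_class_def)

lemma word_inv_left: "word_eq R (word_inv w @ w) []"
proof (induction w)
  case Nil then show ?case by (simp add: word_inv_def word_eq.refl)
next
  case (Cons p w)
  obtain a b where p: "p = (a, b)" by (cases p)
  have "word_eq R (word_inv w @ [(a, \<not> b), (a, \<not> \<not> b)] @ w) (word_inv w @ w)"
    by (rule word_eq.cancel)
  then show ?case using Cons by (simp add: p word_inv_def) (blast intro: word_eq.trans)
qed

lemma group_presented_group: "group (presented_group R)"
proof (rule groupI)
  fix A assume "A \<in> carrier (presented_group R)"
  then obtain w where "A = word_class R w" by (auto simp: carrier_presented_group)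
  then show "\<exists>B\<in>carrier (presented_group R). B \<otimes>\<^bsub>presented_group R\<^esub> A = \<one>\<^bsub>presented_group R\<^esub>"
    by (intro bexI[of _ "word_class R (word_inv w)"])
       (auto simp: mult_presented_group one_presented_group carrier_presented_group
          word_class_eq_iff word_inv_left)
qed (auto simp: carrier_presented_group mult_presented_group one_presented_group)

primrec word_eval :: "('a, 'b) monoid_scheme \<Rightarrow> ('x \<Rightarrow> 'a) \<Rightarrow> 'x word \<Rightarrow> 'a" where
  "word_eval G f [] = \<one>\<^bsub>G\<^esub>"
| "word_eval G f (p # w) = (if snd p then f (fst p) else inv\<^bsub>G\<^esub> (f (fst p))) \<otimes>\<^bsub>G\<^esub> word_eval G f w"

context group
begin

lemma inv_mult_cancel:
  assumes "a \<in> carrier G" "b \<in> carrier G"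
  shows "inv a \<otimes> (a \<otimes> b) = b" "a \<otimes> (inv a \<otimes> b) = b"
  using assms by (simp_all flip: m_assoc)

lemma inv_commute:
  assumes "a \<in> carrier G" "b \<in> carrier G" "a \<otimes> b = b \<otimes> a"
  shows "inv a \<otimes> b = b \<otimes> inv a"
proof -
  have "inv a \<otimes> b = inv a \<otimes> (b \<otimes> a) \<otimes> inv a" using assms(1,2) by (simp add: m_assoc)
  also have "\<dots> = b \<otimes> inv a" using assms by (simp add: inv_mult_cancel flip: assms(3))
  finally show ?thesis .
qed

context
  fixes f :: "'x \<Rightarrow> 'a"
  assumes f: "\<And>a. f a \<in> carrier G"
begin

lemma word_eval_closed [simp]: "word_eval G f w \<in> carrier G"
  by (induction w) (auto simp: f)

lemma word_eval_append: "word_eval G f (u @ v) = word_eval G f u \<otimes> word_eval G f v"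
  by (induction u) (auto simp: f m_assoc)

lemma word_eval_pow: "word_eval G f (word_pow w n) = word_eval G f w [^] n"
proof (induction n)
  case (Suc n)
  then show ?case
    by (simp add: word_pow_def word_eval_append flip: nat_pow_Suc2)
qed (simp add: word_pow_def)

lemma word_eval_inv: "word_eval G f (word_inv w) = inv (word_eval G f w)"
  by (induction w) (auto simp: word_inv_def word_eval_append f inv_mult_group)

lemma word_eval_comm:
  "word_eval G f (word_comm u v) = commut G (word_eval G f u) (word_eval G f v)"
  by (simp add: word_comm_def commut_def word_eval_append word_eval_inv m_assoc)

lemma word_eval_cong:
  assumes "word_eq R u v" "\<And>l r. (l, r) \<in> R \<Longrightarrow> word_eval G f l = word_eval G f r"
  shows "word_eval G f u = word_eval G f v"
  using assms(1)
proof induction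
  case (cancel u a b v)
  then show ?case by (auto simp: word_eval_append f m_assoc inv_mult_cancel)
qed (auto simp: word_eval_append assms(2))

text \<open>Von Dyck's theorem. A class is evaluated at an arbitrarily chosen word in it, and
  \<open>word_eval_cong\<close> makes the choice irrelevant.\<close>

lemma presented_group_universal:
  assumes "\<And>l r. (l, r) \<in> R \<Longrightarrow> word_eval G f l = word_eval G f r"
  shows "\<exists>\<psi>\<in>hom (presented_group R) G. \<forall>w. \<psi> (word_class R w) = word_eval G f w"
proof -
  define \<psi> where "\<psi> A = word_eval G f (SOME w. w \<in> A)" for A
  have *: "\<psi> (word_class R w) = word_eval G f w" for w
  proof -
    have "w \<in> word_class R w" by (simp add: word_class_def word_eq.refl)
    then have "(SOME v. v \<in> word_class R w) \<in> word_class R w" by (rule someI)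
    then show ?thesis
      unfolding \<psi>_def using word_eval_cong[OF _ assms] by (metis mem_Collect_eq word_class_def)
  qed
  then show ?thesis
    by (intro bexI[of _ \<psi>])
       (auto simp: hom_def carrier_presented_group mult_presented_group word_eval_append)
qed

end

end

lemma word_eval_presented_group:
  "word_eval (presented_group R) (\<lambda>a. word_class R [(a, True)]) w = word_class R w"
proof (induction w)
  case Nil then show ?case by (simp add: one_presented_group)
next
  case (Cons p w)
  interpret group "presented_group R" by (rule group_presented_group)
  have "inv\<^bsub>presented_group R\<^esub> (word_class R [(a, True)]) = word_class R [(a, False)]" for a
    using word_eq.cancel[of R "[]" a False "[]"]
    by (intro inv_equality)
       (auto simp: mult_presented_group one_presented_group carrier_presented_group word_class_eq_iff)
  then show ?case using Cons by (cases p) (auto simp: mult_presented_group)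
qed

text \<open>The flag \<open>e\<close> distinguishes \<open>Q\<close> from \<open>D\<close>. The
  presentations differ only in the values of the \<open>2 ^ s\<close>-th powers of \<open>x\<close>
  and \<open>y\<close>, so normal form, centre and finiteness can be treated once for both.\<close>

definition DQ_presentation :: "bool \<Rightarrow> nat \<Rightarrow> (gen word \<times> gen word) set" where
  "DQ_presentation e s = (if e then
     {(word_pow gz (2 ^ s), []),
      (word_pow gx (2 ^ s), word_pow gz (2 ^ (s - 1))),
      (word_pow gz (2 ^ (s - 1)), word_pow gy (2 ^ s)),
      (word_comm gx gz, []), (word_comm gx gy, gz), (word_comm gz gy, [])}
    else
     {(word_pow gx (2 ^ s), []), (word_pow gz (2 ^ s), []), (word_pow gy (2 ^ s), []),
      (word_comm gx gz, []), (word_comm gx gy, gz), (word_comm gz gy, [])})"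

abbreviation DQ_group :: "bool \<Rightarrow> nat \<Rightarrow> gen word set monoid" where
  "DQ_group e s \<equiv> presented_group (DQ_presentation e s)"

lemma D_group_eq: "D_group s = DQ_group False s"
  by (simp add: D_group_def DQ_presentation_def)

lemma Q_group_eq: "Q_group s = DQ_group True s"
  by (simp add: Q_group_def DQ_presentation_def)

definition DQ_relations :: "('a, 'b) monoid_scheme \<Rightarrow> bool \<Rightarrow> nat \<Rightarrow> 'a \<Rightarrow> 'a \<Rightarrow> 'a \<Rightarrow> bool" where
  "DQ_relations G e s x y z \<longleftrightarrow> x \<in> carrier G \<and> y \<in> carrier G \<and> z \<in> carrier G \<and>
     z [^]\<^bsub>G\<^esub> (2 ^ s :: nat) = \<one>\<^bsub>G\<^esub> \<and>
     x [^]\<^bsub>G\<^esub> (2 ^ s :: nat) = (if e then z [^]\<^bsub>G\<^esub> (2 ^ (s - 1) :: nat) else \<one>\<^bsub>G\<^esub>) \<and>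
     y [^]\<^bsub>G\<^esub> (2 ^ s :: nat) = (if e then z [^]\<^bsub>G\<^esub> (2 ^ (s - 1) :: nat) else \<one>\<^bsub>G\<^esub>) \<and>
     commut G x z = \<one>\<^bsub>G\<^esub> \<and> commut G x y = z \<and> commut G z y = \<one>\<^bsub>G\<^esub>"

lemma (in group) DQ_relations_iff:
  assumes "\<And>a. f a \<in> carrier G"
  shows "(\<forall>(l, r)\<in>DQ_presentation e s. word_eval G f l = word_eval G f r) \<longleftrightarrow>
    DQ_relations G e s (f Gen_x) (f Gen_y) (f Gen_z1)"
  using assms
  by (auto simp: word_eval_pow word_eval_comm DQ_relations_def DQ_presentation_def)

definition DQ_gen :: "bool \<Rightarrow> nat \<Rightarrow> gen \<Rightarrow> gen word set" where
  "DQ_gen e s a = word_class (DQ_presentation e s) [(a, True)]"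

lemma DQ_gen_closed [simp]: "DQ_gen e s a \<in> carrier (DQ_group e s)"
  by (simp add: DQ_gen_def carrier_presented_group)

lemma DQ_gen_relations:
  "DQ_relations (DQ_group e s) e s (DQ_gen e s Gen_x) (DQ_gen e s Gen_y) (DQ_gen e s Gen_z1)"
proof -
  interpret group "DQ_group e s" by (rule group_presented_group)
  have "(\<forall>(l, r)\<in>DQ_presentation e s.
      word_eval (DQ_group e s) (DQ_gen e s) l = word_eval (DQ_group e s) (DQ_gen e s) r)"
    using word_eq.relation[of _ _ "DQ_presentation e s" "[]" "[]"]
    by (auto simp: DQ_gen_def [abs_def] word_eval_presented_group word_class_eq_iff)
  then show ?thesis by (subst (asm) DQ_relations_iff) auto
qed

lemma (in group) DQ_universal:
  assumes "DQ_relations G e s x y z"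
  obtains \<psi> where "\<psi> \<in> hom (DQ_group e s) G" "\<psi> (DQ_gen e s Gen_x) = x"
    "\<psi> (DQ_gen e s Gen_y) = y" "\<psi> (DQ_gen e s Gen_z1) = z"
proof -
  define f where "f = case_gen x z y"
  have f: "f a \<in> carrier G" for a
    using assms by (cases a) (auto simp: f_def DQ_relations_def)
  have "\<exists>\<psi>\<in>hom (DQ_group e s) G.
      \<forall>w. \<psi> (word_class (DQ_presentation e s) w) = word_eval G f w"
    using DQ_relations_iff[of f e s] f assms by (intro presented_group_universal) (auto simp: f_def)
  then obtain \<psi> where \<psi>: "\<psi> \<in> hom (DQ_group e s) G"
      "\<And>w. \<psi> (word_class (DQ_presentation e s) w) = word_eval G f w" by auto
  show ?thesis
    by (rule that[OF \<psi>(1)]) (use f \<psi>(2) in \<open>simp_all add: DQ_gen_def\<close>, simp_all add: f_def)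
qed

lemma DQ_gen_induct [consumes 1, case_names one mult inv]:
  assumes "g \<in> carrier (DQ_group e s)"
    and "P \<one>\<^bsub>DQ_group e s\<^esub>"
    and "\<And>a h. h \<in> carrier (DQ_group e s) \<Longrightarrow> P h \<Longrightarrow> P (DQ_gen e s a \<otimes>\<^bsub>DQ_group e s\<^esub> h)"
    and "\<And>a h. h \<in> carrier (DQ_group e s) \<Longrightarrow> P h \<Longrightarrow> P (inv\<^bsub>DQ_group e s\<^esub> (DQ_gen e s a) \<otimes>\<^bsub>DQ_group e s\<^esub> h)"
  shows "P g"
proof -
  interpret group "DQ_group e s" by (rule group_presented_group)
  obtain w where w: "g = word_class (DQ_presentation e s) w"
    using assms(1) by (auto simp: carrier_presented_group)
  have "P (word_eval (DQ_group e s) (DQ_gen e s) w)"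
    by (induction w) (use assms in auto)
  then show ?thesis by (simp add: w DQ_gen_def [abs_def] word_eval_presented_group)
qed

section \<open>Normal forms in \<open>D\<close> and \<open>Q\<close>\<close>

context group
begin

text \<open>Stated for a triple in an arbitrary group, since it is used before the presented groups
  are known to have class two.\<close>

lemma pow_swap_commut:
  assumes x: "x \<in> carrier G" and y: "y \<in> carrier G" and z: "z \<in> carrier G"
    and "commut G x y = z" "commut G x z = \<one>" "commut G z y = \<one>"
  shows "y [^] (b::nat) \<otimes> x [^] (a::nat) = x [^] a \<otimes> y [^] b \<otimes> inv z [^] (a * b)"
proof -
  have zx: "inv z \<otimes> x = x \<otimes> inv z" and zy: "inv z \<otimes> y = y \<otimes> inv z"
    using assms commut_one_iff[of x z] commut_one_iff[of z y]
    by (metis inv_commute)+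
  have zxk: "inv z [^] k \<otimes> x [^] (a::nat) = x [^] a \<otimes> inv z [^] k"
   and zyk: "inv z [^] k \<otimes> y [^] (a::nat) = y [^] a \<otimes> inv z [^] k" for k a :: nat
    using zx zy x y z by (metis group_commutes_pow nat_pow_closed inv_closed)+
  have yx: "y \<otimes> x = x \<otimes> y \<otimes> inv z"
    using commut_swap[OF x y] assms by (simp add: m_assoc)
  have 1: "y \<otimes> x [^] a = x [^] a \<otimes> y \<otimes> inv z [^] a" for a :: nat
  proof (induction a)
    case (Suc a)
    have "y \<otimes> x [^] Suc a = x [^] a \<otimes> y \<otimes> (inv z [^] a \<otimes> x)"
      using Suc x y z by (simp add: m_assoc[symmetric])
    also have "\<dots> = x [^] a \<otimes> (y \<otimes> x) \<otimes> inv z [^] a"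
      using zxk[of a 1] x y z by (simp add: m_assoc)
    also have "\<dots> = x [^] Suc a \<otimes> y \<otimes> inv z [^] Suc a"
      using x y z nat_pow_comm[of "inv z" 1 a] by (simp add: yx m_assoc)
    finally show ?case .
  qed (use y in simp)
  show ?thesis
  proof (induction b)
    case (Suc b)
    have "y [^] Suc b \<otimes> x [^] a = y [^] b \<otimes> (x [^] a \<otimes> y \<otimes> inv z [^] a)"
      using x y z by (simp add: m_assoc 1)
    also have "\<dots> = x [^] a \<otimes> y [^] b \<otimes> (inv z [^] (a * b) \<otimes> y) \<otimes> inv z [^] a"
      using Suc x y z by (simp add: m_assoc[symmetric])
    also have "\<dots> = x [^] a \<otimes> y [^] b \<otimes> y \<otimes> (inv z [^] (a * b) \<otimes> inv z [^] a)"
      using zyk[of "a * b" 1] x y z by (simp add: m_assoc)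
    also have "\<dots> = x [^] a \<otimes> y [^] Suc b \<otimes> inv z [^] (a * Suc b)"
      using x y z by (simp add: m_assoc nat_pow_mult add.commute)
    finally show ?case .
  qed (use x in simp)
qed

end

context
  fixes e :: bool and s :: nat
  assumes s: "s \<ge> 1"
begin

interpretation DG: group "DQ_group e s" by (rule group_presented_group)

lemma DQ_gen_rels:
  "(DQ_gen e s Gen_z1) [^]\<^bsub>DQ_group e s\<^esub> (2 ^ s :: nat) = \<one>\<^bsub>DQ_group e s\<^esub>"
  "(DQ_gen e s Gen_x) [^]\<^bsub>DQ_group e s\<^esub> (2 ^ s :: nat) = (if e then (DQ_gen e s Gen_z1) [^]\<^bsub>DQ_group e s\<^esub> (2 ^ (s - 1) :: nat) else \<one>\<^bsub>DQ_group e s\<^esub>)"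
  "(DQ_gen e s Gen_y) [^]\<^bsub>DQ_group e s\<^esub> (2 ^ s :: nat) = (if e then (DQ_gen e s Gen_z1) [^]\<^bsub>DQ_group e s\<^esub> (2 ^ (s - 1) :: nat) else \<one>\<^bsub>DQ_group e s\<^esub>)"
  "commut (DQ_group e s) (DQ_gen e s Gen_x) (DQ_gen e s Gen_z1) = \<one>\<^bsub>DQ_group e s\<^esub>" "commut (DQ_group e s) (DQ_gen e s Gen_x) (DQ_gen e s Gen_y) = (DQ_gen e s Gen_z1)" "commut (DQ_group e s) (DQ_gen e s Gen_z1) (DQ_gen e s Gen_y) = \<one>\<^bsub>DQ_group e s\<^esub>"
  using DQ_gen_relations[of e s] by (auto simp: DQ_relations_def)

lemma DQ_Z_center: "(DQ_gen e s Gen_z1) \<in> center (DQ_group e s)"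
proof -
  have gen: "(DQ_gen e s Gen_z1) \<otimes>\<^bsub>DQ_group e s\<^esub> DQ_gen e s a = DQ_gen e s a \<otimes>\<^bsub>DQ_group e s\<^esub> (DQ_gen e s Gen_z1)" for a
    using DQ_gen_rels(4,6) by (cases a) (simp_all add: DG.commut_one_iff)
  have "(DQ_gen e s Gen_z1) \<otimes>\<^bsub>DQ_group e s\<^esub> g = g \<otimes>\<^bsub>DQ_group e s\<^esub> (DQ_gen e s Gen_z1)" if "g \<in> carrier (DQ_group e s)" for g
    using that
  proof (induction rule: DQ_gen_induct)
    case (mult a h)
    then show ?case by (metis DG.m_assoc DQ_gen_closed gen)
  next
    case (inv a h)
    have "(DQ_gen e s Gen_z1) \<otimes>\<^bsub>DQ_group e s\<^esub> inv\<^bsub>DQ_group e s\<^esub> (DQ_gen e s a) = inv\<^bsub>DQ_group e s\<^esub> (DQ_gen e s a) \<otimes>\<^bsub>DQ_group e s\<^esub> (DQ_gen e s Gen_z1)"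
      by (rule DG.inv_commute[symmetric]) (simp_all add: gen)
    then show ?case using inv by (metis DG.m_assoc DQ_gen_closed DG.inv_closed)
  qed simp
  then show ?thesis by (simp add: center_def)
qed

lemma DQ_Z_inv_pow: "inv\<^bsub>DQ_group e s\<^esub> (DQ_gen e s Gen_z1) [^]\<^bsub>DQ_group e s\<^esub> (k::nat) = (DQ_gen e s Gen_z1) [^]\<^bsub>DQ_group e s\<^esub> ((2 ^ s - 1) * k)"
proof -
  have "(DQ_gen e s Gen_z1) [^]\<^bsub>DQ_group e s\<^esub> (2 ^ s - 1 :: nat) \<otimes>\<^bsub>DQ_group e s\<^esub> (DQ_gen e s Gen_z1) = (DQ_gen e s Gen_z1) [^]\<^bsub>DQ_group e s\<^esub> (Suc (2 ^ s - 1) :: nat)"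
    by (rule DG.nat_pow_Suc[symmetric])
  also have "Suc (2 ^ s - 1) = 2 ^ s" by simp
  finally have "inv\<^bsub>DQ_group e s\<^esub> (DQ_gen e s Gen_z1) = (DQ_gen e s Gen_z1) [^]\<^bsub>DQ_group e s\<^esub> (2 ^ s - 1 :: nat)"
    by (intro DG.inv_equality) (simp_all add: DQ_gen_rels)
  then show ?thesis by (simp add: DG.nat_pow_pow)
qed

text \<open>Only the additivity of the first two exponents matters. The existential \<open>k\<close>
  absorbs all powers of \<open>z1\<close>, and the first two exponents do not change when the
  factors are exchanged, which will give class two.\<close>

lemma DQ_nf_mult:
  "\<exists>k. ((DQ_gen e s Gen_x) [^]\<^bsub>DQ_group e s\<^esub> a \<otimes>\<^bsub>DQ_group e s\<^esub> (DQ_gen e s Gen_y) [^]\<^bsub>DQ_group e s\<^esub> b \<otimes>\<^bsub>DQ_group e s\<^esub> (DQ_gen e s Gen_z1) [^]\<^bsub>DQ_group e s\<^esub> (c::nat)) \<otimes>\<^bsub>DQ_group e s\<^esub>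
     ((DQ_gen e s Gen_x) [^]\<^bsub>DQ_group e s\<^esub> a' \<otimes>\<^bsub>DQ_group e s\<^esub> (DQ_gen e s Gen_y) [^]\<^bsub>DQ_group e s\<^esub> b' \<otimes>\<^bsub>DQ_group e s\<^esub> (DQ_gen e s Gen_z1) [^]\<^bsub>DQ_group e s\<^esub> (c'::nat)) =
     (DQ_gen e s Gen_x) [^]\<^bsub>DQ_group e s\<^esub> (a + a' :: nat) \<otimes>\<^bsub>DQ_group e s\<^esub> (DQ_gen e s Gen_y) [^]\<^bsub>DQ_group e s\<^esub> (b + b' :: nat) \<otimes>\<^bsub>DQ_group e s\<^esub> (DQ_gen e s Gen_z1) [^]\<^bsub>DQ_group e s\<^esub> (k :: nat)"
proof -
  let ?m = "\<lambda>u v. u \<otimes>\<^bsub>DQ_group e s\<^esub> v"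
  let ?x = "(DQ_gen e s Gen_x) [^]\<^bsub>DQ_group e s\<^esub> a" and ?y = "(DQ_gen e s Gen_y) [^]\<^bsub>DQ_group e s\<^esub> b" and ?z = "(DQ_gen e s Gen_z1) [^]\<^bsub>DQ_group e s\<^esub> c"
  let ?x' = "(DQ_gen e s Gen_x) [^]\<^bsub>DQ_group e s\<^esub> a'" and ?y' = "(DQ_gen e s Gen_y) [^]\<^bsub>DQ_group e s\<^esub> b'" and ?z' = "(DQ_gen e s Gen_z1) [^]\<^bsub>DQ_group e s\<^esub> c'"
  let ?w = "(DQ_gen e s Gen_z1) [^]\<^bsub>DQ_group e s\<^esub> ((2 ^ s - 1) * (a' * b))"
  have zc: "?z \<in> center (DQ_group e s)" "?w \<in> center (DQ_group e s)" using DQ_Z_center by (simp_all add: DG.center_pow)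
  have "?m (?m (?m ?x ?y) ?z) (?m (?m ?x' ?y') ?z') = ?m (?m ?x ?y) (?m (?m ?z (?m ?x' ?y')) ?z')"
    by (simp add: DG.m_assoc)
  also have "\<dots> = ?m (?m ?x ?y) (?m (?m (?m ?x' ?y') ?z) ?z')"
    using center_comm[OF zc(1), of "?m ?x' ?y'"] by simp
  also have "\<dots> = ?m ?x (?m (?m ?y ?x') (?m ?y' (?m ?z ?z')))"
    by (simp add: DG.m_assoc)
  also have "?m ?y ?x' = ?m (?m ?x' ?y) ?w"
    using DG.pow_swap_commut[of "DQ_gen e s Gen_x" "DQ_gen e s Gen_y" "DQ_gen e s Gen_z1" b a'] by (simp add: DQ_gen_rels DQ_Z_inv_pow)
  also have "?m ?x (?m (?m (?m ?x' ?y) ?w) (?m ?y' (?m ?z ?z'))) =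
      ?m (?m (?m ?x ?x') ?y) (?m (?m ?w ?y') (?m ?z ?z'))"
    by (simp add: DG.m_assoc)
  also have "\<dots> = ?m (?m (?m ?x ?x') ?y) (?m (?m ?y' ?w) (?m ?z ?z'))"
    using center_comm[OF zc(2), of ?y'] by simp
  also have "\<dots> = ?m (?m (?m ?x ?x') (?m ?y ?y')) (?m ?w (?m ?z ?z'))"
    by (simp add: DG.m_assoc)
  finally show ?thesis by (simp only: DG.nat_pow_mult DQ_gen_closed) blast
qed

text \<open>In both families the \<open>2 ^ s\<close>-th power of a generator has square 1. Inverses
  of generators are thus positive powers, and normal forms with natural exponents suffice.\<close>

lemma DQ_gen_double_pow: "DQ_gen e s a [^]\<^bsub>DQ_group e s\<^esub> (2 * 2 ^ s :: nat) = \<one>\<^bsub>DQ_group e s\<^esub>"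
proof -
  have "DQ_gen e s a [^]\<^bsub>DQ_group e s\<^esub> (2 ^ s * 2 :: nat) = (DQ_gen e s a [^]\<^bsub>DQ_group e s\<^esub> (2 ^ s :: nat)) [^]\<^bsub>DQ_group e s\<^esub> (2::nat)"
    by (simp add: DG.nat_pow_pow)
  also have "\<dots> = \<one>\<^bsub>DQ_group e s\<^esub>"
  proof -
    have "(2::nat) ^ (s - 1) * 2 = 2 ^ s" using s by (cases s) auto
    then have "((DQ_gen e s Gen_z1) [^]\<^bsub>DQ_group e s\<^esub> (2 ^ (s - 1) :: nat)) [^]\<^bsub>DQ_group e s\<^esub> (2::nat) = \<one>\<^bsub>DQ_group e s\<^esub>"
      using DQ_gen_rels(1) by (simp add: DG.nat_pow_pow)
    moreover have "DQ_gen e s a [^]\<^bsub>DQ_group e s\<^esub> (2 ^ s :: nat) \<in> {\<one>\<^bsub>DQ_group e s\<^esub>, (DQ_gen e s Gen_z1) [^]\<^bsub>DQ_group e s\<^esub> (2 ^ (s - 1) :: nat)}"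
      using DQ_gen_rels(1-3) by (cases a) auto
    ultimately show ?thesis by auto
  qed
  finally show ?thesis by (simp add: mult.commute)
qed

lemma DQ_nf:
  assumes "g \<in> carrier (DQ_group e s)"
  shows "\<exists>(a::nat) (b::nat) (c::nat). g = (DQ_gen e s Gen_x) [^]\<^bsub>DQ_group e s\<^esub> a \<otimes>\<^bsub>DQ_group e s\<^esub> (DQ_gen e s Gen_y) [^]\<^bsub>DQ_group e s\<^esub> b \<otimes>\<^bsub>DQ_group e s\<^esub> (DQ_gen e s Gen_z1) [^]\<^bsub>DQ_group e s\<^esub> c"
    (is "?P g")
proof -
  have nf_mult: "?P (g \<otimes>\<^bsub>DQ_group e s\<^esub> h)" if gh: "?P g" "?P h" for g h
  proof -
    obtain a b c :: nat where
      g: "g = (DQ_gen e s Gen_x) [^]\<^bsub>DQ_group e s\<^esub> a \<otimes>\<^bsub>DQ_group e s\<^esub> (DQ_gen e s Gen_y) [^]\<^bsub>DQ_group e s\<^esub> b \<otimes>\<^bsub>DQ_group e s\<^esub> (DQ_gen e s Gen_z1) [^]\<^bsub>DQ_group e s\<^esub> c"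
      using gh(1) by blast
    obtain a' b' c' :: nat where
      h: "h = (DQ_gen e s Gen_x) [^]\<^bsub>DQ_group e s\<^esub> a' \<otimes>\<^bsub>DQ_group e s\<^esub> (DQ_gen e s Gen_y) [^]\<^bsub>DQ_group e s\<^esub> b' \<otimes>\<^bsub>DQ_group e s\<^esub> (DQ_gen e s Gen_z1) [^]\<^bsub>DQ_group e s\<^esub> c'"
      using gh(2) by blast
    show ?thesis unfolding g h using DQ_nf_mult[of a b c a' b' c'] by blast
  qed
  have pow: "?P (DQ_gen e s a [^]\<^bsub>DQ_group e s\<^esub> (k::nat))" for a k
  proof (cases a)
    case Gen_x
    show ?thesis by (rule exI[of _ k], rule exI[of _ 0], rule exI[of _ 0]) (simp add: Gen_x)
  next
    case Gen_y
    show ?thesis by (rule exI[of _ 0], rule exI[of _ k], rule exI[of _ 0]) (simp add: Gen_y)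
  next
    case Gen_z1
    show ?thesis by (rule exI[of _ 0], rule exI[of _ 0], rule exI[of _ k]) (simp add: Gen_z1)
  qed
  have gen: "?P (DQ_gen e s a)" for a using pow[of a 1] by simp
  have ginv: "inv\<^bsub>DQ_group e s\<^esub> (DQ_gen e s a) = DQ_gen e s a [^]\<^bsub>DQ_group e s\<^esub> (2 * 2 ^ s - 1 :: nat)" for a
  proof (rule DG.inv_equality)
    have "DQ_gen e s a [^]\<^bsub>DQ_group e s\<^esub> (2 * 2 ^ s - 1 :: nat) \<otimes>\<^bsub>DQ_group e s\<^esub> DQ_gen e s a
      = DQ_gen e s a [^]\<^bsub>DQ_group e s\<^esub> (Suc (2 * 2 ^ s - 1) :: nat)"
      by (rule DG.nat_pow_Suc[symmetric])
    also have "Suc (2 * 2 ^ s - 1) = 2 * 2 ^ s" by simp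
    finally show "DQ_gen e s a [^]\<^bsub>DQ_group e s\<^esub> (2 * 2 ^ s - 1 :: nat) \<otimes>\<^bsub>DQ_group e s\<^esub> DQ_gen e s a = \<one>\<^bsub>DQ_group e s\<^esub>"
      by (simp add: DQ_gen_double_pow)
  qed simp_all
  show ?thesis using assms
  proof (induction rule: DQ_gen_induct)
    case one
    show ?case using pow[of Gen_x 0] by simp
  next
    case (mult a h)
    then show ?case using nf_mult[OF gen] by blast
  next
    case (inv a h)
    show ?case unfolding ginv using nf_mult[OF pow inv(2)] by blast
  qed
qed

text \<open>The products \<open>g h\<close> and \<open>h g\<close> have the same exponents of
  \<open>x\<close> and \<open>y\<close>, so they differ by a power of the central
  \<open>z1\<close>.\<close>

lemma DQ_class2: "class2_group (DQ_group e s)"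
proof
  fix g h assume gh: "g \<in> carrier (DQ_group e s)" "h \<in> carrier (DQ_group e s)"
  obtain a b c :: nat where
    g: "g = (DQ_gen e s Gen_x) [^]\<^bsub>DQ_group e s\<^esub> a \<otimes>\<^bsub>DQ_group e s\<^esub> (DQ_gen e s Gen_y) [^]\<^bsub>DQ_group e s\<^esub> b \<otimes>\<^bsub>DQ_group e s\<^esub> (DQ_gen e s Gen_z1) [^]\<^bsub>DQ_group e s\<^esub> c"
    using DQ_nf[OF gh(1)] by blast
  obtain a' b' c' :: nat where
    h: "h = (DQ_gen e s Gen_x) [^]\<^bsub>DQ_group e s\<^esub> a' \<otimes>\<^bsub>DQ_group e s\<^esub> (DQ_gen e s Gen_y) [^]\<^bsub>DQ_group e s\<^esub> b' \<otimes>\<^bsub>DQ_group e s\<^esub> (DQ_gen e s Gen_z1) [^]\<^bsub>DQ_group e s\<^esub> c'"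
    using DQ_nf[OF gh(2)] by blast
  define t where "t = (DQ_gen e s Gen_x) [^]\<^bsub>DQ_group e s\<^esub> (a + a') \<otimes>\<^bsub>DQ_group e s\<^esub> (DQ_gen e s Gen_y) [^]\<^bsub>DQ_group e s\<^esub> (b + b')"
  have t: "t \<in> carrier (DQ_group e s)" by (simp add: t_def)
  obtain k where k: "g \<otimes>\<^bsub>DQ_group e s\<^esub> h = t \<otimes>\<^bsub>DQ_group e s\<^esub> (DQ_gen e s Gen_z1) [^]\<^bsub>DQ_group e s\<^esub> (k::nat)"
    using DQ_nf_mult[of a b c a' b' c'] unfolding g h t_def by blast
  obtain l where l: "h \<otimes>\<^bsub>DQ_group e s\<^esub> g = t \<otimes>\<^bsub>DQ_group e s\<^esub> (DQ_gen e s Gen_z1) [^]\<^bsub>DQ_group e s\<^esub> (l::nat)"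
    using DQ_nf_mult[of a' b' c' a b c] unfolding g h t_def
    by (auto simp: add.commute)
  have zc: "(DQ_gen e s Gen_z1) [^]\<^bsub>DQ_group e s\<^esub> j \<in> center (DQ_group e s)" for j :: nat using DQ_Z_center by (simp add: DG.center_pow)
  have "commut (DQ_group e s) g h = inv\<^bsub>DQ_group e s\<^esub> ((DQ_gen e s Gen_z1) [^]\<^bsub>DQ_group e s\<^esub> l) \<otimes>\<^bsub>DQ_group e s\<^esub> (DQ_gen e s Gen_z1) [^]\<^bsub>DQ_group e s\<^esub> k"
    by (rule DG.commutI[OF gh])
       (use t in \<open>simp_all add: k l DG.m_assoc DG.inv_mult_cancel\<close>)
  then show "commut (DQ_group e s) g h \<in> center (DQ_group e s)"
    using zc by (simp add: DG.center_mult DG.center_inv)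
qed

text \<open>Multiples of \<open>2 ^ s\<close> in the exponents of \<open>x\<close> and
  \<open>y\<close> turn into powers of \<open>z1\<close>; \<open>m = 0\<close> is the case of
  \<open>D\<close>. This bounds the order of the group by \<open>2 ^ (3 * s)\<close>.\<close>

lemma DQ_nf_bounded:
  assumes "g \<in> carrier (DQ_group e s)"
  shows "\<exists>a<(2::nat) ^ s. \<exists>b<(2::nat) ^ s. \<exists>c<(2::nat) ^ s.
    g = (DQ_gen e s Gen_x) [^]\<^bsub>DQ_group e s\<^esub> a \<otimes>\<^bsub>DQ_group e s\<^esub> (DQ_gen e s Gen_y) [^]\<^bsub>DQ_group e s\<^esub> b \<otimes>\<^bsub>DQ_group e s\<^esub> (DQ_gen e s Gen_z1) [^]\<^bsub>DQ_group e s\<^esub> (c::nat)"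
proof -
  let ?N = "2 ^ s :: nat"
  obtain a b c :: nat where g: "g = (DQ_gen e s Gen_x) [^]\<^bsub>DQ_group e s\<^esub> a \<otimes>\<^bsub>DQ_group e s\<^esub> (DQ_gen e s Gen_y) [^]\<^bsub>DQ_group e s\<^esub> b \<otimes>\<^bsub>DQ_group e s\<^esub> (DQ_gen e s Gen_z1) [^]\<^bsub>DQ_group e s\<^esub> c"
    using DQ_nf[OF assms] by blast
  define m where "m = (if e then 2 ^ (s - 1) else 0 :: nat)"
  have split: "h [^]\<^bsub>DQ_group e s\<^esub> k = h [^]\<^bsub>DQ_group e s\<^esub> (k mod ?N) \<otimes>\<^bsub>DQ_group e s\<^esub> (h [^]\<^bsub>DQ_group e s\<^esub> ?N) [^]\<^bsub>DQ_group e s\<^esub> (k div ?N)"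
    if "h \<in> carrier (DQ_group e s)" for h and k :: nat
  proof -
    have "h [^]\<^bsub>DQ_group e s\<^esub> k = h [^]\<^bsub>DQ_group e s\<^esub> (k mod ?N + ?N * (k div ?N))" by simp
    also have "\<dots> = h [^]\<^bsub>DQ_group e s\<^esub> (k mod ?N) \<otimes>\<^bsub>DQ_group e s\<^esub> (h [^]\<^bsub>DQ_group e s\<^esub> ?N) [^]\<^bsub>DQ_group e s\<^esub> (k div ?N)"
      using that by (simp only: DG.nat_pow_mult DG.nat_pow_pow)
    finally show ?thesis .
  qed
  have XY: "(DQ_gen e s Gen_x) [^]\<^bsub>DQ_group e s\<^esub> ?N = (DQ_gen e s Gen_z1) [^]\<^bsub>DQ_group e s\<^esub> m" "(DQ_gen e s Gen_y) [^]\<^bsub>DQ_group e s\<^esub> ?N = (DQ_gen e s Gen_z1) [^]\<^bsub>DQ_group e s\<^esub> m"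
    using DQ_gen_rels(2,3) by (auto simp: m_def)
  have WgX: "(DQ_gen e s Gen_x) [^]\<^bsub>DQ_group e s\<^esub> a = (DQ_gen e s Gen_x) [^]\<^bsub>DQ_group e s\<^esub> (a mod ?N) \<otimes>\<^bsub>DQ_group e s\<^esub> (DQ_gen e s Gen_z1) [^]\<^bsub>DQ_group e s\<^esub> (m * (a div ?N))"
    using split[of "DQ_gen e s Gen_x" a] by (simp add: XY DG.nat_pow_pow)
  have WgY: "(DQ_gen e s Gen_y) [^]\<^bsub>DQ_group e s\<^esub> b = (DQ_gen e s Gen_y) [^]\<^bsub>DQ_group e s\<^esub> (b mod ?N) \<otimes>\<^bsub>DQ_group e s\<^esub> (DQ_gen e s Gen_z1) [^]\<^bsub>DQ_group e s\<^esub> (m * (b div ?N))"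
    using split[of "DQ_gen e s Gen_y" b] by (simp add: XY DG.nat_pow_pow)
  define k where "k = m * (a div ?N) + (m * (b div ?N) + c)"
  have zc: "(DQ_gen e s Gen_z1) [^]\<^bsub>DQ_group e s\<^esub> (m * (a div ?N)) \<in> center (DQ_group e s)"
    using DQ_Z_center by (simp add: DG.center_pow)
  have "g = (DQ_gen e s Gen_x) [^]\<^bsub>DQ_group e s\<^esub> (a mod ?N) \<otimes>\<^bsub>DQ_group e s\<^esub> ((DQ_gen e s Gen_z1) [^]\<^bsub>DQ_group e s\<^esub> (m * (a div ?N)) \<otimes>\<^bsub>DQ_group e s\<^esub>
      (DQ_gen e s Gen_y) [^]\<^bsub>DQ_group e s\<^esub> (b mod ?N)) \<otimes>\<^bsub>DQ_group e s\<^esub> ((DQ_gen e s Gen_z1) [^]\<^bsub>DQ_group e s\<^esub> (m * (b div ?N)) \<otimes>\<^bsub>DQ_group e s\<^esub> (DQ_gen e s Gen_z1) [^]\<^bsub>DQ_group e s\<^esub> c)"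
    unfolding g WgX WgY by (simp add: DG.m_assoc)
  also have "\<dots> = (DQ_gen e s Gen_x) [^]\<^bsub>DQ_group e s\<^esub> (a mod ?N) \<otimes>\<^bsub>DQ_group e s\<^esub> (DQ_gen e s Gen_y) [^]\<^bsub>DQ_group e s\<^esub> (b mod ?N) \<otimes>\<^bsub>DQ_group e s\<^esub> (DQ_gen e s Gen_z1) [^]\<^bsub>DQ_group e s\<^esub> k"
    using center_comm[OF zc, of "(DQ_gen e s Gen_y) [^]\<^bsub>DQ_group e s\<^esub> (b mod ?N)"]
    by (simp add: DG.m_assoc k_def flip: DG.nat_pow_mult)
  also have "(DQ_gen e s Gen_z1) [^]\<^bsub>DQ_group e s\<^esub> k = (DQ_gen e s Gen_z1) [^]\<^bsub>DQ_group e s\<^esub> (k mod ?N)"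
    using split[of "DQ_gen e s Gen_z1" k] by (simp add: DQ_gen_rels)
  finally show ?thesis
    by (intro exI[of _ "a mod ?N"] exI[of _ "b mod ?N"] exI[of _ "k mod ?N"] conjI) auto
qed

lemma finite_DQ: "finite (carrier (DQ_group e s))"
proof (rule finite_subset)
  show "carrier (DQ_group e s) \<subseteq> (\<lambda>(a, b, c). (DQ_gen e s Gen_x) [^]\<^bsub>DQ_group e s\<^esub> a \<otimes>\<^bsub>DQ_group e s\<^esub> (DQ_gen e s Gen_y) [^]\<^bsub>DQ_group e s\<^esub> b \<otimes>\<^bsub>DQ_group e s\<^esub> (DQ_gen e s Gen_z1) [^]\<^bsub>DQ_group e s\<^esub> c) `
      ({..<2 ^ s :: nat} \<times> {..<2 ^ s :: nat} \<times> {..<2 ^ s :: nat})"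
    using DQ_nf_bounded by (force simp: image_iff)
qed simp

context
  fixes G :: "('a, 'b) monoid_scheme" and \<psi> :: "gen word set \<Rightarrow> 'a"
  assumes G: "group G" and hom: "\<psi> \<in> hom (DQ_group e s) G" and ord: "group.ord G (\<psi> (DQ_gen e s Gen_z1)) = 2 ^ s"
begin

interpretation GG: group G by (rule G)
interpretation h: group_hom "DQ_group e s" G \<psi>
  by unfold_locales (rule hom)

lemma hom_commut:
  assumes "g \<in> carrier (DQ_group e s)" "k \<in> carrier (DQ_group e s)"
  shows "\<psi> (commut (DQ_group e s) g k) = commut G (\<psi> g) (\<psi> k)"
  using assms by (simp add: commut_def)

lemma DQ_hom_Z_pow:
  assumes "\<psi> ((DQ_gen e s Gen_z1) [^]\<^bsub>DQ_group e s\<^esub> (k::nat)) = \<one>\<^bsub>G\<^esub>" "k < 2 ^ s"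
  shows "k = 0"
proof -
  have "\<psi> (DQ_gen e s Gen_z1) [^]\<^bsub>G\<^esub> k = \<one>\<^bsub>G\<^esub>" using assms by (simp add: h.hom_nat_pow)
  then have "2 ^ s dvd k" using GG.pow_eq_id[of "\<psi> (DQ_gen e s Gen_z1)" k] ord by simp
  then show ?thesis using assms(2) by (auto dest: dvd_imp_le)
qed

text \<open>Commutators with \<open>y\<close> and \<open>x\<close> turn the exponents of a normal
  form into exponents of \<open>z1\<close>, so an element of the kernel has only zero exponents once
  the image of \<open>z1\<close> has full order \<open>2 ^ s\<close>. The criterion serves both for
  the concrete model and for the copies of \<open>D\<close> and \<open>Q\<close> found inside a
  given group.\<close>

lemma DQ_hom_inj: "inj_on \<psi> (carrier (DQ_group e s))"
proof (rule h.inj_on_one_iff[THEN iffD2, rule_format])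
  interpret DG: class2_group "DQ_group e s" by (rule DQ_class2)
  fix g assume g: "g \<in> carrier (DQ_group e s)" and g1: "\<psi> g = \<one>\<^bsub>G\<^esub>"
  obtain a b c :: nat where abc: "a < 2 ^ s" "b < 2 ^ s" "c < 2 ^ s"
    and geq: "g = (DQ_gen e s Gen_x) [^]\<^bsub>DQ_group e s\<^esub> a \<otimes>\<^bsub>DQ_group e s\<^esub> (DQ_gen e s Gen_y) [^]\<^bsub>DQ_group e s\<^esub> b \<otimes>\<^bsub>DQ_group e s\<^esub> (DQ_gen e s Gen_z1) [^]\<^bsub>DQ_group e s\<^esub> c"
    using DQ_nf_bounded[OF g] by blast
  have gZ: "(DQ_gen e s Gen_z1) [^]\<^bsub>DQ_group e s\<^esub> c \<in> center (DQ_group e s)" using DQ_Z_center by (simp add: DG.center_pow)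
  have "commut (DQ_group e s) g (DQ_gen e s Gen_y) = (DQ_gen e s Gen_z1) [^]\<^bsub>DQ_group e s\<^esub> a" "commut (DQ_group e s) (DQ_gen e s Gen_x) g = (DQ_gen e s Gen_z1) [^]\<^bsub>DQ_group e s\<^esub> b"
    unfolding geq using gZ
    by (simp_all add: DG.commut_mult_left DG.commut_mult_right DG.commut_central
        DG.commut_pow_left DG.commut_pow_right DQ_gen_rels)
  moreover have "\<psi> (commut (DQ_group e s) g (DQ_gen e s Gen_y)) = \<one>\<^bsub>G\<^esub>" "\<psi> (commut (DQ_group e s) (DQ_gen e s Gen_x) g) = \<one>\<^bsub>G\<^esub>"
    using g by (simp_all add: hom_commut g1 GG.commut_one_iff)
  ultimately have "a = 0" "b = 0" using DQ_hom_Z_pow abc by metis+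
  then show "g = \<one>\<^bsub>DQ_group e s\<^esub>" using DQ_hom_Z_pow[of c] abc g1 geq by simp
qed

end

end

text \<open>A Heisenberg group over the integers modulo \<open>N\<close> whose central coordinate is
  a non-zero complex number; the divisor comes from
  \<open>y ^ b x ^ a' = x ^ a' y ^ b z ^ (- a' b)\<close>. The large centre has room for roots of
  -1, so one model receives both \<open>D\<close> and \<open>Q\<close>, and its last coordinate
  later serves as a faithful central character.\<close>

definition heis_model :: "nat \<Rightarrow> complex \<Rightarrow> (nat \<times> nat \<times> complex) monoid" where
  "heis_model N \<zeta> = \<lparr>carrier = {..<N} \<times> {..<N} \<times> (- {0}),
     monoid.mult = (\<lambda>(a, b, w) (a', b', w'). ((a + a') mod N, (b + b') mod N, w * w' / \<zeta> ^ (a' * b))),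
     one = (0, 0, 1)\<rparr>"

lemma root_pow_mod: "(\<zeta> :: complex) ^ N = 1 \<Longrightarrow> \<zeta> ^ (k mod N) = \<zeta> ^ k"
  by (metis mod_mult_div_eq mult.right_neutral power_add power_mult power_one)

lemma root_pow_mult_mod:
  assumes "(\<zeta> :: complex) ^ N = 1"
  shows "\<zeta> ^ ((k mod N) * l) = \<zeta> ^ (k * l)" "\<zeta> ^ (l * (k mod N)) = \<zeta> ^ (l * k)"
  by (metis root_pow_mod[OF assms] mod_mult_left_eq) (metis root_pow_mod[OF assms] mod_mult_right_eq)

lemma group_heis_model:
  assumes N: "N > 0" and \<zeta>: "\<zeta> ^ N = 1"
  shows "group (heis_model N \<zeta>)"
proof (rule groupI)
  have z0: "\<zeta> \<noteq> 0" using N \<zeta> by (auto simp: power_0_left)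
  show "\<one>\<^bsub>heis_model N \<zeta>\<^esub> \<in> carrier (heis_model N \<zeta>)"
    using N by (simp add: heis_model_def)
  fix u assume u: "u \<in> carrier (heis_model N \<zeta>)"
  obtain a b w where uu: "u = (a, b, w)" by (metis prod_cases3)
  show "\<one>\<^bsub>heis_model N \<zeta>\<^esub> \<otimes>\<^bsub>heis_model N \<zeta>\<^esub> u = u"
    using u by (simp add: heis_model_def uu)
  let ?b = "(N - b) mod N"
  \<comment> \<open>The last coordinate is chosen to cancel the factor
    \<open>\<zeta> ^ (a * ?b)\<close> that the product of \<open>?v\<close> and \<open>u\<close>
    brings in.\<close>
  let ?v = "((N - a) mod N, ?b, \<zeta> ^ (a * ?b) / w)"
  have "?v \<in> carrier (heis_model N \<zeta>)"
    using u N z0 by (simp add: heis_model_def uu)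
  moreover have "?v \<otimes>\<^bsub>heis_model N \<zeta>\<^esub> u = \<one>\<^bsub>heis_model N \<zeta>\<^esub>"
    using u N z0 by (simp add: heis_model_def uu mod_simps)
  ultimately show "\<exists>v\<in>carrier (heis_model N \<zeta>). v \<otimes>\<^bsub>heis_model N \<zeta>\<^esub> u = \<one>\<^bsub>heis_model N \<zeta>\<^esub>"
    by blast
  fix v assume v: "v \<in> carrier (heis_model N \<zeta>)"
  obtain a' b' w' where vv: "v = (a', b', w')" by (metis prod_cases3)
  show "u \<otimes>\<^bsub>heis_model N \<zeta>\<^esub> v \<in> carrier (heis_model N \<zeta>)"
    using u v z0 N by (simp add: heis_model_def uu vv)
  fix x assume x: "x \<in> carrier (heis_model N \<zeta>)"
  obtain a'' b'' w'' where xx: "x = (a'', b'', w'')" by (metis prod_cases3)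
  show "u \<otimes>\<^bsub>heis_model N \<zeta>\<^esub> v \<otimes>\<^bsub>heis_model N \<zeta>\<^esub> x =
      u \<otimes>\<^bsub>heis_model N \<zeta>\<^esub> (v \<otimes>\<^bsub>heis_model N \<zeta>\<^esub> x)"
    using z0 by (simp add: heis_model_def uu vv xx mod_simps root_pow_mult_mod[OF \<zeta>] add.assoc)
      (simp add: field_simps power_add)
qed

lemma heis_model_pow:
  assumes N: "N \<ge> 2"
  shows "(1, 0, \<eta>) [^]\<^bsub>heis_model N \<zeta>\<^esub> k = (k mod N, 0, \<eta> ^ k)"
    "(0, 1, \<eta>) [^]\<^bsub>heis_model N \<zeta>\<^esub> k = (0, k mod N, \<eta> ^ k)"
    "(0, 0, \<eta>) [^]\<^bsub>heis_model N \<zeta>\<^esub> (k::nat) = (0, 0, \<eta> ^ k)"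
  by (induction k; simp add: nat_pow_def heis_model_def mod_Suc_eq mult.commute)+

text \<open>\<open>\<zeta>\<close> is a primitive \<open>2 ^ s\<close>-th root of unity. For
  \<open>Q\<close> the number \<open>\<eta>\<close> satisfies
  \<open>\<eta> ^ (2 ^ s) = -1 = \<zeta> ^ (2 ^ (s - 1))\<close>, which is the relation that
  distinguishes \<open>Q\<close> from \<open>D\<close>.\<close>

lemma heis_model_relations:
  fixes s :: nat and e :: bool
  assumes s: "s \<ge> 1"
  defines "\<zeta> \<equiv> cis (pi / 2 ^ (s - 1))" and "\<eta> \<equiv> (if e then cis (pi / 2 ^ s) else 1)"
  shows "DQ_relations (heis_model (2 ^ s) \<zeta>) e s (1, 0, \<eta>) (0, 1, \<eta>) (0, 0, \<zeta>)"
    and "\<zeta> ^ (2 ^ (s - 1)) = -1" "\<zeta> ^ (2 ^ s) = 1"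
proof -
  let ?N = "2 ^ s :: nat"
  show z1: "\<zeta> ^ (2 ^ (s - 1)) = -1" by (simp add: \<zeta>_def DeMoivre)
  have "(2::nat) ^ s = 2 ^ (s - 1) * 2" using s by (cases s) auto
  then show z2: "\<zeta> ^ ?N = 1" using z1 by (simp add: power_mult)
  have N: "?N \<ge> 2" using s by (cases s) auto
  have eta: "\<eta> ^ ?N = (if e then -1 else 1)" by (simp add: \<eta>_def DeMoivre)
  have "\<eta> \<noteq> 0" "\<zeta> \<noteq> 0" by (auto simp: \<eta>_def \<zeta>_def)
  let ?U = "heis_model ?N \<zeta>"
  interpret U: group ?U by (rule group_heis_model) (use z2 in auto)
  have car: "(1, 0, \<eta>) \<in> carrier ?U" "(0, 1, \<eta>) \<in> carrier ?U" "(0, 0, \<zeta>) \<in> carrier ?U"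
    using N \<open>\<eta> \<noteq> 0\<close> \<open>\<zeta> \<noteq> 0\<close> by (auto simp: heis_model_def)
  have c1: "commut ?U (1, 0, \<eta>) (0, 0, \<zeta>) = \<one>\<^bsub>?U\<^esub>" "commut ?U (0, 0, \<zeta>) (0, 1, \<eta>) = \<one>\<^bsub>?U\<^esub>"
    using car by (simp_all add: U.commut_one_iff) (simp_all add: heis_model_def)
  have c2: "commut ?U (1, 0, \<eta>) (0, 1, \<eta>) = (0, 0, \<zeta>)"
    by (rule U.commutI[OF car]) (use \<open>\<zeta> \<noteq> 0\<close> N in \<open>simp add: heis_model_def\<close>)
  have one: "\<one>\<^bsub>?U\<^esub> = (0, 0, 1)" by (simp add: heis_model_def)
  show "DQ_relations ?U e s (1, 0, \<eta>) (0, 1, \<eta>) (0, 0, \<zeta>)"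
    unfolding DQ_relations_def
    using car c1 c2 z1 z2 eta by (auto simp: heis_model_pow[OF N, unfolded One_nat_def] one)
qed

lemma (in group) ord_eq_two_pow:
  assumes "z \<in> carrier G" "z [^] (2 ^ s :: nat) = \<one>" "z [^] (2 ^ (s - 1) :: nat) \<noteq> \<one>" "s \<ge> 1"
  shows "ord z = 2 ^ s"
proof -
  have "ord z dvd 2 ^ s" using assms by (simp add: pow_eq_id)
  then obtain i where i: "i \<le> s" "ord z = 2 ^ i" using divides_primepow_nat[of 2] by auto
  have "\<not> ord z dvd 2 ^ (s - 1)" using assms by (simp add: pow_eq_id)
  then have "\<not> i \<le> s - 1" using i(2) le_imp_power_dvd by metis
  then show ?thesis using i by (metis Suc_diff_le assms(4) diff_Suc_1 le_SucE not_less_eq_eq One_nat_def)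
qed

section \<open>Order of \<open>z1\<close>, centre, and Gauss sums of \<open>D\<close> and
  \<open>Q\<close>\<close>

context
  fixes e :: bool and s :: nat
  assumes s: "s \<ge> 1"
begin

interpretation DG: class2_group "DQ_group e s" by (rule DQ_class2[OF s])

lemma DQ_model_hom:
  defines "\<zeta> \<equiv> cis (pi / 2 ^ (s - 1))"
  obtains \<psi> where "group (heis_model (2 ^ s) \<zeta>)" "\<psi> \<in> hom (DQ_group e s) (heis_model (2 ^ s) \<zeta>)" "\<psi> (DQ_gen e s Gen_z1) = (0, 0, \<zeta>)"
    "group.ord (heis_model (2 ^ s) \<zeta>) (0, 0, \<zeta>) = 2 ^ s"
proof -
  note rels = heis_model_relations(1)[OF s, of e, folded \<zeta>_def]
    heis_model_relations(2,3)[OF s, folded \<zeta>_def]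
  have G: "group (heis_model (2 ^ s) \<zeta>)" by (rule group_heis_model) (use rels in auto)
  interpret U: group "heis_model (2 ^ s) \<zeta>" by (rule G)
  obtain \<psi> where \<psi>: "\<psi> \<in> hom (DQ_group e s) (heis_model (2 ^ s) \<zeta>)" "\<psi> (DQ_gen e s Gen_z1) = (0, 0, \<zeta>)"
    using U.DQ_universal[OF rels(1)] by metis
  have N: "(2::nat) ^ s \<ge> 2" using s by (cases s) auto
  have one: "\<one>\<^bsub>heis_model (2 ^ s) \<zeta>\<^esub> = (0, 0, 1)" by (simp add: heis_model_def)
  have "U.ord (0, 0, \<zeta>) = 2 ^ s"
    using rels s unfolding DQ_relations_def
    by (intro U.ord_eq_two_pow) (auto simp: heis_model_pow(3)[OF N] one)
  with G \<psi> that show thesis by blast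
qed

text \<open>The presentation only bounds the order from above; the image in the model shows that
  \<open>z1\<close> does not collapse.\<close>

lemma DQ_ord_Z: "DG.ord (DQ_gen e s Gen_z1) = 2 ^ s"
proof -
  obtain \<psi> where G: "group (heis_model (2 ^ s) (cis (pi / 2 ^ (s - 1))))" and
    \<psi>: "\<psi> \<in> hom (DQ_group e s) (heis_model (2 ^ s) (cis (pi / 2 ^ (s - 1))))"
    "group.ord (heis_model (2 ^ s) (cis (pi / 2 ^ (s - 1)))) (\<psi> (DQ_gen e s Gen_z1)) = 2 ^ s"
    using DQ_model_hom by metis
  interpret U: group "heis_model (2 ^ s) (cis (pi / 2 ^ (s - 1)))" by (rule G)
  interpret h: group_hom "DQ_group e s" "heis_model (2 ^ s) (cis (pi / 2 ^ (s - 1)))" \<psi>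
    by unfold_locales (rule \<psi>(1))
  have "(DQ_gen e s Gen_z1) [^]\<^bsub>DQ_group e s\<^esub> (2 ^ (s - 1) :: nat) \<noteq> \<one>\<^bsub>DQ_group e s\<^esub>"
  proof
    assume a: "(DQ_gen e s Gen_z1) [^]\<^bsub>DQ_group e s\<^esub> (2 ^ (s - 1) :: nat) = \<one>\<^bsub>DQ_group e s\<^esub>"
    have "2 ^ (s - 1) = (0 :: nat)"
      by (rule DQ_hom_Z_pow[OF s G \<psi>]) (use a s in auto)
    then show False by simp
  qed
  then show ?thesis using DQ_gen_rels(1)[OF s] s by (intro DG.ord_eq_two_pow) auto
qed

lemma DQ_center: "center (DQ_group e s) = {(DQ_gen e s Gen_z1) [^]\<^bsub>DQ_group e s\<^esub> (k::nat) | k. True}"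
proof (intro equalityI subsetI)
  fix g assume gc: "g \<in> center (DQ_group e s)"
  then have g: "g \<in> carrier (DQ_group e s)" by (rule center_sub)
  obtain a b c :: nat where abc: "a < 2 ^ s" "b < 2 ^ s" "c < 2 ^ s"
    and geq: "g = (DQ_gen e s Gen_x) [^]\<^bsub>DQ_group e s\<^esub> a \<otimes>\<^bsub>DQ_group e s\<^esub> (DQ_gen e s Gen_y) [^]\<^bsub>DQ_group e s\<^esub> b \<otimes>\<^bsub>DQ_group e s\<^esub> (DQ_gen e s Gen_z1) [^]\<^bsub>DQ_group e s\<^esub> c"
    using DQ_nf_bounded[OF s g] by blast
  have Z: "(DQ_gen e s Gen_z1) [^]\<^bsub>DQ_group e s\<^esub> c \<in> center (DQ_group e s)" using DQ_Z_center[OF s] by (simp add: DG.center_pow)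
  have "commut (DQ_group e s) g (DQ_gen e s Gen_y) = (DQ_gen e s Gen_z1) [^]\<^bsub>DQ_group e s\<^esub> a" "commut (DQ_group e s) (DQ_gen e s Gen_x) g = (DQ_gen e s Gen_z1) [^]\<^bsub>DQ_group e s\<^esub> b"
    unfolding geq using Z
    by (simp_all add: DG.commut_mult_left DG.commut_mult_right DG.commut_central
        DG.commut_pow_left DG.commut_pow_right DQ_gen_rels[OF s])
  then have "(DQ_gen e s Gen_z1) [^]\<^bsub>DQ_group e s\<^esub> a = \<one>\<^bsub>DQ_group e s\<^esub>" "(DQ_gen e s Gen_z1) [^]\<^bsub>DQ_group e s\<^esub> b = \<one>\<^bsub>DQ_group e s\<^esub>"
    using gc by (simp_all add: DG.commut_central)
  then have "2 ^ s dvd a" "2 ^ s dvd b" using DG.pow_eq_id[of "DQ_gen e s Gen_z1"] by (simp_all add: DQ_ord_Z)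
  then have "a = 0" "b = 0" using abc by (auto dest: dvd_imp_le)
  then show "g \<in> {(DQ_gen e s Gen_z1) [^]\<^bsub>DQ_group e s\<^esub> (k::nat) | k. True}" using geq by auto
qed (use DQ_Z_center[OF s] in \<open>auto simp: DG.center_pow\<close>)

lemma DQ_gauss_group:
  assumes r: "s \<le> r" and lam: "lam \<one>\<^bsub>DQ_group e s\<^esub> = 1"
    "\<And>a b. a \<in> center (DQ_group e s) \<Longrightarrow> b \<in> center (DQ_group e s) \<Longrightarrow> lam (a \<otimes>\<^bsub>DQ_group e s\<^esub> b) = lam a * lam b"
    "inj_on lam (center (DQ_group e s))"
  shows "gauss_group (DQ_group e s) lam r"
proof (unfold_locales)
  show "finite (carrier (DQ_group e s))" by (rule finite_DQ[OF s])
  show "r \<ge> 1" using r s by simp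
  fix z assume "z \<in> center (DQ_group e s)"
  then obtain k :: nat where k: "z = (DQ_gen e s Gen_z1) [^]\<^bsub>DQ_group e s\<^esub> k" unfolding DQ_center by blast
  have "2 ^ s dvd k * 2 ^ r" using r by (simp add: le_imp_power_dvd)
  then show "z [^]\<^bsub>DQ_group e s\<^esub> (2 ^ r :: nat) = \<one>\<^bsub>DQ_group e s\<^esub>"
    by (simp add: k DG.nat_pow_pow DG.pow_eq_id DQ_ord_Z)
qed (use lam in auto)

text \<open>The plane of \<open>x\<close> and \<open>y\<close> is split off from the whole group.
  Its complement is the centre, on which \<open>q\<close> is 1.\<close>

lemma DQ_plane_sum:
  assumes "gauss_group (DQ_group e s) lam r"
  shows "(\<Sum>g\<in>carrier (DQ_group e s). gauss_group.q (DQ_group e s) lam r g) =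
    (\<Sum>a<(2::nat)^s. \<Sum>b<(2::nat)^s. gauss_group.q (DQ_group e s) lam r ((DQ_gen e s Gen_x) [^]\<^bsub>DQ_group e s\<^esub> a \<otimes>\<^bsub>DQ_group e s\<^esub> (DQ_gen e s Gen_y) [^]\<^bsub>DQ_group e s\<^esub> b)) * of_nat (card (center (DQ_group e s)))"
proof -
  interpret gauss_group "DQ_group e s" lam r by fact
  have C: "subgroup (carrier (DQ_group e s)) (DQ_group e s)" by (rule DG.subgroup_self)
  have Zc: "\<exists>i::nat. commut (DQ_group e s) g h = (DQ_gen e s Gen_z1) [^]\<^bsub>DQ_group e s\<^esub> i" if "g \<in> carrier (DQ_group e s)" "h \<in> carrier (DQ_group e s)" for g h
    using DG.commut_center[OF that] unfolding DQ_center by blast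
  have perp: "plane_perp (carrier (DQ_group e s)) (DQ_gen e s Gen_x) (DQ_gen e s Gen_y) = center (DQ_group e s)"
  proof (intro equalityI subsetI)
    fix g assume "g \<in> plane_perp (carrier (DQ_group e s)) (DQ_gen e s Gen_x) (DQ_gen e s Gen_y)"
    then have g: "g \<in> carrier (DQ_group e s)" "commut (DQ_group e s) g (DQ_gen e s Gen_x) = \<one>\<^bsub>DQ_group e s\<^esub>" "commut (DQ_group e s) g (DQ_gen e s Gen_y) = \<one>\<^bsub>DQ_group e s\<^esub>"
      by (auto simp: plane_perp_def)
    show "g \<in> center (DQ_group e s)"
    proof (rule DG.centerI[OF g(1)])
      fix h assume "h \<in> carrier (DQ_group e s)"
      then obtain a b c :: nat where h: "h = (DQ_gen e s Gen_x) [^]\<^bsub>DQ_group e s\<^esub> a \<otimes>\<^bsub>DQ_group e s\<^esub> (DQ_gen e s Gen_y) [^]\<^bsub>DQ_group e s\<^esub> b \<otimes>\<^bsub>DQ_group e s\<^esub> (DQ_gen e s Gen_z1) [^]\<^bsub>DQ_group e s\<^esub> c"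
        using DQ_nf_bounded[OF s] by blast
      show "commut (DQ_group e s) g h = \<one>\<^bsub>DQ_group e s\<^esub>" unfolding h using g DQ_Z_center[OF s]
        by (simp add: DG.commut_mult_right DG.commut_pow_right DG.commut_central DG.center_pow)
    qed
  qed (auto simp: plane_perp_def center_sub DG.commut_central)
  have "(\<Sum>c\<in>center (DQ_group e s). q c) = of_nat (card (center (DQ_group e s)))"
    by (simp add: q_central)
  then show ?thesis
    using plane_split_sum[OF C, of "DQ_gen e s Gen_x" "DQ_gen e s Gen_y" "DQ_gen e s Gen_z1" "2^s"] perp Zc
    by (simp add: DQ_gen_rels[OF s] DQ_ord_Z)
qed

lemma DQ_card_center_pos: "card (center (DQ_group e s)) > 0"
proof -
  have "finite (center (DQ_group e s))"
    by (rule finite_subset[OF _ finite_DQ[OF s, of e]]) (auto intro: center_sub)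
  then show ?thesis using DG.center_one by (metis card_gt_0_iff empty_iff)
qed

end

text \<open>The generators have order dividing \<open>2 ^ s\<close>, hence \<open>q\<close> is 1 on
  them for every \<open>s \<le> r\<close>.\<close>

lemma D_gauss_sum_pos:
  assumes s: "s \<ge> 1" and r: "s \<le> r" and "gauss_group (DQ_group False s) lam r"
  shows "\<exists>p>0. (\<Sum>g\<in>carrier (DQ_group False s). gauss_group.q (DQ_group False s) lam r g) = complex_of_real p"
proof -
  interpret gauss_group "DQ_group False s" lam r by fact
  have q1: "q (DQ_gen False s a) = 1" for a
  proof -
    have "DQ_gen False s a [^]\<^bsub>DQ_group False s\<^esub> (2 ^ s * 2 ^ (r - s) :: nat) = \<one>\<^bsub>DQ_group False s\<^esub>"
      using DQ_gen_rels(1-3)[OF s, of False] by (cases a) (simp_all flip: nat_pow_pow)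
    then show ?thesis using r by (simp add: q_def flip: power_add)
  qed
  obtain p where "p > 0" "(\<Sum>a<(2::nat)^s. \<Sum>b<(2::nat)^s. q (DQ_gen False s Gen_x [^]\<^bsub>DQ_group False s\<^esub> a
      \<otimes>\<^bsub>DQ_group False s\<^esub> DQ_gen False s Gen_y [^]\<^bsub>DQ_group False s\<^esub> b)) = complex_of_real p"
    using plane_sum_pos[of "DQ_gen False s Gen_x" "DQ_gen False s Gen_y" "2^s"] q1 s by auto
  then show ?thesis
    unfolding DQ_plane_sum[OF s assms(3)]
    using DQ_card_center_pos[OF s, of False]
    by (intro exI[of _ "p * real (card (center (DQ_group False s)))"]) simp
qed

text \<open>Here the exponent of the sum is the parameter of \<open>Q\<close> itself: the
  \<open>2 ^ s\<close>-th power of \<open>x\<close> is the involution of the centre, where a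
  faithful \<open>lam\<close> is -1. With a larger exponent \<open>q\<close> would be 1 on the
  generators.\<close>

lemma Q_gauss_sum_neg:
  assumes s: "s \<ge> 1" and "gauss_group (DQ_group True s) lam s"
  shows "\<exists>p>0. (\<Sum>g\<in>carrier (DQ_group True s). gauss_group.q (DQ_group True s) lam s g) = - complex_of_real p"
proof -
  interpret gauss_group "DQ_group True s" lam s by fact
  let ?Z = "DQ_gen True s Gen_z1"
  let ?c = "?Z [^]\<^bsub>DQ_group True s\<^esub> (2 ^ (s - 1) :: nat)"
  have cc: "?c \<in> center (DQ_group True s)" using DQ_Z_center[OF s] by (simp add: center_pow)
  have "?c \<noteq> \<one>\<^bsub>DQ_group True s\<^esub>"
  proof
    assume "?c = \<one>\<^bsub>DQ_group True s\<^esub>"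
    then have "2 ^ s dvd (2 :: nat) ^ (s - 1)" by (simp add: pow_eq_id DQ_ord_Z[OF s])
    then show False using s by (auto dest!: dvd_imp_le)
  qed
  then have "lam ?c \<noteq> 1" using lam_eq_1_iff[OF cc] by simp
  have e: "eps (DQ_gen True s Gen_x) (DQ_gen True s Gen_y) = lam ?c"
    by (simp add: eps_def DQ_gen_rels[OF s])
  then have l: "lam ?c = -1" using \<open>lam ?c \<noteq> 1\<close> eps_cases[of "DQ_gen True s Gen_x" "DQ_gen True s Gen_y"]
    by auto
  have q1: "q (DQ_gen True s Gen_x) = -1" "q (DQ_gen True s Gen_y) = -1"
    using l by (simp_all add: q_def DQ_gen_rels[OF s])
  obtain p where "p > 0" "(\<Sum>a<(2::nat)^s. \<Sum>b<(2::nat)^s. q (DQ_gen True s Gen_x [^]\<^bsub>DQ_group True s\<^esub> a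
      \<otimes>\<^bsub>DQ_group True s\<^esub> DQ_gen True s Gen_y [^]\<^bsub>DQ_group True s\<^esub> b)) = - complex_of_real p"
    using plane_sum_neg[of "DQ_gen True s Gen_x" "DQ_gen True s Gen_y" "2^s"] q1 s e l by auto
  then show ?thesis
    unfolding DQ_plane_sum[OF s assms(2)]
    using DQ_card_center_pos[OF s, of True]
    by (intro exI[of _ "p * real (card (center (DQ_group True s)))"]) simp
qed

text \<open>The centre consists of the powers of \<open>z1\<close>, which the model sends to
  \<open>(0, 0, \<zeta> ^ k)\<close>; such elements multiply through their last coordinate
  alone.\<close>

lemma Q_faithful_central_character:
  assumes s: "s \<ge> 1"
  shows "\<exists>lam. gauss_group (DQ_group True s) lam s"
proof -
  define \<zeta> where "\<zeta> = cis (pi / 2 ^ (s - 1))"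
  obtain \<psi> where G: "group (heis_model (2 ^ s) \<zeta>)" and
    \<psi>: "\<psi> \<in> hom (DQ_group True s) (heis_model (2 ^ s) \<zeta>)"
    "group.ord (heis_model (2 ^ s) \<zeta>) (\<psi> (DQ_gen True s Gen_z1)) = 2 ^ s"
    and \<psi>Z: "\<psi> (DQ_gen True s Gen_z1) = (0, 0, \<zeta>)"
    using DQ_model_hom[OF s, of True] unfolding \<zeta>_def[symmetric] by metis
  interpret DG: class2_group "DQ_group True s" by (rule DQ_class2[OF s])
  interpret U: group "heis_model (2 ^ s) \<zeta>" by (rule G)
  interpret h: group_hom "DQ_group True s" "heis_model (2 ^ s) \<zeta>" \<psi>
    by unfold_locales (rule \<psi>(1))
  have inj: "inj_on \<psi> (carrier (DQ_group True s))" by (rule DQ_hom_inj[OF s G \<psi>])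
  have N: "(2::nat) ^ s \<ge> 2" using s by (cases s) auto
  have c: "fst (\<psi> g) = 0" "fst (snd (\<psi> g)) = 0" if gc: "g \<in> center (DQ_group True s)" for g
  proof -
    obtain k :: nat where "g = DQ_gen True s Gen_z1 [^]\<^bsub>DQ_group True s\<^esub> k"
      using gc unfolding DQ_center[OF s] by blast
    then have "\<psi> g = (0, 0, \<zeta> ^ k)" by (simp add: h.hom_nat_pow \<psi>Z heis_model_pow[OF N])
    then show "fst (\<psi> g) = 0" "fst (snd (\<psi> g)) = 0" by simp_all
  qed
  define lam where "lam g = snd (snd (\<psi> g))" for g
  have "gauss_group (DQ_group True s) lam s"
  proof (rule DQ_gauss_group[OF s order.refl])
    show "lam \<one>\<^bsub>DQ_group True s\<^esub> = 1" by (simp add: lam_def) (simp add: heis_model_def)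
    show "inj_on lam (center (DQ_group True s))"
    proof (rule inj_onI)
      fix g h assume gh: "g \<in> center (DQ_group True s)" "h \<in> center (DQ_group True s)" "lam g = lam h"
      then have "\<psi> g = \<psi> h" using c by (simp add: lam_def prod_eq_iff)
      then show "g = h" using inj gh center_sub by (metis inj_onD)
    qed
    fix a b assume ab: "a \<in> center (DQ_group True s)" "b \<in> center (DQ_group True s)"
    have "\<psi> (a \<otimes>\<^bsub>DQ_group True s\<^esub> b) = \<psi> a \<otimes>\<^bsub>heis_model (2 ^ s) \<zeta>\<^esub> \<psi> b"
      using ab by (simp add: center_sub)
    then show "lam (a \<otimes>\<^bsub>DQ_group True s\<^esub> b) = lam a * lam b"
      using c[OF ab(1)] c[OF ab(2)]
      by (cases "\<psi> a"; cases "\<psi> b") (simp add: lam_def heis_model_def)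
  qed
  then show ?thesis by blast
qed

section \<open>Pushing Gauss sums forward\<close>

lemma (in group) central_subgroup_normal:
  assumes "subgroup N G" "N \<subseteq> center G"
  shows "N \<lhd> G"
proof (rule normal_inv_iff[THEN iffD2], intro conjI ballI)
  fix x h assume x: "x \<in> carrier G" and h: "h \<in> N"
  have "x \<otimes> h \<otimes> inv x = h \<otimes> x \<otimes> inv x" using center_comm[of h G x] h x assms by auto
  also have "\<dots> = h" using h x assms by (auto simp: m_assoc subset_iff center_sub)
  finally show "x \<otimes> h \<otimes> inv x \<in> N" using h by simp
qed (rule assms)

lemma (in group_hom) sum_over_epi:
  fixes f :: "'c \<Rightarrow> complex"
  assumes fin: "finite (carrier G)" and surj: "h ` carrier G = carrier H"
  shows "(\<Sum>a\<in>carrier G. f (h a)) = of_nat (card (kernel G H h)) * (\<Sum>p\<in>carrier H. f p)"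
proof -
  have card: "card {a \<in> carrier G. h a = p} = card (kernel G H h)" if p: "p \<in> carrier H" for p
  proof -
    have "p \<in> h ` carrier G" using p surj by simp
    then obtain a0 where a0: "a0 \<in> carrier G" "h a0 = p" by auto
    have "bij_betw (\<lambda>k. a0 \<otimes> k) (kernel G H h) {a \<in> carrier G. h a = p}"
    proof (rule bij_betwI[where g = "\<lambda>a. inv a0 \<otimes> a"])
      show "(\<lambda>a. inv a0 \<otimes> a) \<in> {a \<in> carrier G. h a = p} \<rightarrow> kernel G H h"
        using a0 by (auto simp: kernel_def)
    qed (use a0 in \<open>auto simp: kernel_def G.inv_mult_cancel\<close>)
    then show ?thesis by (metis bij_betw_same_card)
  qed
  have "(\<Sum>a\<in>carrier G. f (h a)) = (\<Sum>p\<in>carrier H. \<Sum>a | a \<in> carrier G \<and> h a = p. f (h a))"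
    by (rule sum.group[symmetric]) (use fin finite_imageI[OF fin, of h] surj in auto)
  also have "\<dots> = (\<Sum>p\<in>carrier H. of_nat (card (kernel G H h)) * f p)"
  proof (rule sum.cong[OF HOL.refl])
    fix p assume "p \<in> carrier H"
    have "(\<Sum>a | a \<in> carrier G \<and> h a = p. f (h a)) = (\<Sum>a | a \<in> carrier G \<and> h a = p. f p)"
      by (rule sum.cong) auto
    then show "(\<Sum>a | a \<in> carrier G \<and> h a = p. f (h a)) = of_nat (card (kernel G H h)) * f p"
      using card[OF \<open>p \<in> carrier H\<close>] by simp
  qed
  finally show ?thesis by (simp add: sum_distrib_left)
qed

lemma (in group_hom) hom_commut:
  assumes "a \<in> carrier G" "b \<in> carrier G"
  shows "h (commut G a b) = commut H (h a) (h b)"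
  using assms by (simp add: commut_def)

text \<open>One situation with four instances: an isomorphism from \<open>Q\<close>, the quotient
  map of a central product, an arbitrary epimorphism with \<open>R\<close> the preimage of the
  centre, and the quotient by the kernel of a character of the radical. In each of them
  \<open>\<theta>\<close> and the restriction of \<open>\<mu>\<close> to \<open>R\<close> have the
  same kernel.\<close>

locale radical_epi = class2_group A + group_hom A P \<theta> for A (structure) and P and \<theta> +
  fixes R :: "'a set" and \<mu> :: "'a \<Rightarrow> complex"
  assumes fin: "finite (carrier A)"
    and R: "subgroup R A" and center_R: "center A \<subseteq> R"
    and \<mu>_mult: "a \<in> R \<Longrightarrow> b \<in> R \<Longrightarrow> \<mu> (a \<otimes> b) = \<mu> a * \<mu> b" and \<mu>_one: "\<mu> \<one> = 1"
    and R_iff: "a \<in> carrier A \<Longrightarrow> a \<in> R \<longleftrightarrow> (\<forall>b\<in>carrier A. \<mu> (commut A a b) = 1)"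
    and surj: "\<theta> ` carrier A = carrier P"
    and ker: "a \<in> carrier A \<Longrightarrow> \<theta> a = \<one>\<^bsub>P\<^esub> \<longleftrightarrow> a \<in> R \<and> \<mu> a = 1"
begin

text \<open>The character \<open>\<mu>\<close> transported to the centre of \<open>P\<close>. The
  choice of a preimage is harmless on the image of \<open>R\<close>; elsewhere the value is
  unspecified.\<close>

definition push :: "'c \<Rightarrow> complex" where "push p = \<mu> (SOME a. a \<in> R \<and> \<theta> a = p)"

lemma R_carrier: "a \<in> R \<Longrightarrow> a \<in> carrier A"
  using R subgroup.mem_carrier by metis

lemma preimage:
  assumes "p \<in> carrier P"
  obtains a where "a \<in> carrier A" "p = \<theta> a"
proof -
  have "p \<in> \<theta> ` carrier A" using assms surj by simp
  then show thesis using that by auto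
qed

lemma commut_R: "a \<in> carrier A \<Longrightarrow> b \<in> carrier A \<Longrightarrow> commut A a b \<in> R"
  using commut_center center_R by blast

lemma mu_eq_iff:
  assumes "a \<in> R" "b \<in> R"
  shows "\<theta> a = \<theta> b \<longleftrightarrow> \<mu> a = \<mu> b"
proof -
  have ib: "inv b \<in> R" using R assms by (simp add: subgroup.m_inv_closed)
  have "\<mu> b * \<mu> (inv b) = 1" using \<mu>_mult[OF assms(2) ib] R_carrier[OF assms(2)] by (simp add: \<mu>_one)
  moreover have "\<mu> (a \<otimes> inv b) = \<mu> a * \<mu> (inv b)" using \<mu>_mult assms ib by simp
  ultimately have 1: "\<mu> (a \<otimes> inv b) = 1 \<longleftrightarrow> \<mu> a = \<mu> b"
    by (metis mult.commute mult_cancel_right mult_zero_right zero_neq_one)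
  have "\<theta> (a \<otimes> inv b) = \<one>\<^bsub>P\<^esub> \<longleftrightarrow> \<mu> (a \<otimes> inv b) = 1"
    using ker[of "a \<otimes> inv b"] assms ib R by (auto simp: R_carrier subgroup.m_closed)
  moreover have "\<theta> (a \<otimes> inv b) = \<one>\<^bsub>P\<^esub> \<longleftrightarrow> \<theta> a = \<theta> b"
    using assms R_carrier by (simp add: H.inv_solve_right')
  ultimately show ?thesis using 1 by simp
qed

lemma push_eq: "a \<in> R \<Longrightarrow> push (\<theta> a) = \<mu> a"
  unfolding push_def by (rule someI2[of _ a]) (use mu_eq_iff in auto)

text \<open>A commutator is killed by \<open>\<theta>\<close> exactly when \<open>\<mu>\<close> is 1
  on it, so being central in \<open>P\<close> is the same as being orthogonal to everything in
  \<open>A\<close>.\<close>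

lemma center_iff:
  assumes a: "a \<in> carrier A"
  shows "\<theta> a \<in> center P \<longleftrightarrow> a \<in> R"
proof -
  have "\<theta> a \<in> center P \<longleftrightarrow> (\<forall>b\<in>carrier A. commut P (\<theta> a) (\<theta> b) = \<one>\<^bsub>P\<^esub>)"
  proof
    assume "\<theta> a \<in> center P"
    then show "\<forall>b\<in>carrier A. commut P (\<theta> a) (\<theta> b) = \<one>\<^bsub>P\<^esub>"
      by (auto intro: H.commut_central)
  next
    assume *: "\<forall>b\<in>carrier A. commut P (\<theta> a) (\<theta> b) = \<one>\<^bsub>P\<^esub>"
    show "\<theta> a \<in> center P"
    proof (rule H.centerI)
      fix p assume "p \<in> carrier P"
      then obtain b where "b \<in> carrier A" "p = \<theta> b" by (rule preimage)
      then show "commut P (\<theta> a) p = \<one>\<^bsub>P\<^esub>" using * by simp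
    qed (use a in simp)
  qed
  also have "\<dots> \<longleftrightarrow> (\<forall>b\<in>carrier A. \<mu> (commut A a b) = 1)"
  proof -
    have "commut P (\<theta> a) (\<theta> b) = \<one>\<^bsub>P\<^esub> \<longleftrightarrow> \<mu> (commut A a b) = 1" if b: "b \<in> carrier A" for b
      using ker[of "commut A a b"] commut_R[OF a b] a b hom_commut[OF a b] by simp
    then show ?thesis by simp
  qed
  finally show ?thesis using R_iff[OF a] by simp
qed

lemma center_P: "center P = \<theta> ` R"
proof (intro equalityI subsetI)
  fix p assume p: "p \<in> center P"
  obtain a where "a \<in> carrier A" "p = \<theta> a" using preimage center_sub[OF p] by metis
  then show "p \<in> \<theta> ` R" using p center_iff by auto
qed (use center_iff R_carrier in auto)

lemma faithful_push: "faithful_group P push"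
proof (unfold_locales)
  show "finite (carrier P)" using fin surj by (metis finite_imageI)
  show "push \<one>\<^bsub>P\<^esub> = 1"
    using push_eq[of \<one>] subgroup.one_closed[OF R] \<mu>_one by simp
  show "inj_on push (center P)"
    unfolding center_P by (auto simp: inj_on_def push_eq mu_eq_iff)
next
  fix g h assume "g \<in> carrier P" "h \<in> carrier P"
  then obtain a b where ab: "a \<in> carrier A" "b \<in> carrier A" "g = \<theta> a" "h = \<theta> b"
    by (metis preimage)
  then have "commut P g h = \<theta> (commut A a b)" by (simp add: hom_commut)
  then show "commut P g h \<in> center P" using ab commut_R center_P by auto
next
  fix p p' assume "p \<in> center P" "p' \<in> center P"
  then obtain a b where ab: "a \<in> R" "b \<in> R" "p = \<theta> a" "p' = \<theta> b" unfolding center_P by blast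
  then have "p \<otimes>\<^bsub>P\<^esub> p' = \<theta> (a \<otimes> b)" by (simp add: R_carrier)
  then show "push (p \<otimes>\<^bsub>P\<^esub> p') = push p * push p'"
    using ab R \<mu>_mult by (simp add: push_eq subgroup.m_closed)
qed

text \<open>The summand depends on \<open>a\<close> only through \<open>\<theta> a\<close>, and all
  fibres have the size of the kernel.\<close>

lemma gauss_sum_push:
  "gauss_sum A R \<mu> n = of_nat (card (kernel A P \<theta>)) * gauss_sum P (center P) push n"
proof -
  let ?f = "\<lambda>p. if p [^]\<^bsub>P\<^esub> n \<in> center P then push (p [^]\<^bsub>P\<^esub> n) else 0"
  have P: "finite (carrier P)" using fin surj by (metis finite_imageI)
  have iff: "\<theta> a [^]\<^bsub>P\<^esub> n \<in> center P \<longleftrightarrow> a [^] n \<in> R" if "a \<in> carrier A" for a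
    using center_iff[of "a [^] n"] that by (simp add: hom_nat_pow)
  have "gauss_sum A R \<mu> n = (\<Sum>a\<in>carrier A. if a [^] n \<in> R then \<mu> (a [^] n) else 0)"
    unfolding gauss_sum_def by (subst sum.inter_filter[symmetric]) (use fin in \<open>auto intro: sum.cong\<close>)
  also have "\<dots> = (\<Sum>a\<in>carrier A. ?f (\<theta> a))"
  proof (rule sum.cong[OF HOL.refl])
    fix a assume a: "a \<in> carrier A"
    have "push (\<theta> a [^]\<^bsub>P\<^esub> n) = \<mu> (a [^] n)" if "a [^] n \<in> R"
      using push_eq[OF that] hom_nat_pow[OF a, of n] by simp
    then show "(if a [^] n \<in> R then \<mu> (a [^] n) else 0) = ?f (\<theta> a)" using iff[OF a] by simp
  qed
  also have "\<dots> = of_nat (card (kernel A P \<theta>)) * (\<Sum>p\<in>carrier P. ?f p)"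
    by (rule sum_over_epi[OF fin surj])
  also have "(\<Sum>p\<in>carrier P. ?f p) = gauss_sum P (center P) push n"
    unfolding gauss_sum_def by (subst sum.inter_filter[symmetric]) (use P in \<open>auto intro: sum.cong\<close>)
  finally show ?thesis .
qed

lemma card_kernel_pos: "card (kernel A P \<theta>) > 0"
proof -
  have "finite (kernel A P \<theta>)" using fin by (simp add: kernel_def)
  moreover have "\<one> \<in> kernel A P \<theta>" by (simp add: kernel_def)
  ultimately show ?thesis by (auto simp: card_gt_0_iff)
qed

end

section \<open>Gauss sums of central products\<close>

lemma DirProd_facts:
  assumes "group T" "group H" "t \<in> carrier T" "t' \<in> carrier T" "h \<in> carrier H" "h' \<in> carrier H"
  shows "commut (T \<times>\<times> H) (t, h) (t', h') = (commut T t t', commut H h h')"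
    "(t, h) [^]\<^bsub>T \<times>\<times> H\<^esub> (k::nat) = (t [^]\<^bsub>T\<^esub> k, h [^]\<^bsub>H\<^esub> k)"
proof -
  interpret TH: group "T \<times>\<times> H" by (rule DirProd_group) fact+
  show "commut (T \<times>\<times> H) (t, h) (t', h') = (commut T t t', commut H h h')"
    using assms by (simp add: commut_def inv_DirProd)
  show "(t, h) [^]\<^bsub>T \<times>\<times> H\<^esub> (k::nat) = (t [^]\<^bsub>T\<^esub> k, h [^]\<^bsub>H\<^esub> k)"
    by (induction k) simp_all
qed

lemma center_DirProd:
  assumes "group T" "group H"
  shows "center (T \<times>\<times> H) = center T \<times> center H"
proof -
  have "\<one>\<^bsub>T\<^esub> \<in> carrier T" "\<one>\<^bsub>H\<^esub> \<in> carrier H" using assms by (simp_all add: group.is_monoid monoid.one_closed)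
  then show ?thesis unfolding center_def by auto
qed

lemma class2_DirProd:
  assumes "class2_group T" "class2_group H"
  shows "class2_group (T \<times>\<times> H)"
proof -
  interpret T: class2_group T by fact
  interpret H: class2_group H by fact
  interpret TH: group "T \<times>\<times> H" by (rule DirProd_group) unfold_locales
  show ?thesis
    by unfold_locales
      (auto simp: DirProd_facts center_DirProd T.group_axioms H.group_axioms T.commut_center H.commut_center
        T.is_group H.is_group)
qed

text \<open>The sign of the Gauss sum is what every central product of this kind remembers of its
  single \<open>Q\<close> factor.\<close>

definition negative_gauss :: "('a, 'b) monoid_scheme \<Rightarrow> nat \<Rightarrow> bool" where
  "negative_gauss P r \<longleftrightarrow> (\<exists>lam. gauss_group P lam r \<and>
     (\<exists>p>0. gauss_sum P (center P) lam (2 ^ r) = - complex_of_real p))"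

lemma (in radical_epi) negative_gauss_push:
  assumes r: "r \<ge> 1" and exp: "\<And>a. a \<in> R \<Longrightarrow> \<mu> (a [^] (2 ^ r :: nat)) = 1"
    and neg: "p > 0" "gauss_sum A R \<mu> (2 ^ r) = - complex_of_real p"
  shows "negative_gauss P r"
proof -
  interpret P: faithful_group P push by (rule faithful_push)
  have "gauss_group P push r"
  proof (unfold_locales)
    fix z assume "z \<in> center P"
    then obtain a where a: "a \<in> R" "z = \<theta> a" unfolding center_P by blast
    have "a [^] (k :: nat) \<in> R" for k
      using R a by (induction k) (simp_all add: subgroup.one_closed subgroup.m_closed)
    then have "\<theta> (a [^] (2 ^ r :: nat)) = \<one>\<^bsub>P\<^esub>" using a exp ker R_carrier by simp
    then show "z [^]\<^bsub>P\<^esub> (2 ^ r :: nat) = \<one>\<^bsub>P\<^esub>" using a R_carrier by (simp add: hom_nat_pow)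
  qed (rule r)
  moreover have "gauss_sum P (center P) push (2 ^ r) = - complex_of_real (p / card (kernel A P \<theta>))"
    using neg(2) card_kernel_pos unfolding gauss_sum_push by (simp add: field_simps)
  ultimately show ?thesis
    unfolding negative_gauss_def using neg(1) card_kernel_pos
    by (metis divide_pos_pos of_nat_0_less_iff)
qed

lemma negative_gauss_Q:
  assumes "r \<ge> 1" "group P" "Q_group r \<cong> P"
  shows "negative_gauss P r"
proof -
  obtain lam where lam: "gauss_group (DQ_group True r) lam r"
    using Q_faithful_central_character[OF assms(1)] by blast
  interpret gauss_group "DQ_group True r" lam r by (rule lam)
  obtain f where f: "f \<in> iso (DQ_group True r) P" using assms(3) by (auto simp: is_iso_def Q_group_eq)
  interpret P: group P by fact
  interpret group_hom "DQ_group True r" P f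
    by unfold_locales (use f in \<open>auto simp: iso_def\<close>)
  have inj: "f a = \<one>\<^bsub>P\<^esub> \<longleftrightarrow> a = \<one>\<^bsub>DQ_group True r\<^esub>" if "a \<in> carrier (DQ_group True r)" for a
    using f that by (auto simp: iso_iff_mon_epi mon_iff_hom_one)
  have "radical_epi (DQ_group True r) P f (center (DQ_group True r)) lam"
  proof (unfold_locales)
    show "f ` carrier (DQ_group True r) = carrier P" using f by (auto simp: iso_def bij_betw_def)
    fix a assume a: "a \<in> carrier (DQ_group True r)"
    show "f a = \<one>\<^bsub>P\<^esub> \<longleftrightarrow> a \<in> center (DQ_group True r) \<and> lam a = 1"
      using inj[OF a] lam_eq_1_iff by auto
    show "a \<in> center (DQ_group True r) \<longleftrightarrow>
        (\<forall>b\<in>carrier (DQ_group True r). lam (commut (DQ_group True r) a b) = 1)"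
      using a by (auto simp: lam_eq_1_iff commut_center commut_central intro!: centerI)
  qed (auto simp: fin center_sub center_mult center_inv lam_mult)
  then interpret re: radical_epi "DQ_group True r" P f "center (DQ_group True r)" lam .
  obtain p where "p > 0" "gauss_sum (DQ_group True r) (center (DQ_group True r)) lam (2 ^ r) = - complex_of_real p"
    using Q_gauss_sum_neg[OF assms(1) lam] by (auto simp: gauss_sum_eq)
  then show ?thesis
    by (intro re.negative_gauss_push[OF assms(1)]) (auto simp: center_exp)
qed

text \<open>The amalgamated subgroup is the kernel of the central character
  \<open>(z, h) \<mapsto> lam (\<phi> z) * lam h\<close> of the direct product. Up to a positive
  factor the Gauss sum of \<open>P\<close> is thus the product of those of \<open>D\<close> and
  \<open>H\<close>, and \<open>D\<close> contributes a positive number.\<close>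

lemma negative_gauss_central_product:
  assumes s: "1 \<le> s" "s \<le> r" and H: "negative_gauss H r" and cp: "central_product (D_group s) H P"
  shows "negative_gauss P r"
proof -
  define T where "T = DQ_group False s"
  obtain lam p where lam: "gauss_group H lam r"
    and p: "p > 0" "gauss_sum H (center H) lam (2 ^ r) = - complex_of_real p"
    using H by (auto simp: negative_gauss_def)
  interpret H: gauss_group H lam r by (rule lam)
  interpret T: class2_group T unfolding T_def by (rule DQ_class2[OF s(1)])
  interpret TH: class2_group "T \<times>\<times> H" by (rule class2_DirProd) unfold_locales
  note DP = DirProd_facts[OF T.group_axioms H.group_axioms]
  note cTH = center_DirProd[OF T.group_axioms H.group_axioms]
  obtain K \<phi> where P: "group P" and K: "subgroup K H" "K \<subseteq> center H"
    and \<phi>: "\<phi> \<in> iso (T\<lparr>carrier := center T\<rparr>) (H\<lparr>carrier := K\<rparr>)"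
    and isoP: "(T \<times>\<times> H) Mod {(z, inv\<^bsub>H\<^esub> (\<phi> z)) | z. z \<in> center T} \<cong> P"
    using cp unfolding central_product_def D_group_eq T_def[symmetric] by blast
  define N where "N = {(z, inv\<^bsub>H\<^esub> (\<phi> z)) | z. z \<in> center T}"
  have \<phi>c: "\<phi> z \<in> center H" if "z \<in> center T" for z
    using \<phi> K(2) that by (auto simp: iso_def hom_def)
  have \<phi>m: "\<phi> (z \<otimes>\<^bsub>T\<^esub> w) = \<phi> z \<otimes>\<^bsub>H\<^esub> \<phi> w" if "z \<in> center T" "w \<in> center T" for z w
    using \<phi> that by (auto simp: iso_def hom_def)
  have \<phi>i: "inj_on \<phi> (center T)" using \<phi> by (auto simp: iso_def bij_betw_def)
  have \<phi>1: "\<phi> \<one>\<^bsub>T\<^esub> = \<one>\<^bsub>H\<^esub>"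
    using \<phi>m[of "\<one>\<^bsub>T\<^esub>" "\<one>\<^bsub>T\<^esub>"] \<phi>c[of "\<one>\<^bsub>T\<^esub>"]
    by (simp add: center_sub H.r_cancel_one')
  have \<phi>inv: "\<phi> (inv\<^bsub>T\<^esub> z) = inv\<^bsub>H\<^esub> (\<phi> z)" if "z \<in> center T" for z
    using \<phi>m[of "inv\<^bsub>T\<^esub> z" z] \<phi>c that T.center_inv[OF that]
    by (intro H.inv_equality[symmetric]) (auto simp: \<phi>1 center_sub)
  have Nsub: "N \<subseteq> center (T \<times>\<times> H)"
    using \<phi>c by (auto simp: N_def cTH H.center_inv)
  have Ngrp: "subgroup N (T \<times>\<times> H)"
  proof (rule TH.subgroupI)
    show "N \<subseteq> carrier (T \<times>\<times> H)"
      by (rule subset_trans[OF Nsub]) (rule subsetI, erule center_sub)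
    show "N \<noteq> {}" unfolding N_def using T.center_one by blast
  next
    fix a assume "a \<in> N"
    then obtain z where z: "z \<in> center T" "a = (z, inv\<^bsub>H\<^esub> (\<phi> z))" by (auto simp: N_def)
    then have "inv\<^bsub>T \<times>\<times> H\<^esub> a = (inv\<^bsub>T\<^esub> z, inv\<^bsub>H\<^esub> (\<phi> (inv\<^bsub>T\<^esub> z)))"
      using \<phi>c[OF z(1)] by (simp add: inv_DirProd T.group_axioms H.group_axioms center_sub \<phi>inv)
    then show "inv\<^bsub>T \<times>\<times> H\<^esub> a \<in> N" using T.center_inv[OF z(1)] by (auto simp: N_def)
  next
    fix a b assume "a \<in> N" "b \<in> N"
    then obtain z w where z: "z \<in> center T" "a = (z, inv\<^bsub>H\<^esub> (\<phi> z))"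
      and w: "w \<in> center T" "b = (w, inv\<^bsub>H\<^esub> (\<phi> w))" by (auto simp: N_def)
    have "inv\<^bsub>H\<^esub> (\<phi> z) \<otimes>\<^bsub>H\<^esub> inv\<^bsub>H\<^esub> (\<phi> w) = inv\<^bsub>H\<^esub> (\<phi> w \<otimes>\<^bsub>H\<^esub> \<phi> z)"
      using \<phi>c z w by (simp add: H.inv_mult_group center_sub)
    also have "\<phi> w \<otimes>\<^bsub>H\<^esub> \<phi> z = \<phi> (z \<otimes>\<^bsub>T\<^esub> w)"
      using \<phi>m z w \<phi>c center_comm[of "\<phi> w" H "\<phi> z"] by (simp add: center_sub)
    finally have "a \<otimes>\<^bsub>T \<times>\<times> H\<^esub> b = (z \<otimes>\<^bsub>T\<^esub> w, inv\<^bsub>H\<^esub> (\<phi> (z \<otimes>\<^bsub>T\<^esub> w)))"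
      using z w by simp
    then show "a \<otimes>\<^bsub>T \<times>\<times> H\<^esub> b \<in> N" using T.center_mult[OF z(1) w(1)] by (auto simp: N_def)
  qed
  have Nn: "N \<lhd> T \<times>\<times> H" by (rule TH.central_subgroup_normal[OF Ngrp Nsub])
  then interpret N: normal N "T \<times>\<times> H" .
  obtain f where f: "f \<in> iso ((T \<times>\<times> H) Mod N) P"
    using isoP unfolding N_def[symmetric] is_iso_def by blast
  define \<theta> where "\<theta> a = f (N #>\<^bsub>T \<times>\<times> H\<^esub> a)" for a
  interpret Q: group "(T \<times>\<times> H) Mod N" by (rule N.factorgroup_is_group)
  interpret P: group P by (rule P)
  have \<theta>hom: "\<theta> \<in> hom (T \<times>\<times> H) P"
    using hom_compose[OF N.r_coset_hom_Mod, of f P] f by (auto simp: \<theta>_def[abs_def] iso_def comp_def)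
  interpret \<theta>: group_hom "T \<times>\<times> H" P \<theta> by unfold_locales (rule \<theta>hom)
  have \<theta>ker: "\<theta> a = \<one>\<^bsub>P\<^esub> \<longleftrightarrow> a \<in> N" if a: "a \<in> carrier (T \<times>\<times> H)" for a
  proof -
    have c: "N #>\<^bsub>T \<times>\<times> H\<^esub> a \<in> carrier ((T \<times>\<times> H) Mod N)"
      using a by (auto simp: carrier_FactGroup)
    have "\<theta> a = \<one>\<^bsub>P\<^esub> \<longleftrightarrow> N #>\<^bsub>T \<times>\<times> H\<^esub> a = \<one>\<^bsub>(T \<times>\<times> H) Mod N\<^esub>"
      using f c hom_one[of f "(T \<times>\<times> H) Mod N" P] Q.group_axioms P
      unfolding \<theta>_def by (auto simp: iso_iff_mon_epi mon_iff_hom_one)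
    also have "\<dots> \<longleftrightarrow> N #>\<^bsub>T \<times>\<times> H\<^esub> a = N" by (simp add: FactGroup_def)
    also have "\<dots> \<longleftrightarrow> a \<in> N"
      using TH.coset_join1 TH.coset_join2 a Ngrp by metis
    finally show ?thesis .
  qed
  define \<mu> where "\<mu> u = lam (\<phi> (fst u)) * lam (snd u)" for u
  have \<mu>m: "\<mu> (a \<otimes>\<^bsub>T \<times>\<times> H\<^esub> b) = \<mu> a * \<mu> b" if "a \<in> center (T \<times>\<times> H)" "b \<in> center (T \<times>\<times> H)" for a b
    using that by (auto simp: cTH \<mu>_def \<phi>m \<phi>c H.lam_mult)
  have \<mu>1: "\<mu> a = 1 \<longleftrightarrow> a \<in> N" if a: "a \<in> center (T \<times>\<times> H)" for a
  proof -
    obtain z h where zh: "a = (z, h)" "z \<in> center T" "h \<in> center H" using a by (auto simp: cTH)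
    have "\<mu> a = lam (\<phi> z \<otimes>\<^bsub>H\<^esub> h)" using zh \<phi>c by (simp add: \<mu>_def H.lam_mult)
    then have "\<mu> a = 1 \<longleftrightarrow> \<phi> z \<otimes>\<^bsub>H\<^esub> h = \<one>\<^bsub>H\<^esub>"
      using zh \<phi>c by (simp add: H.lam_eq_1_iff H.center_mult)
    also have "\<dots> \<longleftrightarrow> h = inv\<^bsub>H\<^esub> (\<phi> z)"
      using zh \<phi>c center_sub by (metis H.inv_equality H.inv_inv H.inv_closed H.r_inv)
    also have "\<dots> \<longleftrightarrow> a \<in> N" using zh by (auto simp: N_def)
    finally show ?thesis .
  qed
  define lamT where "lamT z = lam (\<phi> z)" for z
  have "inj_on lamT (center T)"
    using comp_inj_on[OF \<phi>i inj_on_subset[OF H.lam_inj, of "\<phi> ` center T"]] \<phi>c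
    by (auto simp: lamT_def[abs_def] comp_def)
  then have lamT: "gauss_group T lamT r"
    using DQ_gauss_group[OF s, where e = False and lam = lamT] \<phi>m \<phi>c \<phi>1
    by (simp add: lamT_def H.lam_mult T_def)
  interpret GT: gauss_group T lamT r by (rule lamT)
  have "radical_epi (T \<times>\<times> H) P \<theta> (center (T \<times>\<times> H)) \<mu>"
  proof (unfold_locales)
    show "\<theta> ` carrier (T \<times>\<times> H) = carrier P"
    proof -
      have "f ` carrier ((T \<times>\<times> H) Mod N) = carrier P" using f by (auto simp: iso_def bij_betw_def)
      then show ?thesis by (simp add: carrier_FactGroup \<theta>_def image_image)
    qed
    show "\<mu> \<one>\<^bsub>T \<times>\<times> H\<^esub> = 1" by (simp add: \<mu>_def \<phi>1)
    fix a assume a: "a \<in> carrier (T \<times>\<times> H)"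
    show "\<theta> a = \<one>\<^bsub>P\<^esub> \<longleftrightarrow> a \<in> center (T \<times>\<times> H) \<and> \<mu> a = 1"
      using \<theta>ker[OF a] \<mu>1[of a] Nsub by blast
    show "a \<in> center (T \<times>\<times> H) \<longleftrightarrow> (\<forall>b\<in>carrier (T \<times>\<times> H). \<mu> (commut (T \<times>\<times> H) a b) = 1)"
    proof
      assume "a \<in> center (T \<times>\<times> H)"
      then show "\<forall>b\<in>carrier (T \<times>\<times> H). \<mu> (commut (T \<times>\<times> H) a b) = 1"
        by (auto simp: TH.commut_central \<mu>_def \<phi>1)
    next
      assume *: "\<forall>b\<in>carrier (T \<times>\<times> H). \<mu> (commut (T \<times>\<times> H) a b) = 1"
      obtain t h where th: "a = (t, h)" "t \<in> carrier T" "h \<in> carrier H" using a by auto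
      have "t \<in> center T"
      proof (rule T.centerI[OF th(2)])
        fix t' assume t': "t' \<in> carrier T"
        have "lamT (commut T t t') = 1"
          using *[rule_format, of "(t', \<one>\<^bsub>H\<^esub>)"] t' th
          by (simp add: DP \<mu>_def lamT_def H.commut_central)
        then show "commut T t t' = \<one>\<^bsub>T\<^esub>"
          using GT.lam_eq_1_iff th t' by (simp add: T.commut_center)
      qed
      moreover have "h \<in> center H"
      proof (rule H.centerI[OF th(3)])
        fix h' assume h': "h' \<in> carrier H"
        have "lam (commut H h h') = 1"
          using *[rule_format, of "(\<one>\<^bsub>T\<^esub>, h')"] h' th
          by (simp add: DP \<mu>_def \<phi>1 T.commut_central)
        then show "commut H h h' = \<one>\<^bsub>H\<^esub>"
          using H.lam_eq_1_iff th h' by (simp add: H.commut_center)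
      qed
      ultimately show "a \<in> center (T \<times>\<times> H)" using th by (simp add: cTH)
    qed
  qed (use TH.center_mult TH.center_inv TH.center_one center_sub[of _ "T \<times>\<times> H"] \<mu>m in \<open>auto simp: H.fin GT.fin\<close>)
  then interpret re: radical_epi "T \<times>\<times> H" P \<theta> "center (T \<times>\<times> H)" \<mu> .
  obtain p' where p': "p' > 0" "(\<Sum>t\<in>carrier T. GT.q t) = complex_of_real p'"
    using D_gauss_sum_pos[OF s lamT[unfolded T_def]] unfolding T_def by blast
  \<comment> \<open>All \<open>2 ^ r\<close>-th powers are central in both factors, so the index set
    is the full product and the sum factorises.\<close>
  have "gauss_sum (T \<times>\<times> H) (center (T \<times>\<times> H)) \<mu> (2 ^ r) =
      (\<Sum>u\<in>carrier T \<times> carrier H. \<mu> (u [^]\<^bsub>T \<times>\<times> H\<^esub> (2 ^ r :: nat)))"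
    unfolding gauss_sum_def
    by (intro sum.cong) (auto simp: DP cTH GT.pow_n_center H.pow_n_center)
  also have "\<dots> = (\<Sum>(t, h)\<in>carrier T \<times> carrier H. GT.q t * H.q h)"
    by (intro sum.cong) (auto simp: DP \<mu>_def GT.q_def H.q_def lamT_def)
  also have "\<dots> = (\<Sum>t\<in>carrier T. GT.q t) * (\<Sum>h\<in>carrier H. H.q h)"
    by (simp only: sum_product sum.cartesian_product)
  also have "\<dots> = - complex_of_real (p' * p)"
    using p p' by (simp add: H.gauss_sum_eq)
  finally show ?thesis
  proof (rule re.negative_gauss_push[rotated 3])
    fix a assume "a \<in> center (T \<times>\<times> H)"
    then obtain t h where th: "a = (t, h)" "t \<in> center T" "h \<in> center H" by (auto simp: cTH)
    then show "\<mu> (a [^]\<^bsub>T \<times>\<times> H\<^esub> (2 ^ r :: nat)) = 1"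
      using DP(2)[of t t h h "2 ^ r"]
      by (auto simp: center_sub \<mu>_def GT.center_exp H.center_exp \<phi>1)
  qed (use p p' H.r_pos in auto)
qed

lemma DQ_product_negative_gauss:
  assumes "DQ_product rs r P" "\<forall>s\<in>set rs. 1 \<le> s \<and> s \<le> r" "r \<ge> 1"
  shows "negative_gauss P r"
  using assms
proof (induction rs arbitrary: P)
  case Nil
  then show ?case using negative_gauss_Q[of r P] by simp
next
  case (Cons s rs)
  then show ?case using negative_gauss_central_product by fastforce
qed

section \<open>Non-negativity on characters\<close>

lemma mat_trace_mult_commute:
  assumes "A \<in> carrier_mat n m" "B \<in> carrier_mat m n"
  shows "mat_trace (A * B) = mat_trace (B * A)"
proof -
  have "mat_trace (A * B) = (\<Sum>i<n. \<Sum>j<m. A $$ (i, j) * B $$ (j, i))"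
    using assms by (simp add: mat_trace_def scalar_prod_def atLeast0LessThan)
  also have "\<dots> = (\<Sum>j<m. \<Sum>i<n. B $$ (j, i) * A $$ (i, j))"
    by (subst sum.swap) (simp add: mult.commute)
  also have "\<dots> = mat_trace (B * A)"
    using assms by (simp add: mat_trace_def scalar_prod_def atLeast0LessThan)
  finally show ?thesis .
qed

lemma upper_triangular_square_diag:
  fixes B :: "complex mat"
  assumes B: "B \<in> carrier_mat n n" and ut: "upper_triangular B" and i: "i < n"
  shows "(B * B) $$ (i, i) = B $$ (i, i) * B $$ (i, i)"
proof -
  have "(B * B) $$ (i, i) = (\<Sum>k<n. B $$ (i, k) * B $$ (k, i))"
    using B i by (simp add: scalar_prod_def atLeast0LessThan)
  also have "\<dots> = (\<Sum>k<n. if k = i then B $$ (i, i) * B $$ (i, i) else 0)"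
  proof (rule sum.cong)
    fix k assume k: "k \<in> {..<n}"
    consider "k = i" | "k < i" | "i < k" by linarith
    then show "B $$ (i, k) * B $$ (k, i) = (if k = i then B $$ (i, i) * B $$ (i, i) else 0)"
      using upper_triangularD[OF ut, of k i] upper_triangularD[OF ut, of i k] B i k
      by cases auto
  qed simp
  also have "\<dots> = B $$ (i, i) * B $$ (i, i)" using i by simp
  finally show ?thesis .
qed

text \<open>Schur triangularisation preserves trace and idempotence. The diagonal entries of an
  idempotent triangular matrix are 0 or 1, so the trace counts the ones.\<close>

lemma mat_trace_idempotent:
  fixes A :: "complex mat"
  assumes A: "A \<in> carrier_mat n n" and id: "A * A = A"
  shows "\<exists>k :: nat. mat_trace A = of_nat k"
proof -
  obtain es where "char_poly A = (\<Prod>a\<leftarrow>es. [:- a, 1:])"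
    using char_poly_factorized[OF A] by blast
  then obtain B where B: "B \<in> carrier_mat n n" "upper_triangular B" and sim: "similar_mat A B"
    using schur_decomposition_exists[OF A] by blast
  obtain Q R where QR: "similar_mat_wit A B Q R" using sim by (auto simp: similar_mat_def)
  note w = similar_mat_witD2[OF A QR]
  have Q: "Q \<in> carrier_mat n n" and R: "R \<in> carrier_mat n n" using w by auto
  have RQ: "R * Q = 1\<^sub>m n" and AQ: "A = Q * B * R" using w by auto
  have QB: "Q * B \<in> carrier_mat n n" using Q B by simp
  have BA: "similar_mat_wit B A R Q" by (rule similar_mat_wit_sym[OF QR])
  have "B ^\<^sub>m 2 = R * A ^\<^sub>m 2 * Q" by (rule similar_mat_wit_pow_id[OF BA])
  also have "A ^\<^sub>m 2 = A" using A id by (simp add: numeral_2_eq_2)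
  also have "R * A * Q = B" using similar_mat_witD2[OF B(1) BA] by simp
  finally have "B * B = B" using B(1) by (simp add: numeral_2_eq_2)
  then have diag: "B $$ (i, i) \<in> {0, 1}" if "i < n" for i
    using upper_triangular_square_diag[OF B that] by auto
  have "mat_trace A = mat_trace (R * (Q * B))"
    unfolding AQ using mat_trace_mult_commute[OF QB R] by simp
  also have "R * (Q * B) = B" using assoc_mult_mat[OF R Q B(1)] RQ B by simp
  also have "mat_trace B = (\<Sum>i<n. B $$ (i, i))" using B by (simp add: mat_trace_def)
  also have "\<dots> = (\<Sum>i<n. of_nat (if B $$ (i, i) = 1 then 1 else 0))"
    using diag by (intro sum.cong) auto
  also have "\<dots> = of_nat (\<Sum>i<n. (if B $$ (i, i) = 1 then 1 else 0))"
    by simp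
  finally show ?thesis by blast
qed

lemma representation_mat:
  assumes "representation G n \<rho>" "g \<in> carrier G"
  shows "\<rho> g \<in> carrier_mat n n"
  using assms unfolding representation_def hom_def
  by (auto simp: units_of_def Units_def ring_mat_simps)

lemma representation_mult:
  assumes "representation G n \<rho>" "g \<in> carrier G" "h \<in> carrier G"
  shows "\<rho> (g \<otimes>\<^bsub>G\<^esub> h) = \<rho> g * \<rho> h"
  using assms unfolding representation_def hom_def
  by (auto simp: units_of_def ring_mat_simps)

text \<open>Averaging a representation against a linear character of a subgroup gives an idempotent
  matrix, up to the order of the subgroup.\<close>

lemma (in group) representation_subgroup_sum:
  assumes fin: "finite (carrier G)" and rep: "representation G n \<rho>"
    and Z: "subgroup Z G" and l: "\<And>a b. a \<in> Z \<Longrightarrow> b \<in> Z \<Longrightarrow> l (a \<otimes> b) = l a * l b"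
  shows "\<exists>k :: nat. (\<Sum>z\<in>Z. l z * mat_trace (\<rho> z)) = of_nat (card Z) * of_nat k"
proof -
  define c where "c = complex_of_nat (card Z)"
  have Zc: "z \<in> carrier G" if "z \<in> Z" for z using Z that subgroup.mem_carrier by metis
  have finZ: "finite Z" using fin Z subgroup.subset finite_subset by metis
  have c0: "c \<noteq> 0" using finZ subgroup.one_closed[OF Z] by (auto simp: c_def)
  define f where "f i j = (\<Sum>z\<in>Z. l z * \<rho> z $$ (i, j))" for i j
  define E where "E = mat n n (\<lambda>(i, j). f i j / c)"
  have E: "E \<in> carrier_mat n n" by (simp add: E_def)
  have ff: "(\<Sum>k<n. f i k * f k j) = c * f i j" if i: "i < n" and j: "j < n" for i j
  proof -
    have "(\<Sum>k<n. f i k * f k j) = (\<Sum>k<n. \<Sum>z\<in>Z. \<Sum>w\<in>Z. l z * \<rho> z $$ (i, k) * (l w * \<rho> w $$ (k, j)))"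
      by (simp add: f_def sum_product)
    also have "\<dots> = (\<Sum>z\<in>Z. \<Sum>w\<in>Z. \<Sum>k<n. l z * \<rho> z $$ (i, k) * (l w * \<rho> w $$ (k, j)))"
      by (subst sum.swap, intro sum.cong, simp, subst sum.swap, simp)
    also have "\<dots> = (\<Sum>z\<in>Z. \<Sum>w\<in>Z. l (z \<otimes> w) * \<rho> (z \<otimes> w) $$ (i, j))"
    proof (intro sum.cong HOL.refl)
      fix z w assume zw: "z \<in> Z" "w \<in> Z"
      have m: "\<rho> z \<in> carrier_mat n n" "\<rho> w \<in> carrier_mat n n"
        using zw Zc representation_mat[OF rep] by auto
      have "\<rho> (z \<otimes> w) $$ (i, j) = (\<Sum>k<n. \<rho> z $$ (i, k) * \<rho> w $$ (k, j))"
        using m i j representation_mult[OF rep Zc[OF zw(1)] Zc[OF zw(2)]]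
        by (simp add: scalar_prod_def atLeast0LessThan)
      then show "(\<Sum>k<n. l z * \<rho> z $$ (i, k) * (l w * \<rho> w $$ (k, j))) = l (z \<otimes> w) * \<rho> (z \<otimes> w) $$ (i, j)"
        by (simp add: l zw sum_distrib_left algebra_simps)
    qed
    \<comment> \<open>For fixed \<open>z\<close> the product \<open>z \<otimes> w\<close> runs
      through \<open>Z\<close>, so every \<open>z\<close> contributes the same
      \<open>f i j\<close>.\<close>
    also have "\<dots> = (\<Sum>z\<in>Z. f i j)"
    proof (rule sum.cong)
      fix z assume z: "z \<in> Z"
      have "bij_betw (\<lambda>w. z \<otimes> w) Z Z"
        by (rule bij_betwI[where g = "\<lambda>w. inv z \<otimes> w"])
          (use z Z Zc in \<open>auto simp: subgroup.m_closed subgroup.m_inv_closed inv_mult_cancel\<close>)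
      then show "(\<Sum>w\<in>Z. l (z \<otimes> w) * \<rho> (z \<otimes> w) $$ (i, j)) = f i j"
        unfolding f_def by (rule sum.reindex_bij_betw)
    qed simp
    finally show ?thesis by (simp add: c_def)
  qed
  have "E * E = E"
  proof (rule eq_matI)
    fix i j assume ij: "i < dim_row E" "j < dim_col E"
    then have ij': "i < n" "j < n" by (auto simp: E_def)
    have "(E * E) $$ (i, j) = (\<Sum>k<n. f i k * f k j) / (c * c)"
      using ij' by (simp add: E_def scalar_prod_def atLeast0LessThan sum_divide_distrib)
    also have "\<dots> = E $$ (i, j)" using ij' c0 by (simp add: ff E_def)
    finally show "(E * E) $$ (i, j) = E $$ (i, j)" .
  qed (simp_all add: E_def)
  then obtain k :: nat where k: "mat_trace E = of_nat k" using mat_trace_idempotent[OF E] by blast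
  have "(\<Sum>z\<in>Z. l z * mat_trace (\<rho> z)) = (\<Sum>z\<in>Z. \<Sum>i<n. l z * \<rho> z $$ (i, i))"
  proof (rule sum.cong)
    fix z assume z: "z \<in> Z"
    have "dim_row (\<rho> z) = n" using representation_mat[OF rep Zc[OF z]] by simp
    then show "l z * mat_trace (\<rho> z) = (\<Sum>i<n. l z * \<rho> z $$ (i, i))"
      by (simp add: mat_trace_def sum_distrib_left)
  qed simp
  also have "\<dots> = (\<Sum>i<n. f i i)" unfolding f_def by (rule sum.swap)
  also have "\<dots> = c * mat_trace E"
    using c0 by (simp add: mat_trace_def E_def sum_distrib_left)
  finally show ?thesis using k by (auto simp: c_def)
qed

text \<open>Sorting by the value of the power expresses the sum through \<open>l z\<close> times the
  power count at \<open>z\<close>. Each irreducible constituent contributes a natural number by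
  \<open>representation_subgroup_sum\<close>, and the multiplicities are natural numbers
  too.\<close>

lemma (in group) character_gauss_sum_nonneg:
  assumes fin: "finite (carrier G)" and ch: "is_character G (\<lambda>g. of_nat (power_count G n g))"
    and Z: "subgroup Z G" and l: "\<And>a b. a \<in> Z \<Longrightarrow> b \<in> Z \<Longrightarrow> l (a \<otimes> b) = l a * l b"
  shows "\<exists>k :: nat. gauss_sum G Z l n = of_nat k"
proof -
  obtain S c where S: "finite S" "S \<subseteq> irreducible_characters G"
    and eq: "\<And>g. g \<in> carrier G \<Longrightarrow> of_nat (power_count G n g) = (\<Sum>\<psi>\<in>S. of_nat (c \<psi> :: nat) * \<psi> g)"
    using ch unfolding is_character_def by blast
  have Zc: "z \<in> carrier G" if "z \<in> Z" for z using Z that subgroup.mem_carrier by metis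
  have finZ: "finite Z" using fin Z subgroup.subset finite_subset by metis
  have "\<exists>k :: nat. (\<Sum>z\<in>Z. l z * \<psi> z) = of_nat k" if \<psi>: "\<psi> \<in> S" for \<psi>
  proof -
    obtain m \<rho> where \<rho>: "irreducible_representation G m \<rho>"
      "\<psi> = restrict (\<lambda>g. mat_trace (\<rho> g)) (carrier G)"
      using \<psi> S(2) unfolding irreducible_characters_def by blast
    have "representation G m \<rho>" using \<rho>(1) by (simp add: irreducible_representation_def)
    then obtain k :: nat where "(\<Sum>z\<in>Z. l z * mat_trace (\<rho> z)) = of_nat (card Z) * of_nat k"
      using representation_subgroup_sum[OF fin _ Z l] by blast
    moreover have "(\<Sum>z\<in>Z. l z * \<psi> z) = (\<Sum>z\<in>Z. l z * mat_trace (\<rho> z))"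
      using Zc by (intro sum.cong) (auto simp: \<rho>(2))
    ultimately show ?thesis by (metis of_nat_mult)
  qed
  then obtain k :: "('a \<Rightarrow> complex) \<Rightarrow> nat" where k: "\<And>\<psi>. \<psi> \<in> S \<Longrightarrow> (\<Sum>z\<in>Z. l z * \<psi> z) = of_nat (k \<psi>)"
    by metis
  have "gauss_sum G Z l n = (\<Sum>z\<in>Z. \<Sum>g | g \<in> {g \<in> carrier G. g [^] n \<in> Z} \<and> g [^] n = z. l (g [^] n))"
    unfolding gauss_sum_def by (rule sum.group[symmetric]) (use fin finZ in auto)
  also have "\<dots> = (\<Sum>z\<in>Z. l z * of_nat (power_count G n z))"
  proof (rule sum.cong)
    fix z assume z: "z \<in> Z"
    have "(\<Sum>g | g \<in> {g \<in> carrier G. g [^] n \<in> Z} \<and> g [^] n = z. l (g [^] n)) =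
        (\<Sum>g | g \<in> carrier G \<and> g [^] n = z. l z)"
      using z by (intro sum.cong) auto
    then show "(\<Sum>g | g \<in> {g \<in> carrier G. g [^] n \<in> Z} \<and> g [^] n = z. l (g [^] n)) = l z * of_nat (power_count G n z)"
      by (simp add: power_count_def)
  qed simp
  also have "\<dots> = (\<Sum>z\<in>Z. l z * (\<Sum>\<psi>\<in>S. of_nat (c \<psi>) * \<psi> z))"
    using Zc by (intro sum.cong) (auto simp: eq)
  also have "\<dots> = (\<Sum>z\<in>Z. \<Sum>\<psi>\<in>S. of_nat (c \<psi>) * (l z * \<psi> z))"
    by (simp add: sum_distrib_left algebra_simps)
  also have "\<dots> = (\<Sum>\<psi>\<in>S. of_nat (c \<psi>) * (\<Sum>z\<in>Z. l z * \<psi> z))"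
    by (subst sum.swap) (simp add: sum_distrib_left)
  also have "\<dots> = of_nat (\<Sum>\<psi>\<in>S. c \<psi> * k \<psi>)" by (simp add: k)
  finally show ?thesis by blast
qed

lemma class2_group_of_nilpotency:
  assumes "group G" "has_nilpotency_class G 2"
  shows "class2_group G"
proof -
  interpret group G by fact
  have lc: "lower_central G 2 = {\<one>\<^bsub>G\<^esub>}" using assms(2) by (simp add: has_nilpotency_class_def)
  have "commut G g h \<in> center G" if gh: "g \<in> carrier G" "h \<in> carrier G" for g h
  proof (rule centerI)
    fix k assume k: "k \<in> carrier G"
    have "commut G g h \<in> lower_central G 1"
      unfolding One_nat_def lower_central.simps commutator_subgroup_def
      by (rule generate.incl) (use gh in \<open>auto simp: commut_def\<close>)
    then have "commut G (commut G g h) k \<in> lower_central G (Suc 1)"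
      unfolding lower_central.simps(2) commutator_subgroup_def[of G "lower_central G 1"]
      by (intro generate.incl) (use k in \<open>auto simp: commut_def[of G "commut G g h"]\<close>)
    then show "commut G (commut G g h) k = \<one>\<^bsub>G\<^esub>" using lc by (simp add: numeral_2_eq_2)
  qed (use gh in simp)
  then show ?thesis by unfold_locales
qed

text \<open>Pull \<open>lam\<close> back to the preimage \<open>R\<close> of the centre of
  \<open>P\<close>. The Gauss sum over \<open>G\<close> is then a positive multiple of the negative
  one over \<open>P\<close>, yet for a character it is a natural number.\<close>

lemma no_epi_if_character:
  assumes G: "class2_group G" and fin: "finite (carrier G)"
    and ch: "is_character G (\<lambda>g. of_nat (power_count G (2 ^ r) g))"
    and neg: "negative_gauss P r" and f: "f \<in> epi G P"
  shows False
proof -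
  obtain lam p where lam: "gauss_group P lam r"
    and p: "p > 0" "gauss_sum P (center P) lam (2 ^ r) = - complex_of_real p"
    using neg by (auto simp: negative_gauss_def)
  interpret P: gauss_group P lam r by (rule lam)
  interpret class2_group G by (rule G)
  interpret f: group_hom G P f by unfold_locales (use f in \<open>auto simp: epi_def\<close>)
  define R where "R = {a \<in> carrier G. f a \<in> center P}"
  have surj: "f ` carrier G = carrier P" using f by (simp add: epi_def)
  have "radical_epi G P f R (\<lambda>a. lam (f a))"
  proof (unfold_locales)
    fix a assume a: "a \<in> carrier G"
    show "f a = \<one>\<^bsub>P\<^esub> \<longleftrightarrow> a \<in> R \<and> lam (f a) = 1"
      using a P.lam_eq_1_iff[of "f a"] by (auto simp: R_def)
    have com: "lam (f (commut G a b)) = 1 \<longleftrightarrow> commut P (f a) (f b) = \<one>\<^bsub>P\<^esub>" if b: "b \<in> carrier G" for b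
      using a b by (simp add: f.hom_commut P.lam_eq_1_iff P.commut_center)
    show "a \<in> R \<longleftrightarrow> (\<forall>b\<in>carrier G. lam (f (commut G a b)) = 1)"
    proof
      assume "a \<in> R"
      then show "\<forall>b\<in>carrier G. lam (f (commut G a b)) = 1"
        by (auto simp: com R_def P.commut_central)
    next
      assume *: "\<forall>b\<in>carrier G. lam (f (commut G a b)) = 1"
      have "f a \<in> center P"
      proof (rule P.centerI)
        fix q assume "q \<in> carrier P"
        then have "q \<in> f ` carrier G" using surj by simp
        then show "commut P (f a) q = \<one>\<^bsub>P\<^esub>" using * com by auto
      qed (use a in simp)
      then show "a \<in> R" using a by (simp add: R_def)
    qed
  next
    show "center G \<subseteq> R"
    proof
      fix z assume z: "z \<in> center G"
      have "f z \<in> center P"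
      proof (rule P.centerI)
        fix q assume "q \<in> carrier P"
        then have "q \<in> f ` carrier G" using surj by simp
        then obtain b where "b \<in> carrier G" "q = f b" by auto
        then show "commut P (f z) q = \<one>\<^bsub>P\<^esub>"
          using z center_sub[OF z] f.hom_commut[of z b] by (simp add: commut_central)
      qed (use center_sub[OF z] in simp)
      then show "z \<in> R" using center_sub[OF z] by (simp add: R_def)
    qed
  qed (auto simp: fin surj R_def P.lam_mult P.center_mult P.center_inv)
  then interpret re: radical_epi G P f R "\<lambda>a. lam (f a)" .
  \<comment> \<open>\<open>re.push\<close> is defined through a choice of preimages and has to be
    matched with the given \<open>lam\<close>.\<close>
  have push: "re.push q = lam q" if "q \<in> center P" for q
    using that re.push_eq unfolding re.center_P by auto
  have "gauss_sum P (center P) re.push (2 ^ r) = gauss_sum P (center P) lam (2 ^ r)"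
    unfolding gauss_sum_def by (rule sum.cong) (auto simp: push)
  then have s: "gauss_sum G R (\<lambda>a. lam (f a)) (2 ^ r) = - complex_of_real (card (kernel G P f) * p)"
    using re.gauss_sum_push[of "2 ^ r"] p by simp
  obtain k :: nat where "gauss_sum G R (\<lambda>a. lam (f a)) (2 ^ r) = of_nat k"
    using character_gauss_sum_nonneg[OF fin ch re.R, of "\<lambda>a. lam (f a)"] re.\<mu>_mult by blast
  then have "real k = - (card (kernel G P f) * p)"
    using s by (metis of_real_eq_iff of_real_minus of_real_of_nat_eq)
  moreover have "card (kernel G P f) * p > 0" using re.card_kernel_pos p by simp
  ultimately show False by linarith
qed

section \<open>Recognising central products\<close>

text \<open>If \<open>\<psi> t\<close> lies in \<open>H\<close>, it commutes with the image of
  \<open>T\<close>, so \<open>t\<close> is central by injectivity. Hence the kernel of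
  \<open>(t, h) \<mapsto> \<psi> t \<otimes> h\<close> is precisely the subgroup divided out in
  \<open>central_product\<close>.\<close>

lemma (in group) central_product_internal:
  fixes T :: "('t, 'm) monoid_scheme"
  assumes T: "group T" and H: "subgroup H G" and \<psi>: "\<psi> \<in> hom T G" and inj: "inj_on \<psi> (carrier T)"
    and com: "\<And>t h. t \<in> carrier T \<Longrightarrow> h \<in> H \<Longrightarrow> \<psi> t \<otimes> h = h \<otimes> \<psi> t"
    and cen: "\<And>z. z \<in> center T \<Longrightarrow> \<psi> z \<in> H"
  defines "TH \<equiv> (\<lambda>(t, h). \<psi> t \<otimes> h) ` (carrier T \<times> H)"
  shows "subgroup TH G" "central_product T (G\<lparr>carrier := H\<rparr>) (G\<lparr>carrier := TH\<rparr>)"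
proof -
  let ?H = "G\<lparr>carrier := H\<rparr>"
  let ?\<theta> = "\<lambda>(t, h). \<psi> t \<otimes> h"
  interpret T: group T by (rule T)
  interpret H: group ?H by (rule subgroup_imp_group[OF H])
  interpret TxH: group "T \<times>\<times> ?H" by (rule DirProd_group) unfold_locales
  interpret \<psi>: group_hom T G \<psi> by unfold_locales (rule \<psi>)
  have Hc: "h \<in> carrier G" if "h \<in> H" for h using H that subgroup.mem_carrier by metis
  have invH: "inv\<^bsub>?H\<^esub> h = inv h" if "h \<in> H" for h using m_inv_consistent[OF H that] .
  have \<theta>: "?\<theta> \<in> hom (T \<times>\<times> ?H) G"
  proof (rule homI)
    fix a b assume "a \<in> carrier (T \<times>\<times> ?H)" "b \<in> carrier (T \<times>\<times> ?H)"
    then obtain t h t' h' where ab: "a = (t, h)" "b = (t', h')" "t \<in> carrier T" "t' \<in> carrier T" "h \<in> H" "h' \<in> H"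
      by auto
    have "\<psi> t \<otimes> \<psi> t' \<otimes> (h \<otimes> h') = \<psi> t \<otimes> (\<psi> t' \<otimes> h) \<otimes> h'"
      using ab Hc by (simp add: m_assoc)
    also have "\<dots> = \<psi> t \<otimes> h \<otimes> (\<psi> t' \<otimes> h')"
      using ab Hc com[of t' h] by (simp add: m_assoc)
    finally show "?\<theta> (a \<otimes>\<^bsub>T \<times>\<times> ?H\<^esub> b) = ?\<theta> a \<otimes> ?\<theta> b" using ab by simp
  qed (auto simp: Hc)
  interpret \<theta>: group_hom "T \<times>\<times> ?H" G ?\<theta> by unfold_locales (rule \<theta>)
  show sub: "subgroup TH G" using \<theta>.img_is_subgroup by (simp add: TH_def)
  interpret TH: group "G\<lparr>carrier := TH\<rparr>" by (rule subgroup_imp_group[OF sub])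
  have \<theta>': "?\<theta> \<in> hom (T \<times>\<times> ?H) (G\<lparr>carrier := TH\<rparr>)"
    using \<theta> by (auto simp: hom_def TH_def)
  interpret \<theta>': group_hom "T \<times>\<times> ?H" "G\<lparr>carrier := TH\<rparr>" ?\<theta> by unfold_locales (rule \<theta>')
  have centerH: "\<psi> z \<in> center ?H" if "z \<in> center T" for z
    using cen[OF that] com[OF center_sub[OF that]] by (simp add: center_def)
  have inH: "t \<in> center T" if t: "t \<in> carrier T" "\<psi> t \<in> H" for t
  proof (rule T.centerI[OF t(1)])
    fix t' assume t': "t' \<in> carrier T"
    have "\<psi> (commut T t t') = commut G (\<psi> t) (\<psi> t')" using t t' by (rule_tac \<psi>.hom_commut)
    also have "\<dots> = \<one>" using com[OF t' t(2)] t t' by (simp add: commut_one_iff)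
    finally show "commut T t t' = \<one>\<^bsub>T\<^esub>"
      using inj t t' by (metis T.commut_closed T.one_closed \<psi>.hom_one inj_onD)
  qed
  have ker: "kernel (T \<times>\<times> ?H) (G\<lparr>carrier := TH\<rparr>) ?\<theta> = {(z, inv\<^bsub>?H\<^esub> (\<psi> z)) | z. z \<in> center T}"
  proof (intro equalityI subsetI)
    fix u assume "u \<in> kernel (T \<times>\<times> ?H) (G\<lparr>carrier := TH\<rparr>) ?\<theta>"
    then obtain t h where u: "u = (t, h)" "t \<in> carrier T" "h \<in> H" "\<psi> t \<otimes> h = \<one>"
      by (auto simp: kernel_def)
    have "\<psi> t = inv h" using u Hc by (metis \<psi>.hom_closed inv_equality inv_inv)
    then have "\<psi> t \<in> H" using u H by (simp add: subgroup.m_inv_closed)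
    moreover have "h = inv (\<psi> t)" using u Hc \<open>\<psi> t = inv h\<close> by simp
    ultimately show "u \<in> {(z, inv\<^bsub>?H\<^esub> (\<psi> z)) | z. z \<in> center T}"
      using u inH invH by auto
  next
    fix u assume "u \<in> {(z, inv\<^bsub>?H\<^esub> (\<psi> z)) | z. z \<in> center T}"
    then obtain z where z: "z \<in> center T" "u = (z, inv (\<psi> z))" using invH cen by auto
    then show "u \<in> kernel (T \<times>\<times> ?H) (G\<lparr>carrier := TH\<rparr>) ?\<theta>"
      using cen[OF z(1)] H center_sub[OF z(1)] by (simp add: kernel_def subgroup.m_inv_closed)
  qed
  have "?\<theta> ` carrier (T \<times>\<times> ?H) = carrier (G\<lparr>carrier := TH\<rparr>)" by (simp add: TH_def)
  then have iso: "(T \<times>\<times> ?H) Mod {(z, inv\<^bsub>?H\<^esub> (\<psi> z)) | z. z \<in> center T} \<cong> G\<lparr>carrier := TH\<rparr>"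
    using \<theta>'.FactGroup_iso unfolding ker by blast
  have ph: "\<psi> \<in> hom (T\<lparr>carrier := center T\<rparr>) ?H"
    using cen by (auto simp: hom_def center_sub)
  interpret Tc: group "T\<lparr>carrier := center T\<rparr>"
    by (rule T.subgroup_imp_group[OF T.subgroup_center])
  interpret ph: group_hom "T\<lparr>carrier := center T\<rparr>" ?H \<psi> by unfold_locales (rule ph)
  have K: "subgroup (\<psi> ` center T) ?H" using ph.img_is_subgroup by simp
  have "inj_on \<psi> (center T)" using inj by (rule inj_on_subset) (auto intro: center_sub)
  then have "\<psi> \<in> iso (T\<lparr>carrier := center T\<rparr>) (?H\<lparr>carrier := \<psi> ` center T\<rparr>)"
    by (auto simp: iso_def bij_betw_def hom_def center_sub)
  then show "central_product T ?H (G\<lparr>carrier := TH\<rparr>)"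
    unfolding central_product_def using iso K centerH TH.group_axioms by blast
qed

lemma (in group) iso_image_subgroup:
  fixes T :: "('t, 'm) monoid_scheme"
  assumes T: "group T" and \<psi>: "\<psi> \<in> hom T G" and inj: "inj_on \<psi> (carrier T)"
  shows "subgroup (\<psi> ` carrier T) G" "T \<cong> G\<lparr>carrier := \<psi> ` carrier T\<rparr>"
proof -
  interpret T: group T by (rule T)
  interpret \<psi>: group_hom T G \<psi> by unfold_locales (rule \<psi>)
  show "subgroup (\<psi> ` carrier T) G" by (rule \<psi>.img_is_subgroup)
  have "\<psi> \<in> iso T (G\<lparr>carrier := \<psi> ` carrier T\<rparr>)"
    using inj by (auto simp: iso_def bij_betw_def hom_def)
  then show "T \<cong> G\<lparr>carrier := \<psi> ` carrier T\<rparr>" by (auto simp: is_iso_def)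
qed

text \<open>Translation by \<open>z\<close> permutes the summation range and multiplies the sum by
  \<open>lam (z [^] n)\<close>; a non-zero sum forces this factor to be 1.\<close>

lemma (in faithful_group) center_exp_if_gauss_sum:
  assumes "gauss_sum G (center G) lam n \<noteq> 0" and z: "z \<in> center G"
  shows "z [^] n = \<one>"
proof -
  let ?A = "{g \<in> carrier G. g [^] n \<in> center G}"
  have zc: "z \<in> carrier G" using z by (rule center_sub)
  have pw: "(z \<otimes> g) [^] n = z [^] n \<otimes> g [^] n" if "g \<in> carrier G" for g
    using center_pow_mult[OF z that] .
  have mem: "w \<otimes> g \<in> ?A" if w: "w \<in> center G" and g: "g \<in> ?A" for w g
    using g center_sub[OF w] center_pow_mult[OF w, of g n] center_pow[OF w, of n] by (auto intro: center_mult)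
  have "bij_betw (\<lambda>g. z \<otimes> g) ?A ?A"
    by (rule bij_betwI[where g = "\<lambda>g. inv z \<otimes> g"])
      (use zc z mem center_inv in \<open>auto simp: inv_mult_cancel\<close>)
  then have "gauss_sum G (center G) lam n = (\<Sum>g\<in>?A. lam ((z \<otimes> g) [^] n))"
    unfolding gauss_sum_def by (rule sum.reindex_bij_betw[symmetric])
  also have "\<dots> = (\<Sum>g\<in>?A. lam (z [^] n) * lam (g [^] n))"
    by (rule sum.cong) (auto simp: pw lam_mult center_pow z)
  also have "\<dots> = lam (z [^] n) * gauss_sum G (center G) lam n"
    by (simp add: gauss_sum_def sum_distrib_left)
  finally have "lam (z [^] n) = 1" using assms(1) by simp
  then show ?thesis using lam_eq_1_iff center_pow[OF z] by blast
qed

section \<open>Consequences of a non-zero Gauss sum\<close>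

context gauss_group
begin

text \<open>The radical of \<open>eps\<close>. It contains the centre, in general properly, because
  \<open>eps\<close> sees only the \<open>2 ^ (r - 1)\<close>-th powers of commutators.\<close>

definition rad :: "'a set" where
  "rad = {x \<in> carrier G. \<forall>g\<in>carrier G. eps x g = 1}"

lemma translate_sum:
  fixes f :: "'a \<Rightarrow> complex"
  assumes "subgroup C G" "x \<in> C"
  shows "(\<Sum>g\<in>C. f (x \<otimes> g)) = (\<Sum>g\<in>C. f g)"
proof (rule sum.reindex_bij_betw, rule bij_betwI[where g = "\<lambda>w. inv x \<otimes> w"])
  have "c \<in> carrier G" if "c \<in> C" for c using that assms subgroup.mem_carrier by metis
  then show "\<And>c. c \<in> C \<Longrightarrow> inv x \<otimes> (x \<otimes> c) = c" "\<And>c. c \<in> C \<Longrightarrow> x \<otimes> (inv x \<otimes> c) = c"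
    using assms by (auto simp: inv_mult_cancel)
qed (use assms in \<open>auto simp: subgroup.m_closed subgroup.m_inv_closed\<close>)

text \<open>The translation argument of \<open>center_exp_if_gauss_sum\<close> again, now with an
  element orthogonal to the whole group.\<close>

lemma q_rad:
  assumes S: "(\<Sum>g\<in>carrier G. q g) \<noteq> 0" and x: "x \<in> rad"
  shows "q x = 1"
proof -
  have xc: "x \<in> carrier G" using x by (simp add: rad_def)
  have "(\<Sum>g\<in>carrier G. q g) = (\<Sum>g\<in>carrier G. q (x \<otimes> g))"
    by (rule translate_sum[OF subgroup_self xc, symmetric])
  also have "\<dots> = (\<Sum>g\<in>carrier G. q x * q g)"
    using x by (intro sum.cong) (auto simp: q_mult rad_def)
  also have "\<dots> = q x * (\<Sum>g\<in>carrier G. q g)" by (simp add: sum_distrib_left)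
  finally show ?thesis using S by simp
qed

text \<open>Since \<open>eps\<close> takes only the values 1 and -1, squares lie in
  \<open>rad\<close>, where \<open>q\<close> is 1.\<close>

lemma q_cases:
  assumes S: "(\<Sum>g\<in>carrier G. q g) \<noteq> 0" and g: "g \<in> carrier G"
  shows "q g = 1 \<or> q g = -1"
proof -
  have "eps (g \<otimes> g) h = 1" if "h \<in> carrier G" for h
    using g that eps_cases[OF g that] by (auto simp: eps_mult_left)
  then have "g \<otimes> g \<in> rad" using g by (simp add: rad_def)
  then have "q (g \<otimes> g) = 1" by (rule q_rad[OF S])
  then have "q g ^ 2 = 1" using g by (simp add: q_mult power2_eq_square)
  then show ?thesis by (simp add: power2_eq_1_iff)
qed

text \<open>Take \<open>x\<close> with \<open>q x = -1\<close>. On its orthogonal complement the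
  translation \<open>g \<mapsto> x \<otimes> g\<close> reverses the sign of \<open>q\<close>, so
  this part cancels. Without a partner \<open>y\<close> all remaining values would be 1, and the
  total could not be negative.\<close>

lemma Q_pair_exists:
  assumes S: "(\<Sum>g\<in>carrier G. q g) = - complex_of_real p" "p > 0"
  shows "\<exists>x\<in>carrier G. \<exists>y\<in>carrier G. q x = -1 \<and> q y = -1 \<and> eps x y = -1"
proof (rule ccontr)
  assume no: "\<not> ?thesis"
  have S0: "(\<Sum>g\<in>carrier G. q g) \<noteq> 0" using S by simp
  have nonneg: False if "(\<Sum>g\<in>carrier G. q g) = of_nat k" for k :: nat
  proof -
    have "complex_of_real (real k) = complex_of_real (- p)" using S(1) that by simp
    then have "real k = - p" by (simp only: of_real_eq_iff)
    then show False using S(2) by simp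
  qed
  have "\<exists>x\<in>carrier G. q x = -1"
  proof (rule ccontr)
    assume none: "\<not> (\<exists>x\<in>carrier G. q x = -1)"
    have "q g = 1" if "g \<in> carrier G" for g using q_cases[OF S0 that] none that by auto
    then show False using nonneg[of "card (carrier G)"] by simp
  qed
  then obtain x where x: "x \<in> carrier G" "q x = -1" by auto
  let ?A = "{g \<in> carrier G. eps x g = 1}" and ?B = "{g \<in> carrier G. eps x g = -1}"
  have A: "(\<Sum>g\<in>?A. q g) = 0"
  proof -
    have "bij_betw (\<lambda>g. x \<otimes> g) ?A ?A"
    proof (rule bij_betwI[where g = "\<lambda>g. inv x \<otimes> g"])
      have "eps x (inv x) = 1" using x eps_mult_right[of x x "inv x"] by simp
      then show "(\<lambda>g. inv x \<otimes> g) \<in> ?A \<rightarrow> ?A" using x by (auto simp: eps_mult_right)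
    qed (use x in \<open>auto simp: eps_mult_right inv_mult_cancel\<close>)
    then have "(\<Sum>g\<in>?A. q g) = (\<Sum>g\<in>?A. q (x \<otimes> g))" by (rule sum.reindex_bij_betw[symmetric])
    also have "\<dots> = (\<Sum>g\<in>?A. - q g)" using x by (intro sum.cong) (auto simp: q_mult)
    finally show ?thesis by (simp add: sum_negf)
  qed
  have B: "(\<Sum>g\<in>?B. q g) = of_nat (card ?B)"
  proof -
    have "q g = 1" if "g \<in> ?B" for g
      using that x no q_cases[OF S0, of g] by auto
    then have "(\<Sum>g\<in>?B. q g) = (\<Sum>g\<in>?B. 1)" by (intro sum.cong) auto
    then show ?thesis by simp
  qed
  have "carrier G = ?A \<union> ?B" using x eps_cases by auto
  then have "(\<Sum>g\<in>carrier G. q g) = (\<Sum>g\<in>?A. q g) + (\<Sum>g\<in>?B. q g)"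
    using fin by (subst sum.union_disjoint[symmetric]) auto
  then show False using nonneg A B by simp
qed

text \<open>The \<open>N\<close> distinct powers of \<open>z\<close> are mapped by
  \<open>lam\<close> onto all \<open>N\<close>-th roots of unity, so \<open>lam u\<close> is one of
  these values.\<close>

lemma center_cyclic:
  assumes z: "z \<in> center G" "ord z = N" and u: "u \<in> center G" "u [^] N = \<one>"
  shows "\<exists>i::nat. u = z [^] i"
proof -
  have zc: "z \<in> carrier G" by (rule center_sub[OF z(1)])
  have N: "N \<ge> 1" using ord_ge_1[OF fin zc] z by simp
  have finr: "finite {w::complex. w ^ N = 1}" and card: "card {w::complex. w ^ N = 1} = N"
    using N by (auto simp: card_roots_unity_eq intro: finite_roots_unity)
  have inj: "inj_on (\<lambda>i. lam (z [^] i)) {..<N}"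
  proof (rule inj_onI)
    fix i j assume ij: "i \<in> {..<N}" "j \<in> {..<N}" "lam (z [^] i) = lam (z [^] j)"
    then have "z [^] i = z [^] j" using lam_inj center_pow[OF z(1)] by (auto dest: inj_onD)
    then show "i = j" using ord_inj[OF zc] ij z(2) by (auto simp: inj_on_def)
  qed
  have "(\<lambda>i. lam (z [^] i)) ` {..<N} \<subseteq> {w. w ^ N = 1}"
    using z pow_ord_eq_1[OF zc]
    by (auto simp: lam_pow simp flip: power_mult) (metis lam_one lam_pow mult.commute power_mult power_one)
  then have "(\<lambda>i. lam (z [^] i)) ` {..<N} = {w. w ^ N = 1}"
    using card card_image[OF inj] finr by (intro card_subset_eq) auto
  moreover have "lam u \<in> {w. w ^ N = 1}" using u by (simp flip: lam_pow)
  ultimately have "lam u \<in> (\<lambda>i. lam (z [^] i)) ` {..<N}" by simp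
  then obtain i :: nat where "lam u = lam (z [^] i)" by auto
  then have "u = z [^] i" using lam_inj u(1) center_pow[OF z(1)] by (auto dest: inj_onD)
  then show ?thesis by blast
qed

lemma ord_commut:
  assumes "x \<in> carrier G" "y \<in> carrier G" "eps x y = -1"
  shows "ord (commut G x y) = 2 ^ r"
proof (rule ord_eq_two_pow)
  show "commut G x y [^] (2 ^ (r - 1) :: nat) \<noteq> \<one>"
    using assms unfolding eps_def by auto
qed (use assms r_pos in \<open>auto simp: center_exp commut_center\<close>)

end

text \<open>The elements are natural numbers because \<open>DQ_product\<close> speaks of such groups
  only. As its order equals the bound on the exponent, \<open>z0\<close> generates the
  centre.\<close>

locale nat_gauss_group = gauss_group G lam r for G :: "nat monoid" (structure) and lam r +
  fixes z0
  assumes z0: "z0 \<in> center G" "ord z0 = 2 ^ r" and S_neq: "(\<Sum>g\<in>carrier G. q g) \<noteq> 0"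
begin

text \<open>Stage of the decomposition: \<open>G\<close> is the product of the commuting subgroups \<open>C\<close> and \<open>H\<close>,
  where \<open>H\<close> is already recognised as an iterated central product and \<open>C\<close> has a positive
  Gauss sum, so that only \<open>D\<close> factors remain to be split off from \<open>C\<close>.\<close>

definition partial_decomp :: "nat set \<Rightarrow> nat set \<Rightarrow> nat list \<Rightarrow> bool" where
  "partial_decomp C H ss \<longleftrightarrow> subgroup C G \<and> subgroup H G \<and> center G \<subseteq> C \<and> center G \<subseteq> H \<and>
     (\<forall>c\<in>C. \<forall>h\<in>H. commut G c h = \<one>) \<and> (\<forall>g\<in>carrier G. \<exists>c\<in>C. \<exists>h\<in>H. g = c \<otimes> h) \<and>
     DQ_product ss r (G\<lparr>carrier := H\<rparr>) \<and> sorted ss \<and> (\<forall>s\<in>set ss. 1 \<le> s \<and> s \<le> r) \<and>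
     (\<forall>s\<in>set ss. \<forall>g\<in>C. \<forall>h\<in>C. commut G g h [^] (2 ^ s :: nat) = \<one>) \<and>
     (\<exists>p>0. (\<Sum>g\<in>C. q g) = complex_of_real p)"

text \<open>For \<open>s = r\<close> the form \<open>eps\<close> is non-trivial on \<open>C\<close>,
  and positivity of the sum provides \<open>x\<close> and \<open>y\<close> with \<open>q = 1\<close>
  and \<open>eps x y = -1\<close>. For \<open>s < r\<close> it is trivial there, so \<open>q\<close>
  is 1 on \<open>C\<close>, and any two elements with a commutator of order \<open>2 ^ s\<close> can
  be corrected by central factors.\<close>

lemma find_D_pair:
  assumes C: "subgroup C G" and H: "subgroup H G" and cC: "center G \<subseteq> C"
    and CH: "\<And>c h. c \<in> C \<Longrightarrow> h \<in> H \<Longrightarrow> commut G c h = \<one>"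
    and gen: "\<And>g. g \<in> carrier G \<Longrightarrow> \<exists>c\<in>C. \<exists>h\<in>H. g = c \<otimes> h"
    and p: "p > 0" "(\<Sum>g\<in>C. q g) = complex_of_real p"
    and s: "1 \<le> s" "s \<le> r" and exp: "\<And>g h. g \<in> C \<Longrightarrow> h \<in> C \<Longrightarrow> commut G g h [^] (2 ^ s :: nat) = \<one>"
    and ne: "g0 \<in> C" "h0 \<in> C" "commut G g0 h0 [^] (2 ^ (s - 1) :: nat) \<noteq> \<one>"
  shows "\<exists>x\<in>C. \<exists>y\<in>C. x [^] (2 ^ s :: nat) = \<one> \<and> y [^] (2 ^ s :: nat) = \<one> \<and> ord (commut G x y) = 2 ^ s"
proof -
  have Cc: "c \<in> carrier G" if "c \<in> C" for c using C that subgroup.mem_carrier by metis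
  have Hc: "h \<in> carrier G" if "h \<in> H" for h using H that subgroup.mem_carrier by metis
  have rad: "x \<in> rad" if x: "x \<in> C" "\<And>g. g \<in> C \<Longrightarrow> eps x g = 1" for x
    unfolding rad_def
  proof (intro CollectI conjI ballI)
    fix g assume "g \<in> carrier G"
    then obtain c h where ch: "c \<in> C" "h \<in> H" "g = c \<otimes> h" using gen by blast
    then show "eps x g = 1"
      using x Cc Hc CH by (simp add: eps_mult_right eps_commute_one)
  qed (use x Cc in auto)
  show ?thesis
  proof (cases "s = r")
    case True
    have "\<exists>x\<in>C. q x = 1 \<and> (\<exists>y\<in>C. eps x y \<noteq> 1)"
    proof (rule ccontr)
      assume no: "\<not> ?thesis"
      let ?R = "{x \<in> C. \<forall>y\<in>C. eps x y = 1}"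
      have finC: "finite C" using fin Cc by (auto intro: finite_subset)
      have R1: "q x = 1" if "x \<in> ?R" for x using that rad q_rad[OF S_neq] by auto
      have e0: "eps g0 h0 \<noteq> 1"
        using ne True lam_eq_1_iff Cc by (simp add: eps_def center_pow commut_center)
      \<comment> \<open>Translation by \<open>g0\<close> moves the radical \<open>?R\<close> of
        \<open>C\<close> into its set complement, so at most half of \<open>C\<close> is radical.
        With \<open>q = -1\<close> on the rest, the sum over \<open>C\<close> could not be
        positive.\<close>
      have "inj_on (\<lambda>x. g0 \<otimes> x) ?R" using Cc ne by (auto simp: inj_on_def)
      moreover have "(\<lambda>x. g0 \<otimes> x) ` ?R \<subseteq> C - ?R"
      proof
        fix u assume "u \<in> (\<lambda>x. g0 \<otimes> x) ` ?R"
        then obtain x where x: "x \<in> ?R" "u = g0 \<otimes> x" by blast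
        then have "eps u h0 = eps g0 h0" using ne Cc by (simp add: eps_mult_left)
        then have "eps u h0 \<noteq> 1" using e0 by simp
        then have "u \<notin> ?R" using ne(2) by blast
        moreover have "u \<in> C" using x ne C by (simp add: subgroup.m_closed)
        ultimately show "u \<in> C - ?R" by simp
      qed
      ultimately have le: "card ?R \<le> card (C - ?R)"
        using finC by (metis (no_types, lifting) card_inj_on_le finite_Diff)
      have "(\<Sum>g\<in>C. q g) = (\<Sum>g\<in>?R. q g) + (\<Sum>g\<in>C - ?R. q g)"
        using finC by (subst sum.union_disjoint[symmetric]) (auto intro!: arg_cong2[of _ _ _ _ sum])
      also have "(\<Sum>g\<in>?R. q g) = of_nat (card ?R)" using R1 by simp
      also have "(\<Sum>g\<in>C - ?R. q g) = (\<Sum>g\<in>C - ?R. -1)"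
      proof (rule sum.cong)
        fix g assume g: "g \<in> C - ?R"
        then have "q g \<noteq> 1" using no by auto
        then show "q g = -1" using q_cases[OF S_neq, of g] g Cc by auto
      qed simp
      finally have "complex_of_real p = complex_of_real (real (card ?R) - real (card (C - ?R)))"
        using p by simp
      then have "p = real (card ?R) - real (card (C - ?R))" by (simp only: of_real_eq_iff)
      then show False using le p by simp
    qed
    then obtain x y where x: "x \<in> C" "q x = 1" and y: "y \<in> C" "eps x y \<noteq> 1" by blast
    have exy: "eps x y = -1" using eps_cases[of x y] x y Cc by auto
    \<comment> \<open>Replacing \<open>y\<close> by \<open>x \<otimes> y\<close> changes the sign of
      \<open>q\<close>, since \<open>q x = 1\<close> and \<open>eps x y = -1\<close>, but leaves
      \<open>eps x y\<close> as it is.\<close>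
    have qy: "q y = 1 \<or> q (x \<otimes> y) = 1"
      using q_cases[OF S_neq, of y] x y Cc exy by (auto simp: q_mult)
    obtain y' where y': "y' \<in> C" "q y' = 1" "eps x y' = -1"
    proof (cases "q y = 1")
      case True
      then show ?thesis using that y exy by blast
    next
      case False
      have "eps x (x \<otimes> y) = -1" using x y Cc exy by (simp add: eps_mult_right)
      then show ?thesis using that[of "x \<otimes> y"] False qy x y C by (auto simp: subgroup.m_closed)
    qed
    have "u [^] (2 ^ s :: nat) = \<one>" if "u \<in> C" "q u = 1" for u
      using that lam_eq_1_iff[OF pow_n_center[OF Cc]] by (simp add: q_def True)
    then show ?thesis using ord_commut[of x y'] x y' Cc True by metis
  next
    case False
    have e1: "eps g h = 1" if "g \<in> C" "h \<in> C" for g h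
    proof -
      have "(2::nat) ^ (r - 1) = 2 ^ s * 2 ^ (r - 1 - s)"
        using False s by (simp flip: power_add)
      then have "commut G g h [^] (2 ^ (r - 1) :: nat) = \<one>"
        using exp[OF that] that Cc by (simp flip: nat_pow_pow)
      then show ?thesis by (simp add: eps_def)
    qed
    \<comment> \<open>The power \<open>?u\<close> is central and killed by
      \<open>2 ^ (r - s)\<close>. In the cyclic centre of order \<open>2 ^ r\<close> such an element
      is the \<open>2 ^ s\<close>-th power of some \<open>v\<close>, by which \<open>g\<close> is
      divided.\<close>
    have adj: "\<exists>v\<in>center G. (inv v \<otimes> g) [^] (2 ^ s :: nat) = \<one>" if g: "g \<in> C" for g
    proof -
      let ?u = "g [^] (2 ^ s :: nat)"
      have "q g = 1" using g e1 by (intro q_rad[OF S_neq] rad) auto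
      then have "g [^] (2 ^ r :: nat) = \<one>" using lam_eq_1_iff[OF pow_n_center[OF Cc[OF g]]] by (simp add: q_def)
      moreover have "(2::nat) ^ r = 2 ^ s * 2 ^ (r - s)" using s by (simp flip: power_add)
      ultimately have un: "?u [^] (2 ^ (r - s) :: nat) = \<one>" using Cc[OF g] by (simp add: nat_pow_pow)
      have uc: "?u \<in> center G"
      proof (rule centerI)
        fix k assume "k \<in> carrier G"
        then obtain c h where "c \<in> C" "h \<in> H" "k = c \<otimes> h" using gen by blast
        then show "commut G ?u k = \<one>"
          using g Cc Hc CH exp by (simp add: commut_pow_left commut_mult_right)
      qed (use g Cc in simp)
      obtain i :: nat where i: "?u = z0 [^] i"
        using center_cyclic[OF z0 uc center_exp[OF uc]] by blast
      have z0c: "z0 \<in> carrier G" using z0 center_sub by metis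
      have "z0 [^] (i * 2 ^ (r - s)) = \<one>" using un z0c unfolding i by (simp add: nat_pow_pow)
      then have "2 ^ r dvd i * 2 ^ (r - s)" using pow_eq_id[OF z0c] z0 by simp
      moreover have "(2::nat) ^ r = 2 ^ s * 2 ^ (r - s)" using s by (simp flip: power_add)
      ultimately have "2 ^ s dvd i" by simp
      then obtain j where j: "i = j * 2 ^ s" by (auto simp: dvd_def mult.commute)
      define v where "v = z0 [^] j"
      have v: "v \<in> center G" using z0 by (simp add: v_def center_pow)
      have vp: "v [^] (2 ^ s :: nat) = ?u" using z0c by (simp add: v_def i j nat_pow_pow)
      have "(inv v \<otimes> g) [^] (2 ^ s :: nat) = inv v [^] (2 ^ s :: nat) \<otimes> ?u"
        using center_pow_mult[OF center_inv[OF v]] Cc[OF g] by blast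
      also have "\<dots> = inv ?u \<otimes> ?u" using vp center_sub[OF v] by (simp add: nat_pow_inv)
      also have "\<dots> = \<one>" using Cc[OF g] by simp
      finally show ?thesis using v by blast
    qed
    obtain v w where v: "v \<in> center G" "(inv v \<otimes> g0) [^] (2 ^ s :: nat) = \<one>"
      and w: "w \<in> center G" "(inv w \<otimes> h0) [^] (2 ^ s :: nat) = \<one>"
      using adj ne by metis
    have c: "commut G (inv v \<otimes> g0) (inv w \<otimes> h0) = commut G g0 h0"
      using center_inv[OF v(1)] center_inv[OF w(1)] center_sub[OF w(1)] Cc[OF ne(1)] Cc[OF ne(2)]
      by (simp add: commut_central_left)
    have "ord (commut G g0 h0) = 2 ^ s"
      using exp ne s Cc by (intro ord_eq_two_pow) auto
    moreover have "inv v \<otimes> g0 \<in> C" "inv w \<otimes> h0 \<in> C"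
      using v w ne cC C center_inv by (auto intro!: subgroup.m_closed)
    ultimately show ?thesis using c v w by metis
  qed
qed

text \<open>The pair that was found spans a copy of \<open>D\<close>, which is merged with
  \<open>H\<close>, while \<open>C\<close> shrinks to the complement of the plane. The plane has a
  positive sum, so the complement inherits positivity.\<close>

lemma partial_decomp_step:
  assumes pd: "partial_decomp C H ss" and nc: "\<not> C \<subseteq> center G"
  shows "\<exists>C' H' s. partial_decomp C' H' (s # ss) \<and> card C' < card C"
proof -
  have C: "subgroup C G" and H: "subgroup H G" and cC: "center G \<subseteq> C" and cH: "center G \<subseteq> H"
    and CH: "\<And>c h. c \<in> C \<Longrightarrow> h \<in> H \<Longrightarrow> commut G c h = \<one>"
    and gen: "\<And>g. g \<in> carrier G \<Longrightarrow> \<exists>c\<in>C. \<exists>h\<in>H. g = c \<otimes> h"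
    and DQ: "DQ_product ss r (G\<lparr>carrier := H\<rparr>)" and so: "sorted ss" and bd: "\<forall>s\<in>set ss. 1 \<le> s \<and> s \<le> r"
    and ex: "\<forall>s\<in>set ss. \<forall>g\<in>C. \<forall>h\<in>C. commut G g h [^] (2 ^ s :: nat) = \<one>"
    using pd unfolding partial_decomp_def by auto
  obtain p where p: "p > 0" "(\<Sum>g\<in>C. q g) = complex_of_real p"
    using pd unfolding partial_decomp_def by auto
  have Cc: "c \<in> carrier G" if "c \<in> C" for c using C that subgroup.mem_carrier by metis
  have Hc: "h \<in> carrier G" if "h \<in> H" for h using H that subgroup.mem_carrier by metis
  have finC: "finite C" using fin Cc by (auto intro: finite_subset)
  let ?E = "\<lambda>s::nat. \<forall>g\<in>C. \<forall>h\<in>C. commut G g h [^] (2 ^ s :: nat) = \<one>"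
  \<comment> \<open>\<open>2 ^ s\<close> is the maximal order of a commutator in \<open>C\<close>.
    Maximality makes every commutator in \<open>C\<close> a power of \<open>z\<close>, as splitting
    off the plane requires, and it keeps the list sorted, since the exponents already in
    \<open>ss\<close> also bound the commutators of \<open>C\<close>.\<close>
  define s where "s = (LEAST s. ?E s)"
  have Er: "?E r" using Cc by (simp add: center_exp commut_center)
  have Es: "?E s" unfolding s_def by (rule LeastI[of ?E, OF Er])
  have sr: "s \<le> r" unfolding s_def by (rule Least_le[of ?E, OF Er])
  have s_ss: "s \<le> s'" if "s' \<in> set ss" for s' unfolding s_def by (rule Least_le) (use ex that in blast)
  have "s \<noteq> 0"
  proof
    assume "s = 0"
    then have ab: "commut G g h = \<one>" if "g \<in> C" "h \<in> C" for g h using Es that Cc by force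
    have "C \<subseteq> center G"
    proof
      fix c assume c: "c \<in> C"
      show "c \<in> center G"
      proof (rule centerI)
        fix k assume "k \<in> carrier G"
        then obtain d h where "d \<in> C" "h \<in> H" "k = d \<otimes> h" using gen by blast
        then show "commut G c k = \<one>" using c Cc Hc CH ab by (simp add: commut_mult_right)
      qed (use c Cc in simp)
    qed
    then show False using nc by simp
  qed
  then have s1: "1 \<le> s" by simp
  have "\<not> ?E (s - 1)" unfolding s_def by (rule not_less_Least) (use s1 in \<open>simp add: s_def\<close>)
  then obtain g0 h0 where gh0: "g0 \<in> C" "h0 \<in> C" "commut G g0 h0 [^] (2 ^ (s - 1) :: nat) \<noteq> \<one>" by blast
  obtain x y where x: "x \<in> C" "x [^] (2 ^ s :: nat) = \<one>" and y: "y \<in> C" "y [^] (2 ^ s :: nat) = \<one>"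
    and o: "ord (commut G x y) = 2 ^ s"
    using find_D_pair[OF C H cC CH gen p s1 sr _ gh0] Es by blast
  define z where "z = commut G x y"
  have xc: "x \<in> carrier G" and yc: "y \<in> carrier G" using x y Cc by auto
  have zcen: "z \<in> center G" by (simp add: z_def commut_center xc yc)
  have zc: "z \<in> carrier G" using zcen by (rule center_sub)
  have zs: "z [^] (2 ^ s :: nat) = \<one>" using pow_ord_eq_1[OF zc] o by (simp add: z_def)
  have "DQ_relations G False s x y z"
    unfolding DQ_relations_def using x y xc yc zc zs zcen by (simp add: z_def commut_central)
  then obtain \<psi> where \<psi>: "\<psi> \<in> hom (DQ_group False s) G" "\<psi> (DQ_gen False s Gen_x) = x"
    "\<psi> (DQ_gen False s Gen_y) = y" "\<psi> (DQ_gen False s Gen_z1) = z"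
    using DQ_universal by blast
  interpret T: class2_group "DQ_group False s" by (rule DQ_class2[OF s1])
  interpret \<psi>: group_hom "DQ_group False s" G \<psi> by unfold_locales (rule \<psi>(1))
  have inj: "inj_on \<psi> (carrier (DQ_group False s))"
    by (rule DQ_hom_inj[OF s1 is_group \<psi>(1)]) (simp add: \<psi>(4) z_def o)
  have nf: "\<exists>(a::nat) (b::nat) (c::nat). \<psi> t = x [^] a \<otimes> y [^] b \<otimes> z [^] c" if t: "t \<in> carrier (DQ_group False s)" for t
  proof -
    obtain a b c :: nat where "t = DQ_gen False s Gen_x [^]\<^bsub>DQ_group False s\<^esub> a \<otimes>\<^bsub>DQ_group False s\<^esub>
       DQ_gen False s Gen_y [^]\<^bsub>DQ_group False s\<^esub> b \<otimes>\<^bsub>DQ_group False s\<^esub> DQ_gen False s Gen_z1 [^]\<^bsub>DQ_group False s\<^esub> c"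
      using DQ_nf_bounded[OF s1 t] by blast
    then have "\<psi> t = x [^] a \<otimes> y [^] b \<otimes> z [^] c" by (simp add: \<psi>.hom_nat_pow \<psi>)
    then show ?thesis by blast
  qed
  have \<psi>com: "commut G (\<psi> t) g = \<one>" if t: "t \<in> carrier (DQ_group False s)"
    and g: "g \<in> carrier G" "commut G x g = \<one>" "commut G y g = \<one>" for t g
  proof -
    obtain a b c :: nat where abc: "\<psi> t = x [^] a \<otimes> y [^] b \<otimes> z [^] c" using nf[OF t] by blast
    show ?thesis unfolding abc using g xc yc zc zcen
      by (simp add: commut_mult_left commut_pow_left commut_central)
  qed
  define C' where "C' = plane_perp C x y"
  define H' where "H' = (\<lambda>(t, h). \<psi> t \<otimes> h) ` (carrier (DQ_group False s) \<times> H)"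
  have tH: "\<psi> t \<otimes> h = h \<otimes> \<psi> t" if "t \<in> carrier (DQ_group False s)" "h \<in> H" for t h
    using \<psi>com[OF that(1), of h] that CH x y Hc by (simp add: commut_one_iff)
  have cenH: "\<psi> u \<in> H" if u: "u \<in> center (DQ_group False s)" for u
  proof -
    obtain k :: nat where k: "u = DQ_gen False s Gen_z1 [^]\<^bsub>DQ_group False s\<^esub> k"
      using u unfolding DQ_center[OF s1] by blast
    show ?thesis using cH center_pow[OF zcen, of k] by (auto simp: k \<psi>.hom_nat_pow \<psi>)
  qed
  note cp = central_product_internal[OF T.is_group H \<psi>(1) inj tH cenH, folded H'_def]
  have DQ': "DQ_product (s # ss) r (G\<lparr>carrier := H'\<rparr>)"
    using cp(2) DQ by (auto simp: D_group_eq)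
  have Cz: "\<exists>i::nat. commut G c d = z [^] i" if "c \<in> C" "d \<in> C" for c d
    by (rule center_cyclic[OF zcen]) (use that Es Cc o in \<open>auto simp: z_def commut_center\<close>)
  have Cy: "\<exists>i::nat. commut G c y = z [^] i" if "c \<in> C" for c using Cz[OF that y(1)] .
  have Cx: "\<exists>i::nat. commut G c x = z [^] i" if "c \<in> C" for c using Cz[OF that x(1)] .
  note pl = C x(1) y(1) z_def o[folded z_def, symmetric] Cy Cx
  have sub': "subgroup C' G" unfolding C'_def by (rule subgroup_plane_perp[OF pl])
  have C'C: "C' \<subseteq> C" by (auto simp: C'_def plane_perp_def)
  have C'c: "c \<in> carrier G" "commut G x c = \<one>" "commut G y c = \<one>" if "c \<in> C'" for c
    using that Cc xc yc commut_inv[of c x] commut_inv[of c y] by (auto simp: C'_def plane_perp_def)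
  have split: "(\<Sum>g\<in>C. q g) = (\<Sum>a<(2::nat)^s. \<Sum>b<(2::nat)^s. q (x [^] a \<otimes> y [^] b)) * (\<Sum>g\<in>C'. q g)"
    unfolding C'_def by (rule plane_split_sum[OF pl])
  have qxy: "q u = 1" if "u \<in> carrier G" "u [^] (2 ^ s :: nat) = \<one>" for u
  proof -
    have "(2::nat) ^ r = 2 ^ s * 2 ^ (r - s)" using sr by (simp flip: power_add)
    then have "u [^] (2 ^ r :: nat) = \<one>" using that by (simp flip: nat_pow_pow)
    then show ?thesis by (simp add: q_def)
  qed
  obtain p' where p': "p' > 0" "(\<Sum>a<(2::nat)^s. \<Sum>b<(2::nat)^s. q (x [^] a \<otimes> y [^] b)) = complex_of_real p'"
    using plane_sum_pos[OF xc yc qxy[OF xc x(2)] qxy[OF yc y(2)], of "2 ^ s"] s1 by auto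
  have pos': "(\<Sum>g\<in>C'. q g) = complex_of_real (p / p')"
    using split p p' by (simp add: field_simps)
  have "x \<notin> C'"
  proof
    assume "x \<in> C'"
    then have "z = \<one>" by (simp add: C'_def plane_perp_def z_def)
    then have "ord z = 1" by simp
    then show False using o s1 unfolding z_def[symmetric] by simp
  qed
  then have card: "card C' < card C" using C'C x finC by (intro psubset_card_mono) auto
  have "partial_decomp C' H' (s # ss)"
    unfolding partial_decomp_def
  proof (intro conjI)
    show "subgroup C' G" by (rule sub')
    show "subgroup H' G" by (rule cp(1))
    show "center G \<subseteq> C'" using cC xc yc by (auto simp: C'_def plane_perp_def commut_central)
    show "center G \<subseteq> H'"
    proof
      fix u assume u: "u \<in> center G"
      have "u = \<psi> \<one>\<^bsub>DQ_group False s\<^esub> \<otimes> u" using center_sub[OF u] by simp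
      then show "u \<in> H'" unfolding H'_def using cH u by (intro image_eqI[of _ _ "(\<one>\<^bsub>DQ_group False s\<^esub>, u)"]) auto
    qed
    show "\<forall>c\<in>C'. \<forall>h\<in>H'. commut G c h = \<one>"
    proof (intro ballI)
      fix c k assume c: "c \<in> C'" and "k \<in> H'"
      then obtain t h where th: "t \<in> carrier (DQ_group False s)" "h \<in> H" "k = \<psi> t \<otimes> h" by (auto simp: H'_def)
      have "commut G c (\<psi> t) = inv (commut G (\<psi> t) c)" using c C'c th by (intro commut_inv) auto
      also have "commut G (\<psi> t) c = \<one>" using \<psi>com[OF th(1)] C'c[OF c] by simp
      finally show "commut G c k = \<one>" using th c C'C CH C'c Hc by (auto simp: commut_mult_right)
    qed
    show "\<forall>g\<in>carrier G. \<exists>c\<in>C'. \<exists>h\<in>H'. g = c \<otimes> h"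
    proof
      fix g assume "g \<in> carrier G"
      then obtain c h where ch: "c \<in> C" "h \<in> H" "g = c \<otimes> h" using gen by blast
      have "c \<in> (\<lambda>((a, b), c). x [^] a \<otimes> y [^] b \<otimes> c) ` (({..<(2::nat)^s} \<times> {..<(2::nat)^s}) \<times> C')"
        using plane_bij[OF pl] ch(1) unfolding C'_def bij_betw_def by simp
      then obtain a b :: nat and c' where c': "c' \<in> C'" "c = x [^] a \<otimes> y [^] b \<otimes> c'" by auto
      let ?t = "DQ_gen False s Gen_x [^]\<^bsub>DQ_group False s\<^esub> a \<otimes>\<^bsub>DQ_group False s\<^esub> DQ_gen False s Gen_y [^]\<^bsub>DQ_group False s\<^esub> b"
      have t: "?t \<in> carrier (DQ_group False s)" by simp
      have \<psi>t: "\<psi> ?t = x [^] a \<otimes> y [^] b" by (simp add: \<psi>.hom_nat_pow \<psi>)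
      have "\<psi> ?t \<otimes> c' = c' \<otimes> \<psi> ?t"
        using \<psi>com[OF t C'c[OF c'(1)]] C'c(1)[OF c'(1)] t by (simp add: commut_one_iff)
      then have "g = c' \<otimes> (\<psi> ?t \<otimes> h)"
        using ch c' C'c(1)[OF c'(1)] Hc[OF ch(2)] xc yc by (simp add: \<psi>t flip: m_assoc)
      moreover have "\<psi> ?t \<otimes> h \<in> H'" unfolding H'_def using t ch(2)
        by (intro image_eqI[of _ _ "(?t, h)"]) auto
      ultimately show "\<exists>c\<in>C'. \<exists>h\<in>H'. g = c \<otimes> h" using c'(1) by blast
    qed
    show "DQ_product (s # ss) r (G\<lparr>carrier := H'\<rparr>)" by (rule DQ')
    show "sorted (s # ss)" using so s_ss by simp
    show "\<forall>s\<in>set (s # ss). 1 \<le> s \<and> s \<le> r" using bd s1 sr by simp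
    show "\<forall>s\<in>set (s # ss). \<forall>g\<in>C'. \<forall>h\<in>C'. commut G g h [^] (2 ^ s :: nat) = \<one>"
    proof (intro ballI)
      fix s' g h assume s': "s' \<in> set (s # ss)" and gh: "g \<in> C'" "h \<in> C'"
      have "?E s'" using s' ex Es by (cases "s' = s") auto
      then show "commut G g h [^] (2 ^ s' :: nat) = \<one>" using subsetD[OF C'C] gh by simp
    qed
    show "\<exists>p>0. (\<Sum>g\<in>C'. q g) = complex_of_real p"
      using pos' p p' by (intro exI[of _ "p / p'"]) simp
  qed
  then show ?thesis using card by blast
qed

text \<open>Induction on the size of \<open>C\<close>. Once \<open>C\<close> is central it is
  contained in \<open>H\<close>, which is then the whole group.\<close>

lemma partial_decomp_finish:
  assumes "partial_decomp C H ss"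
  shows "\<exists>ss. sorted ss \<and> (\<forall>s\<in>set ss. 1 \<le> s \<and> s \<le> r) \<and> DQ_product ss r G"
  using assms
proof (induction "card C" arbitrary: C H ss rule: less_induct)
  case less
  show ?case
  proof (cases "C \<subseteq> center G")
    case False
    then show ?thesis using partial_decomp_step[OF less.prems] less.hyps by blast
  next
    case True
    have H: "subgroup H G" and cH: "center G \<subseteq> H"
      and gen: "\<And>g. g \<in> carrier G \<Longrightarrow> \<exists>c\<in>C. \<exists>h\<in>H. g = c \<otimes> h"
      using less.prems unfolding partial_decomp_def by auto
    have "carrier G = H"
    proof (intro equalityI subsetI)
      fix g assume "g \<in> carrier G"
      then obtain c h where ch: "c \<in> C" "h \<in> H" "g = c \<otimes> h" using gen by blast
      then show "g \<in> H" using True cH H by (auto intro!: subgroup.m_closed)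
    qed (use H subgroup.mem_carrier in metis)
    then have "G\<lparr>carrier := H\<rparr> = G" by simp
    then show ?thesis using less.prems unfolding partial_decomp_def by (intro exI[of _ ss]) auto
  qed
qed

end

text \<open>The first plane has to take up the sign: it is spanned by a pair on which
  \<open>q\<close> and \<open>eps\<close> are -1, generates a copy of \<open>Q\<close>, and leaves a
  complement with positive sum.\<close>

lemma DQ_product_exists:
  fixes P :: "nat monoid"
  assumes f: "faithful_group P lam" and r: "r \<ge> 1"
    and neg: "gauss_sum P (center P) lam (2 ^ r) = - complex_of_real p" "p > 0"
  shows "\<exists>ss. sorted ss \<and> (\<forall>s\<in>set ss. 1 \<le> s \<and> s \<le> r) \<and> DQ_product ss r P"
proof -
  interpret f: faithful_group P lam by (rule f)
  interpret gauss_group P lam r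
    by unfold_locales (use r neg f.center_exp_if_gauss_sum[of "2 ^ r"] in auto)
  have S: "(\<Sum>g\<in>carrier P. q g) = - complex_of_real p" using neg by (simp add: gauss_sum_eq)
  obtain x y where x: "x \<in> carrier P" "q x = -1" and y: "y \<in> carrier P" "q y = -1" and e: "eps x y = -1"
    using Q_pair_exists[OF S neg(2)] by blast
  define z where "z = commut P x y"
  have zcen: "z \<in> center P" and o: "f.ord z = 2 ^ r"
    using x y e f.commut_center ord_commut by (auto simp: z_def)
  interpret nat_gauss_group P lam r z
    by unfold_locales (use zcen o S neg in auto)
  have zc: "z \<in> carrier P" using zcen by (rule center_sub)
  \<comment> \<open>\<open>q u\<close> and \<open>eps x y\<close> are both -1, so two central
    elements have the same value under the injective \<open>lam\<close>. Their equality is the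
    defining relation of \<open>Q\<close>.\<close>
  have pw: "u [^]\<^bsub>P\<^esub> (2 ^ r :: nat) = z [^]\<^bsub>P\<^esub> (2 ^ (r - 1) :: nat)" if "u \<in> carrier P" "q u = -1" for u
  proof -
    have "lam (u [^]\<^bsub>P\<^esub> (2 ^ r :: nat)) = lam (z [^]\<^bsub>P\<^esub> (2 ^ (r - 1) :: nat))"
      using that e by (simp add: q_def eps_def z_def)
    then show ?thesis using f.lam_inj pow_n_center[OF that(1)] f.center_pow[OF zcen] by (auto dest: inj_onD)
  qed
  have "DQ_relations P True r x y z"
    unfolding DQ_relations_def using x y zc zcen pw center_exp[OF zcen] by (simp add: z_def f.commut_central)
  then obtain \<psi> where \<psi>: "\<psi> \<in> hom (DQ_group True r) P" "\<psi> (DQ_gen True r Gen_x) = x"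
    "\<psi> (DQ_gen True r Gen_y) = y" "\<psi> (DQ_gen True r Gen_z1) = z"
    using f.DQ_universal by blast
  interpret T: class2_group "DQ_group True r" by (rule DQ_class2[OF r])
  interpret \<psi>: group_hom "DQ_group True r" P \<psi> by unfold_locales (rule \<psi>(1))
  have inj: "inj_on \<psi> (carrier (DQ_group True r))"
    by (rule DQ_hom_inj[OF r f.is_group \<psi>(1)]) (simp add: \<psi>(4) o)
  define H where "H = \<psi> ` carrier (DQ_group True r)"
  note H = f.iso_image_subgroup[OF T.is_group \<psi>(1) inj, folded H_def]
  define C where "C = plane_perp (carrier P) x y"
  have cyc: "\<exists>i::nat. u = z [^]\<^bsub>P\<^esub> i" if "u \<in> center P" for u
    by (rule center_cyclic[OF zcen o that center_exp[OF that]])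
  have cx: "\<exists>i::nat. commut P c x = z [^]\<^bsub>P\<^esub> i" if "c \<in> carrier P" for c
    using cyc f.commut_center[OF that x(1)] by blast
  have cy: "\<exists>i::nat. commut P c y = z [^]\<^bsub>P\<^esub> i" if "c \<in> carrier P" for c
    using cyc f.commut_center[OF that y(1)] by blast
  note pl = f.subgroup_self x(1) y(1) z_def o[symmetric] cy cx
  have pos: "\<exists>p'>0. (\<Sum>g\<in>C. q g) = complex_of_real p'"
  proof -
    obtain p1 where p1: "p1 > 0" "(\<Sum>a<(2::nat)^r. \<Sum>b<(2::nat)^r. q (x [^]\<^bsub>P\<^esub> a \<otimes>\<^bsub>P\<^esub> y [^]\<^bsub>P\<^esub> b)) = - complex_of_real p1"
      using plane_sum_neg[OF x(1) y(1) x(2) y(2) e, of "2 ^ r"] r by auto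
    have "- complex_of_real p = - complex_of_real p1 * (\<Sum>g\<in>C. q g)"
      using plane_split_sum[OF pl] S p1(2) by (simp add: C_def)
    then have "(\<Sum>g\<in>C. q g) = complex_of_real (p / p1)" using p1(1) by (simp add: field_simps)
    then show ?thesis using neg(2) p1(1) by (intro exI[of _ "p / p1"]) simp
  qed
  have Cc: "c \<in> carrier P" "commut P x c = \<one>\<^bsub>P\<^esub>" "commut P y c = \<one>\<^bsub>P\<^esub>" if "c \<in> C" for c
    using that x(1) y(1) f.commut_inv[of c x] f.commut_inv[of c y] by (auto simp: C_def plane_perp_def)
  have cH: "center P \<subseteq> H"
  proof
    fix u assume "u \<in> center P"
    then obtain i :: nat where "u = z [^]\<^bsub>P\<^esub> i" using cyc by blast
    then have "u = \<psi> (DQ_gen True r Gen_z1 [^]\<^bsub>DQ_group True r\<^esub> i)" by (simp add: \<psi>.hom_nat_pow \<psi>)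
    then show "u \<in> H" by (simp add: H_def)
  qed
  have \<psi>com: "commut P c (\<psi> t) = \<one>\<^bsub>P\<^esub>" if c: "c \<in> C" and t: "t \<in> carrier (DQ_group True r)" for c t
  proof -
    obtain i j k :: nat where "t = DQ_gen True r Gen_x [^]\<^bsub>DQ_group True r\<^esub> i \<otimes>\<^bsub>DQ_group True r\<^esub>
       DQ_gen True r Gen_y [^]\<^bsub>DQ_group True r\<^esub> j \<otimes>\<^bsub>DQ_group True r\<^esub> DQ_gen True r Gen_z1 [^]\<^bsub>DQ_group True r\<^esub> k"
      using DQ_nf_bounded[OF r t] by blast
    then have "\<psi> t = x [^]\<^bsub>P\<^esub> i \<otimes>\<^bsub>P\<^esub> y [^]\<^bsub>P\<^esub> j \<otimes>\<^bsub>P\<^esub> z [^]\<^bsub>P\<^esub> k" by (simp add: \<psi>.hom_nat_pow \<psi>)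
    moreover have "commut P c x = \<one>\<^bsub>P\<^esub>" "commut P c y = \<one>\<^bsub>P\<^esub>" using c by (auto simp: C_def plane_perp_def)
    ultimately show ?thesis using Cc(1)[OF c] x(1) y(1) zc zcen
      by (simp add: f.commut_mult_right f.commut_pow_right f.commut_central)
  qed
  have gen: "\<exists>c\<in>C. \<exists>h\<in>H. g = c \<otimes>\<^bsub>P\<^esub> h" if g: "g \<in> carrier P" for g
  proof -
    have "g \<in> (\<lambda>((a, b), c). x [^]\<^bsub>P\<^esub> a \<otimes>\<^bsub>P\<^esub> y [^]\<^bsub>P\<^esub> b \<otimes>\<^bsub>P\<^esub> c) ` (({..<(2::nat)^r} \<times> {..<(2::nat)^r}) \<times> C)"
      using plane_bij[OF pl] g unfolding C_def bij_betw_def by simp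
    then obtain a b :: nat and c where c: "c \<in> C" "g = x [^]\<^bsub>P\<^esub> a \<otimes>\<^bsub>P\<^esub> y [^]\<^bsub>P\<^esub> b \<otimes>\<^bsub>P\<^esub> c" by auto
    let ?t = "DQ_gen True r Gen_x [^]\<^bsub>DQ_group True r\<^esub> a \<otimes>\<^bsub>DQ_group True r\<^esub> DQ_gen True r Gen_y [^]\<^bsub>DQ_group True r\<^esub> b"
    have t: "?t \<in> carrier (DQ_group True r)" by simp
    have "\<psi> ?t = x [^]\<^bsub>P\<^esub> a \<otimes>\<^bsub>P\<^esub> y [^]\<^bsub>P\<^esub> b" by (simp add: \<psi>.hom_nat_pow \<psi>)
    moreover have "c \<otimes>\<^bsub>P\<^esub> \<psi> ?t = \<psi> ?t \<otimes>\<^bsub>P\<^esub> c"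
      using \<psi>com[OF c(1) t] f.commut_one_iff[OF Cc(1)[OF c(1)] \<psi>.hom_closed[OF t]] by blast
    ultimately have "g = c \<otimes>\<^bsub>P\<^esub> \<psi> ?t" using c(2) by simp
    then show ?thesis using c(1) t unfolding H_def by blast
  qed
  have "partial_decomp C H []"
    unfolding partial_decomp_def
  proof (intro conjI)
    show "subgroup C P" unfolding C_def by (rule subgroup_plane_perp[OF pl])
    show "subgroup H P" by (rule H(1))
    show "center P \<subseteq> C"
      using x(1) y(1) by (auto simp: C_def plane_perp_def f.commut_central intro: center_sub)
    show "\<forall>c\<in>C. \<forall>h\<in>H. commut P c h = \<one>\<^bsub>P\<^esub>" using \<psi>com by (auto simp: H_def)
    show "DQ_product [] r (P\<lparr>carrier := H\<rparr>)"
      using H f.subgroup_imp_group[OF H(1)] by (simp add: Q_group_eq)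
  qed (use pos cH gen in simp_all)
  then show ?thesis by (rule partial_decomp_finish)
qed

section \<open>Multiplicities\<close>

text \<open>As \<open>q\<close> takes the values 1 and -1,
  \<open>q g * q (g \<otimes> k) = q k * eps g k\<close>. Summed over \<open>g\<close> this vanishes
  unless \<open>k\<close> lies in \<open>rad\<close>, where \<open>q k = 1\<close>.\<close>

lemma (in gauss_group) gauss_sum_square:
  assumes S: "(\<Sum>g\<in>carrier G. q g) \<noteq> 0"
  shows "(\<Sum>g\<in>carrier G. q g) ^ 2 = of_nat (card rad) * of_nat (card (carrier G))"
proof -
  let ?S = "\<Sum>g\<in>carrier G. q g"
  have e: "(\<Sum>g\<in>carrier G. eps g k) = (if k \<in> rad then of_nat (card (carrier G)) else 0)" if k: "k \<in> carrier G" for k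
  proof (cases "k \<in> rad")
    case True
    then have "eps g k = 1" if "g \<in> carrier G" for g
      using that eps_sym[OF that k] by (simp add: rad_def)
    then show ?thesis using True by simp
  next
    case False
    then obtain x where x: "x \<in> carrier G" "eps k x \<noteq> 1" using k by (auto simp: rad_def)
    then have exk: "eps x k \<noteq> 1" using eps_sym k by simp
    have "(\<Sum>g\<in>carrier G. eps g k) = (\<Sum>g\<in>carrier G. eps (x \<otimes> g) k)"
      by (rule translate_sum[OF subgroup_self x(1), symmetric])
    also have "\<dots> = eps x k * (\<Sum>g\<in>carrier G. eps g k)"
      using x k by (simp add: eps_mult_left sum_distrib_left)
    finally show ?thesis using exk False by simp
  qed
  have qq: "q g * q (g \<otimes> k) = q k * eps g k" if "g \<in> carrier G" "k \<in> carrier G" for g k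
    using q_cases[OF S that(1)] that by (auto simp: q_mult)
  have "?S ^ 2 = (\<Sum>g\<in>carrier G. q g * ?S)"
    by (simp add: power2_eq_square sum_distrib_right)
  also have "\<dots> = (\<Sum>g\<in>carrier G. \<Sum>k\<in>carrier G. q g * q (g \<otimes> k))"
  proof (rule sum.cong)
    fix g assume "g \<in> carrier G"
    then have "?S = (\<Sum>k\<in>carrier G. q (g \<otimes> k))"
      by (intro translate_sum[OF subgroup_self, symmetric])
    then show "q g * ?S = (\<Sum>k\<in>carrier G. q g * q (g \<otimes> k))" by (simp add: sum_distrib_left)
  qed simp
  also have "\<dots> = (\<Sum>g\<in>carrier G. \<Sum>k\<in>carrier G. q k * eps g k)"
    by (intro sum.cong) (auto simp: qq)
  also have "\<dots> = (\<Sum>k\<in>carrier G. q k * (\<Sum>g\<in>carrier G. eps g k))"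
    by (subst sum.swap) (simp add: sum_distrib_left)
  also have "\<dots> = (\<Sum>k\<in>carrier G. if k \<in> rad then of_nat (card (carrier G)) else 0)"
    by (intro sum.cong) (auto simp: e q_rad[OF S])
  also have "\<dots> = (\<Sum>k\<in>rad. of_nat (card (carrier G)))"
    by (subst sum.inter_filter[symmetric]) (use fin in \<open>auto simp: rad_def intro!: sum.cong\<close>)
  finally show ?thesis by simp
qed

lemma (in gauss_group) card_center_dvd_rad: "card (center G) dvd card rad"
proof -
  have rad: "subgroup rad G"
  proof (rule subgroupI)
    fix a assume a: "a \<in> rad"
    have "eps (inv a) g = 1" if g: "g \<in> carrier G" for g
      using a g eps_mult_left[of g a "inv a"] by (auto simp: rad_def)
    then show "inv a \<in> rad" using a by (simp add: rad_def)
  qed (auto simp: rad_def eps_mult_left intro!: exI[of _ \<one>])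
  have "center G \<subseteq> rad"
    by (auto simp: rad_def center_sub eps_def commut_central)
  then have "subgroup (center G) (G\<lparr>carrier := rad\<rparr>)"
    using subgroup_center rad by (intro subgroup_incl) auto
  then have "card (rcosets\<^bsub>G\<lparr>carrier := rad\<rparr>\<^esub> center G) * card (center G) = card rad"
    using group.lagrange[OF subgroup_imp_group[OF rad]] by (simp add: Coset.order_def)
  then show ?thesis by (metis dvd_triv_right)
qed

text \<open>The second alternative carries the integrality information: for a non-zero sum
  \<open>m\<close> is the index of the centre in \<open>rad\<close> and will be the square of the
  multiplicity. A vanishing sum is covered by \<open>k = 0\<close>.\<close>

lemma (in faithful_group) gauss_sum_dichotomy:
  assumes r: "r \<ge> 1"
  shows "(\<exists>p>0. gauss_sum G (center G) lam (2 ^ r) = - complex_of_real p) \<or>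
    (\<exists>(k::nat) (m::nat). gauss_sum G (center G) lam (2 ^ r) = of_nat k \<and>
        k ^ 2 = m * card (center G) * card (carrier G))"
proof (cases "gauss_sum G (center G) lam (2 ^ r) = 0")
  case True
  then show ?thesis by (intro disjI2 exI[of _ 0]) simp
next
  case False
  interpret gauss_group G lam r
    by unfold_locales (use r center_exp_if_gauss_sum[OF False] in auto)
  have S: "(\<Sum>g\<in>carrier G. q g) \<noteq> 0" using False by (simp add: gauss_sum_eq)
  define t :: int where "t = (\<Sum>g\<in>carrier G. if q g = 1 then 1 else - 1)"
  have "(\<Sum>g\<in>carrier G. q g) = (\<Sum>g\<in>carrier G. of_int (if q g = 1 then 1 else - 1))"
    using q_cases[OF S] by (intro sum.cong) auto
  then have t: "(\<Sum>g\<in>carrier G. q g) = of_int t" by (simp add: t_def)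
  show ?thesis
  proof (cases "t < 0")
    case True
    then show ?thesis unfolding gauss_sum_eq t
      by (intro disjI1 exI[of _ "real_of_int (- t)"]) simp
  next
    case False
    define k where "k = nat t"
    have k: "(\<Sum>g\<in>carrier G. q g) = of_nat k" using False by (simp add: t k_def)
    obtain m where m: "card rad = card (center G) * m" using card_center_dvd_rad by blast
    have "complex_of_nat (k ^ 2) = of_nat (card rad * card (carrier G))"
      using gauss_sum_square[OF S] by (simp add: k)
    then have "k ^ 2 = card rad * card (carrier G)" by (simp only: of_nat_eq_iff)
    then show ?thesis unfolding gauss_sum_eq k using m
      by (intro disjI2 exI[of _ k] exI[of _ m]) simp
  qed
qed

text \<open>Both counts come from \<open>sum_over_epi\<close>, applied to the indicator function of
  the centre and to the constant 1.\<close>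

lemma (in radical_epi) card_R: "card R = card (kernel A P \<theta>) * card (center P)"
  and card_A: "card (carrier A) = card (kernel A P \<theta>) * card (carrier P)"
proof -
  have P: "finite (carrier P)" using finite_imageI[OF fin, of \<theta>] surj by simp
  have "(\<Sum>a\<in>carrier A. if \<theta> a \<in> center P then 1 else 0) =
      complex_of_nat (card (kernel A P \<theta>)) * (\<Sum>p\<in>carrier P. if p \<in> center P then 1 else 0)"
    by (rule sum_over_epi[OF fin surj])
  moreover have "(\<Sum>a\<in>carrier A. if \<theta> a \<in> center P then 1 else 0) = complex_of_nat (card R)"
  proof -
    have "(\<Sum>a\<in>carrier A. if \<theta> a \<in> center P then 1 else 0 :: complex) = (\<Sum>a\<in>carrier A. if a \<in> R then 1 else 0)"
      by (rule sum.cong) (auto simp: center_iff)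
    also have "\<dots> = (\<Sum>a\<in>R. 1)"
      by (subst sum.inter_filter[symmetric]) (use fin R_carrier in \<open>auto intro!: arg_cong[of _ _ card]\<close>)
    finally show ?thesis by simp
  qed
  moreover have "(\<Sum>p\<in>carrier P. if p \<in> center P then 1 else 0) = complex_of_nat (card (center P))"
  proof -
    have "(\<Sum>p\<in>carrier P. if p \<in> center P then 1 else 0 :: complex) = (\<Sum>p\<in>center P. 1)"
      by (subst sum.inter_filter[symmetric]) (use P center_sub in \<open>auto intro!: arg_cong[of _ _ card]\<close>)
    then show ?thesis by simp
  qed
  ultimately have "complex_of_nat (card R) = of_nat (card (kernel A P \<theta>) * card (center P))" by simp
  then show "card R = card (kernel A P \<theta>) * card (center P)" by (simp only: of_nat_eq_iff)
  have "(\<Sum>a\<in>carrier A. 1) = complex_of_nat (card (kernel A P \<theta>)) * (\<Sum>p\<in>carrier P. 1)"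
    by (rule sum_over_epi[OF fin surj])
  then have "complex_of_nat (card (carrier A)) = of_nat (card (kernel A P \<theta>) * card (carrier P))" by simp
  then show "card (carrier A) = card (kernel A P \<theta>) * card (carrier P)" by (simp only: of_nat_eq_iff)
qed

text \<open>The rational number \<open>d * k / card (carrier P)\<close> has the integer square
  \<open>m\<close>, hence is itself an integer \<open>j\<close>. This \<open>j\<close> is the
  multiplicity of the character \<open>d \<mu>\<close>.\<close>

lemma (in radical_epi) gauss_sum_multiplicity:
  assumes r: "r \<ge> 1" and d: "d ^ 2 * card R = card (carrier A)"
  shows "(\<exists>p>0. gauss_sum P (center P) push (2 ^ r) = - complex_of_real p) \<or>
    (\<exists>j :: nat. of_nat d * cnj (gauss_sum A R \<mu> (2 ^ r)) = of_nat (card (carrier A)) * of_nat j)"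
proof -
  interpret P: faithful_group P push by (rule faithful_push)
  let ?K = "card (kernel A P \<theta>)"
  show ?thesis
  proof (rule disjE[OF P.gauss_sum_dichotomy[OF r]])
    assume "\<exists>(k::nat) (m::nat). gauss_sum P (center P) push (2 ^ r) = of_nat k \<and>
        k ^ 2 = m * card (center P) * card (carrier P)"
    then obtain k m :: nat where k: "gauss_sum P (center P) push (2 ^ r) = of_nat k"
      and km: "k ^ 2 = m * card (center P) * card (carrier P)" by blast
    have dd: "d ^ 2 * card (center P) = card (carrier P)"
      using d card_kernel_pos unfolding card_R card_A by simp
    have "(d * k) ^ 2 = m * (d ^ 2 * card (center P)) * card (carrier P)"
      by (simp add: power_mult_distrib km)
    then have "(d * k) ^ 2 = m * card (carrier P) ^ 2"
      unfolding dd by (simp add: power2_eq_square)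
    then have "card (carrier P) ^ 2 dvd (d * k) ^ 2" by simp
    then have "card (carrier P) dvd d * k" by simp
    then obtain j where j: "d * k = card (carrier P) * j" by blast
    have "of_nat d * cnj (gauss_sum A R \<mu> (2 ^ r)) = complex_of_nat (?K * (d * k))"
      by (simp add: gauss_sum_push k)
    also have "?K * (d * k) = card (carrier A) * j" by (simp add: j card_A)
    finally show ?thesis by auto
  qed blast
qed

text \<open>Transport to the element type that \<open>DQ_product\<close> prescribes.\<close>

lemma group_to_nat:
  fixes Q :: "('q, 'm) monoid_scheme"
  assumes "group Q" "finite (carrier Q)"
  obtains P :: "nat monoid" and f where "group P" "f \<in> iso Q P"
proof -
  interpret Q: group Q by fact
  obtain f :: "'q \<Rightarrow> nat" where inj: "inj_on f (carrier Q)"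
    using finite_imp_inj_to_nat_seg[OF assms(2)] by blast
  define P :: "nat monoid" where "P = \<lparr>carrier = f ` carrier Q,
     monoid.mult = (\<lambda>a b. f (inv_into (carrier Q) f a \<otimes>\<^bsub>Q\<^esub> inv_into (carrier Q) f b)), one = f \<one>\<^bsub>Q\<^esub>\<rparr>"
  have "f \<in> iso Q P"
    using inj by (auto simp: iso_def hom_def bij_betw_def P_def)
  moreover from Q.iso_imp_img_group[OF this] have "group P" by (simp add: P_def)
  ultimately show thesis using that by blast
qed

lemma (in group) quotient_to_nat:
  assumes K: "K \<lhd> G" and fin: "finite (carrier G)"
  obtains P :: "nat monoid" and \<theta> where "group P" "\<theta> \<in> epi G P"
    "\<And>a. a \<in> carrier G \<Longrightarrow> \<theta> a = \<one>\<^bsub>P\<^esub> \<longleftrightarrow> a \<in> K"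
proof -
  interpret K: normal K G by (rule K)
  interpret Q: group "G Mod K" by (rule K.factorgroup_is_group)
  have "finite (carrier (G Mod K))" using fin by (simp add: carrier_FactGroup)
  then obtain P :: "nat monoid" and f where P: "group P" "f \<in> iso (G Mod K) P"
    using group_to_nat[OF Q.group_axioms] by blast
  interpret P: group P by (rule P(1))
  define \<theta> where "\<theta> a = f (K #> a)" for a
  have hom: "\<theta> \<in> hom G P"
    using Group.hom_compose[OF K.r_coset_hom_Mod, of f P] P(2) by (auto simp: \<theta>_def[abs_def] iso_def comp_def)
  have im: "\<theta> ` carrier G = carrier P"
  proof -
    have "f ` carrier (G Mod K) = carrier P" using P(2) by (auto simp: iso_def bij_betw_def)
    then show ?thesis by (simp add: carrier_FactGroup \<theta>_def image_image)
  qed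
  have "\<theta> a = \<one>\<^bsub>P\<^esub> \<longleftrightarrow> a \<in> K" if a: "a \<in> carrier G" for a
  proof -
    have c: "K #> a \<in> carrier (G Mod K)" using a by (auto simp: carrier_FactGroup)
    have "\<theta> a = \<one>\<^bsub>P\<^esub> \<longleftrightarrow> K #> a = \<one>\<^bsub>G Mod K\<^esub>"
      using P(2) c hom_one[of f "G Mod K" P] Q.group_axioms P(1)
      unfolding \<theta>_def by (auto simp: iso_iff_mon_epi mon_iff_hom_one)
    also have "\<dots> \<longleftrightarrow> K #> a = K" by (simp add: FactGroup_def)
    also have "\<dots> \<longleftrightarrow> a \<in> K" using coset_join1 coset_join2 a K.is_subgroup by metis
    finally show ?thesis .
  qed
  then show thesis by (intro that[OF P(1)]) (use hom im in \<open>auto simp: epi_def\<close>)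
qed

section \<open>Extending linear characters\<close>

text \<open>Extending by zero outside \<open>A\<close> makes these functions unique.\<close>

definition lin_ext :: "('a, 'b) monoid_scheme \<Rightarrow> 'a set \<Rightarrow> 'a set \<Rightarrow> ('a \<Rightarrow> complex) \<Rightarrow> ('a \<Rightarrow> complex) set" where
  "lin_ext G B A \<kappa> = {\<mu>. (\<forall>x. x \<notin> A \<longrightarrow> \<mu> x = 0) \<and>
     (\<forall>a\<in>A. \<forall>b\<in>A. \<mu> (a \<otimes>\<^bsub>G\<^esub> b) = \<mu> a * \<mu> b) \<and> (\<forall>b\<in>B. \<mu> b = \<kappa> b)}"

locale two_group = group G for G (structure) +
  assumes fin: "finite (carrier G)" and two_power: "\<exists>k::nat. Coset.order G = 2 ^ k"
begin

lemma mem_carrier: "subgroup A G \<Longrightarrow> a \<in> A \<Longrightarrow> a \<in> carrier G"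
  using subgroup.mem_carrier by metis

lemma finite_subgroup: "subgroup A G \<Longrightarrow> finite A"
  using fin subgroup.subset finite_subset by metis

lemma subgroup_pow:
  assumes "subgroup A G" "a \<in> A"
  shows "a [^] (k::nat) \<in> A"
  using assms by (induction k) (auto intro: subgroup.m_closed subgroup.one_closed)

text \<open>Among the iterated squares of \<open>g\<close> take the last one outside
  \<open>B\<close>. Adjoining it enlarges \<open>B\<close> by index two, so characters can be
  extended one quadratic step at a time.\<close>

lemma square_in_subgroup:
  assumes B: "subgroup B G" and g: "g \<in> carrier G" "g \<notin> B"
  shows "\<exists>j::nat. g [^] (2 ^ j :: nat) \<notin> B \<and> g [^] (2 ^ j :: nat) \<otimes> g [^] (2 ^ j :: nat) \<in> B"
proof -
  obtain k :: nat where k: "Coset.order G = 2 ^ k" using two_power by blast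
  let ?Q = "\<lambda>j. g [^] (2 ^ j :: nat) \<in> B"
  have Qk: "?Q k" using pow_order_eq_1[OF g(1)] k subgroup.one_closed[OF B] by simp
  define m where "m = (LEAST j. ?Q j)"
  have m: "?Q m" unfolding m_def by (rule LeastI[of ?Q, OF Qk])
  have "m \<noteq> 0" using m g by (cases "m = 0") auto
  then obtain j where j: "m = Suc j" by (cases m) auto
  have "\<not> ?Q j" using not_less_Least[of j ?Q] j by (simp add: m_def)
  moreover have "g [^] (2 ^ j :: nat) \<otimes> g [^] (2 ^ j :: nat) \<in> B"
    using m g by (simp add: j nat_pow_mult mult_2)
  ultimately show ?thesis by blast
qed

context
  fixes A B and \<kappa> :: "'a \<Rightarrow> complex"
  assumes A: "subgroup A G" and B: "subgroup B G" and BA: "B \<subseteq> A"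
    and com: "\<And>a b. a \<in> A \<Longrightarrow> b \<in> A \<Longrightarrow> commut G a b \<in> B"
begin

lemma swap_B:
  assumes "b \<in> B" "a \<in> A"
  shows "b \<otimes> a = a \<otimes> (b \<otimes> commut G b a)"
  using commut_swap[of b a] assms BA mem_carrier[OF A] by (auto simp: m_assoc subset_iff)

lemma double_mult:
  assumes a: "a \<in> A" and b: "b \<in> B" and b': "b' \<in> B"
  shows "b \<otimes> (a \<otimes> b') = a \<otimes> (b \<otimes> commut G b a \<otimes> b')"
    "a \<otimes> b \<otimes> (a \<otimes> b') = a \<otimes> a \<otimes> (b \<otimes> commut G b a \<otimes> b')"
proof -
  have c: "a \<in> carrier G" "b \<in> carrier G" "b' \<in> carrier G"
    using assms BA mem_carrier[OF A] by auto
  have "b \<otimes> (a \<otimes> b') = (b \<otimes> a) \<otimes> b'" using c by (simp add: m_assoc)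
  also have "\<dots> = a \<otimes> (b \<otimes> commut G b a \<otimes> b')" using c by (simp add: swap_B[OF b a] m_assoc)
  finally show 1: "b \<otimes> (a \<otimes> b') = a \<otimes> (b \<otimes> commut G b a \<otimes> b')" .
  have "a \<otimes> b \<otimes> (a \<otimes> b') = a \<otimes> (b \<otimes> (a \<otimes> b'))" using c by (simp add: m_assoc)
  then show "a \<otimes> b \<otimes> (a \<otimes> b') = a \<otimes> a \<otimes> (b \<otimes> commut G b a \<otimes> b')"
    unfolding 1 using c by (simp add: m_assoc)
qed

lemma double_subgroup:
  assumes a: "a \<in> A" "a \<otimes> a \<in> B"
  shows "subgroup (B \<union> (\<lambda>b. a \<otimes> b) ` B) G"
proof -
  note Bm = subgroup.m_closed[OF B] and Bi = subgroup.m_inv_closed[OF B]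
  have ac: "a \<in> carrier G" using a mem_carrier[OF A] by simp
  have cl: "u \<otimes> v \<in> B \<union> (\<lambda>b. a \<otimes> b) ` B"
    if u: "u \<in> B \<union> (\<lambda>b. a \<otimes> b) ` B" and v: "v \<in> B \<union> (\<lambda>b. a \<otimes> b) ` B" for u v
  proof -
    have com': "commut G b a \<in> B" if "b \<in> B" for b using com a BA that by auto
    from u v consider "u \<in> B" "v \<in> B"
      | b where "u \<in> B" "b \<in> B" "v = a \<otimes> b"
      | b where "v \<in> B" "b \<in> B" "u = a \<otimes> b"
      | b b' where "b \<in> B" "b' \<in> B" "u = a \<otimes> b" "v = a \<otimes> b'" by blast
    then show ?thesis
    proof cases
      case 2
      then show ?thesis using double_mult(1)[OF a(1)] com' Bm by auto
    next
      case 3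
      then have "u \<otimes> v = a \<otimes> (b \<otimes> v)" using ac mem_carrier[OF B] by (simp add: m_assoc)
      then show ?thesis using 3 Bm by auto
    next
      case 4
      then show ?thesis using double_mult(2)[OF a(1)] com' Bm a(2) by auto
    qed (use Bm in auto)
  qed
  show ?thesis
  proof (rule subgroupI)
    fix u assume u: "u \<in> B \<union> (\<lambda>b. a \<otimes> b) ` B"
    show "inv u \<in> B \<union> (\<lambda>b. a \<otimes> b) ` B"
    proof (cases "u \<in> B")
      case True
      then show ?thesis using Bi by simp
    next
      case False
      then obtain b where b: "b \<in> B" "u = a \<otimes> b" using u by blast
      have bc: "b \<in> carrier G" using b mem_carrier[OF B] by simp
      have "inv a = a \<otimes> inv (a \<otimes> a)" using ac by (simp add: inv_mult_group inv_mult_cancel)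
      then have "inv a \<in> B \<union> (\<lambda>b. a \<otimes> b) ` B" using Bi[OF a(2)] by auto
      moreover have "inv u = inv b \<otimes> inv a" using b bc ac by (simp add: inv_mult_group)
      ultimately show ?thesis using cl[of "inv b" "inv a"] Bi[OF b(1)] by simp
    qed
  qed (use cl subgroup.one_closed[OF B] ac mem_carrier[OF B] in auto)
qed

text \<open>On the new coset an extension is determined by its value \<open>w\<close> at
  \<open>a\<close>, subject to the single condition on \<open>w * w\<close>. Commutators do not
  interfere because \<open>\<kappa>\<close> is 1 on them.\<close>

lemma double_character:
  assumes mult: "\<And>a b. a \<in> B \<Longrightarrow> b \<in> B \<Longrightarrow> \<kappa> (a \<otimes> b) = \<kappa> a * \<kappa> b"
    and lcom: "\<And>a b. a \<in> A \<Longrightarrow> b \<in> A \<Longrightarrow> \<kappa> (commut G a b) = 1"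
    and a: "a \<in> A" "a \<notin> B" "a \<otimes> a \<in> B" and w: "w * w = \<kappa> (a \<otimes> a)"
  defines "\<kappa>' \<equiv> \<lambda>x. if x \<in> B then \<kappa> x else w * \<kappa> (inv a \<otimes> x)"
  shows "\<And>u v. u \<in> B \<union> (\<lambda>b. a \<otimes> b) ` B \<Longrightarrow> v \<in> B \<union> (\<lambda>b. a \<otimes> b) ` B \<Longrightarrow> \<kappa>' (u \<otimes> v) = \<kappa>' u * \<kappa>' v"
    and "\<And>b. b \<in> B \<Longrightarrow> \<kappa>' b = \<kappa> b" and "\<kappa> \<one> = 1 \<Longrightarrow> \<kappa>' a = w"
proof -
  note Bm = subgroup.m_closed[OF B] and Bi = subgroup.m_inv_closed[OF B]
  have ac: "a \<in> carrier G" using a mem_carrier[OF A] by simp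
  have abB: "a \<otimes> b \<notin> B" if b: "b \<in> B" for b
  proof
    assume "a \<otimes> b \<in> B"
    then have "a \<otimes> b \<otimes> inv b \<in> B" using b Bm Bi by simp
    then show False using a(2) ac mem_carrier[OF B b] by (simp add: m_assoc)
  qed
  have l1: "\<kappa>' b = \<kappa> b" if "b \<in> B" for b using that by (simp add: \<kappa>'_def)
  have l2: "\<kappa>' (a \<otimes> b) = w * \<kappa> b" if "b \<in> B" for b
    using that abB ac mem_carrier[OF B that] by (simp add: \<kappa>'_def inv_mult_cancel)
  show "\<And>b. b \<in> B \<Longrightarrow> \<kappa>' b = \<kappa> b" by (rule l1)
  show "\<kappa> \<one> = 1 \<Longrightarrow> \<kappa>' a = w" using l2[of \<one>] ac subgroup.one_closed[OF B] by simp
  fix u v assume u: "u \<in> B \<union> (\<lambda>b. a \<otimes> b) ` B" and v: "v \<in> B \<union> (\<lambda>b. a \<otimes> b) ` B"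
  have com': "commut G b a \<in> B" "\<kappa> (commut G b a) = 1" if "b \<in> B" for b
    using com lcom a BA that by auto
  from u v consider "u \<in> B" "v \<in> B"
    | b where "u \<in> B" "b \<in> B" "v = a \<otimes> b"
    | b where "v \<in> B" "b \<in> B" "u = a \<otimes> b"
    | b b' where "b \<in> B" "b' \<in> B" "u = a \<otimes> b" "v = a \<otimes> b'" by blast
  then show "\<kappa>' (u \<otimes> v) = \<kappa>' u * \<kappa>' v"
  proof cases
    case 1
    then show ?thesis by (simp add: l1 Bm mult)
  next
    case 2
    then show ?thesis using double_mult(1)[OF a(1) 2(1,2)] com'[OF 2(1)] Bm by (simp add: l1 l2 mult)
  next
    case 3
    then have "u \<otimes> v = a \<otimes> (b \<otimes> v)" using ac mem_carrier[OF B] by (simp add: m_assoc)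
    then show ?thesis using 3 Bm by (simp add: l1 l2 mult)
  next
    case 4
    then show ?thesis using double_mult(2)[OF a(1) 4(1,2)] com'[OF 4(1)] Bm a(3) w
      by (simp add: l1 l2 mult)
  qed
qed

end

text \<open>Complex numbers have square roots, so extensions by index two can be iterated from
  \<open>B\<close> up to \<open>A\<close>.\<close>

lemma lin_ext_exists:
  assumes A: "subgroup A G" and B: "subgroup B G" and BA: "B \<subseteq> A"
    and com: "\<And>a b. a \<in> A \<Longrightarrow> b \<in> A \<Longrightarrow> commut G a b \<in> B"
    and mult: "\<And>a b. a \<in> B \<Longrightarrow> b \<in> B \<Longrightarrow> \<kappa> (a \<otimes> b) = \<kappa> a * \<kappa> b"
    and lcom: "\<And>a b. a \<in> A \<Longrightarrow> b \<in> A \<Longrightarrow> \<kappa> (commut G a b) = 1"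
  shows "lin_ext G B A \<kappa> \<noteq> {}"
  using B BA com mult lcom
proof (induction "card A - card B" arbitrary: B \<kappa> rule: less_induct)
  case less
  note B = less.prems(1) and BA = less.prems(2) and com = less.prems(3)
    and mult = less.prems(4) and lcom = less.prems(5)
  show ?case
  proof (cases "A = B")
    case True
    have "(\<lambda>x. if x \<in> A then \<kappa> x else 0) \<in> lin_ext G B A \<kappa>"
      using True mult subgroup.m_closed[OF A] by (simp add: lin_ext_def)
    then show ?thesis by blast
  next
    case False
    then obtain g where g: "g \<in> A" "g \<notin> B" using BA by blast
    then obtain j :: nat where j: "g [^] (2 ^ j :: nat) \<notin> B"
        "g [^] (2 ^ j :: nat) \<otimes> g [^] (2 ^ j :: nat) \<in> B"
      using square_in_subgroup[OF B mem_carrier[OF A]] by blast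
    define a where "a = g [^] (2 ^ j :: nat)"
    have a: "a \<in> A" "a \<notin> B" "a \<otimes> a \<in> B" using j g subgroup_pow[OF A] by (auto simp: a_def)
    define w where "w = csqrt (\<kappa> (a \<otimes> a))"
    have w: "w * w = \<kappa> (a \<otimes> a)" unfolding w_def by (simp flip: power2_eq_square)
    define B' where "B' = B \<union> (\<lambda>b. a \<otimes> b) ` B"
    define \<kappa>' where "\<kappa>' x = (if x \<in> B then \<kappa> x else w * \<kappa> (inv a \<otimes> x))" for x
    have B': "subgroup B' G" unfolding B'_def by (rule double_subgroup[OF A B BA com a(1,3)])
    have B'A: "B' \<subseteq> A" using BA a subgroup.m_closed[OF A] by (auto simp: B'_def)
    note dc = double_character[OF A B BA com mult lcom a w, folded \<kappa>'_def B'_def]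
    have "a = a \<otimes> \<one>" using a mem_carrier[OF A] by simp
    then have "a \<in> B'" using subgroup.one_closed[OF B] unfolding B'_def by blast
    then have "B \<subset> B'" using a by (auto simp: B'_def)
    then have "card B < card B'" using finite_subgroup[OF B'] by (rule psubset_card_mono[rotated])
    moreover have "card B' \<le> card A" using B'A finite_subgroup[OF A] by (rule card_mono[rotated])
    ultimately have lt: "card A - card B' < card A - card B" by simp
    have "lin_ext G B' A \<kappa>' \<noteq> {}"
    proof (rule less.hyps[OF lt B' B'A])
      fix u v assume uv: "u \<in> A" "v \<in> A"
      show "commut G u v \<in> B'" using com[OF uv] by (simp add: B'_def)
      show "\<kappa>' (commut G u v) = 1" using com[OF uv] lcom[OF uv] by (simp add: \<kappa>'_def)
    qed (rule dc(1))
    then obtain \<mu> where \<mu>: "\<mu> \<in> lin_ext G B' A \<kappa>'" by blast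
    then have "\<mu> \<in> lin_ext G B A \<kappa>" by (auto simp: lin_ext_def B'_def \<kappa>'_def)
    then show ?thesis by blast
  qed
qed

section \<open>Orthogonality and counting of extensions\<close>

context
  fixes A B and \<kappa> :: "'a \<Rightarrow> complex"
  assumes A: "subgroup A G" and B: "subgroup B G" and BA: "B \<subseteq> A"
    and com: "\<And>a b. a \<in> A \<Longrightarrow> b \<in> A \<Longrightarrow> commut G a b \<in> B"
    and mult: "\<And>a b. a \<in> B \<Longrightarrow> b \<in> B \<Longrightarrow> \<kappa> (a \<otimes> b) = \<kappa> a * \<kappa> b"
    and lcom: "\<And>a b. a \<in> A \<Longrightarrow> b \<in> A \<Longrightarrow> \<kappa> (commut G a b) = 1"
begin

lemma lam_one: "\<kappa> \<one> = 1"
  using lcom[of \<one> \<one>] subgroup.one_closed[OF A] by simp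

lemma lin_ext_facts:
  assumes "\<mu> \<in> lin_ext G B A \<kappa>"
  shows "\<And>a b. a \<in> A \<Longrightarrow> b \<in> A \<Longrightarrow> \<mu> (a \<otimes> b) = \<mu> a * \<mu> b" "\<And>b. b \<in> B \<Longrightarrow> \<mu> b = \<kappa> b"
    "\<And>x. x \<notin> A \<Longrightarrow> \<mu> x = 0" "\<mu> \<one> = 1" "\<And>a. a \<in> A \<Longrightarrow> \<mu> a \<noteq> 0"
proof -
  show m: "\<And>a b. a \<in> A \<Longrightarrow> b \<in> A \<Longrightarrow> \<mu> (a \<otimes> b) = \<mu> a * \<mu> b" and b: "\<And>b. b \<in> B \<Longrightarrow> \<mu> b = \<kappa> b"
    and "\<And>x. x \<notin> A \<Longrightarrow> \<mu> x = 0"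
    using assms by (auto simp: lin_ext_def)
  show one: "\<mu> \<one> = 1" using b subgroup.one_closed[OF B] lam_one by simp
  fix a assume a: "a \<in> A"
  have "\<mu> a * \<mu> (inv a) = 1"
    using m[OF a subgroup.m_inv_closed[OF A a]] mem_carrier[OF A a] one by simp
  then show "\<mu> a \<noteq> 0" by auto
qed

lemma lin_ext_pow:
  assumes "\<mu> \<in> lin_ext G B A \<kappa>" "a \<in> A"
  shows "\<mu> (a [^] (k::nat)) = \<mu> a ^ k"
  by (induction k) (use assms lin_ext_facts(1,4)[OF assms(1)] subgroup_pow[OF A] in auto)

lemma finite_lin_ext: "finite (lin_ext G B A \<kappa>)"
proof (rule finite_subset)
  show "lin_ext G B A \<kappa> \<subseteq>
      {f. \<forall>x. (x \<in> A \<longrightarrow> f x \<in> {w. w ^ card (carrier G) = 1}) \<and> (x \<notin> A \<longrightarrow> f x = 0)}"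
  proof (intro subsetI CollectI allI conjI impI)
    fix \<mu> x assume \<mu>: "\<mu> \<in> lin_ext G B A \<kappa>"
    show "\<mu> x = 0" if "x \<notin> A" using lin_ext_facts(3)[OF \<mu> that] .
    show "\<mu> x ^ card (carrier G) = 1" if x: "x \<in> A"
      using lin_ext_pow[OF \<mu> x, of "card (carrier G)"] pow_order_eq_1[OF mem_carrier[OF A x]]
        lin_ext_facts(4)[OF \<mu>] by (simp add: Coset.order_def)
  qed
  have "card (carrier G) > 0" using fin by (auto simp: card_gt_0_iff)
  then have "finite {w :: complex. w ^ card (carrier G) = 1}" by (intro finite_roots_unity) simp
  then show "finite {f. \<forall>x. (x \<in> A \<longrightarrow> f x \<in> {w :: complex. w ^ card (carrier G) = 1}) \<and> (x \<notin> A \<longrightarrow> f x = 0)}"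
    by (intro finite_set_of_finite_funs finite_subgroup[OF A])
qed

text \<open>The square roots \<open>w\<close> and \<open>- w\<close> give extensions that differ at
  the power \<open>a\<close> of \<open>g\<close>, hence already at \<open>g\<close>.\<close>

lemma lin_ext_separates:
  assumes g: "g \<in> A" "g \<notin> B"
  shows "\<exists>\<mu>1\<in>lin_ext G B A \<kappa>. \<exists>\<mu>2\<in>lin_ext G B A \<kappa>. \<mu>1 g \<noteq> \<mu>2 g"
proof -
  obtain j :: nat where j: "g [^] (2 ^ j :: nat) \<notin> B"
      "g [^] (2 ^ j :: nat) \<otimes> g [^] (2 ^ j :: nat) \<in> B"
    using square_in_subgroup[OF B mem_carrier[OF A]] g by blast
  define a where "a = g [^] (2 ^ j :: nat)"
  have a: "a \<in> A" "a \<notin> B" "a \<otimes> a \<in> B" using j g subgroup_pow[OF A] by (auto simp: a_def)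
  define B' where "B' = B \<union> (\<lambda>b. a \<otimes> b) ` B"
  have B': "subgroup B' G" unfolding B'_def by (rule double_subgroup[OF A B BA com a(1,3)])
  have B'A: "B' \<subseteq> A" using BA a subgroup.m_closed[OF A] by (auto simp: B'_def)
  have "a = a \<otimes> \<one>" using a mem_carrier[OF A] by simp
  then have aB': "a \<in> B'" using subgroup.one_closed[OF B] unfolding B'_def by blast
  have ext: "\<exists>\<mu>\<in>lin_ext G B A \<kappa>. \<mu> a = w" if w: "w * w = \<kappa> (a \<otimes> a)" for w
  proof -
    define \<kappa>' where "\<kappa>' x = (if x \<in> B then \<kappa> x else w * \<kappa> (inv a \<otimes> x))" for x
    note dc = double_character[OF A B BA com mult lcom a w, folded \<kappa>'_def B'_def]
    have "lin_ext G B' A \<kappa>' \<noteq> {}"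
    proof (rule lin_ext_exists[OF A B' B'A])
      fix u v assume uv: "u \<in> A" "v \<in> A"
      show "commut G u v \<in> B'" using com[OF uv] by (simp add: B'_def)
      show "\<kappa>' (commut G u v) = 1" using com[OF uv] lcom[OF uv] by (simp add: \<kappa>'_def)
    qed (rule dc(1))
    then obtain \<mu> where \<mu>: "\<mu> \<in> lin_ext G B' A \<kappa>'" by blast
    then have "\<mu> \<in> lin_ext G B A \<kappa>" "\<mu> a = \<kappa>' a"
      using aB' by (auto simp: lin_ext_def B'_def \<kappa>'_def)
    moreover have "\<kappa>' a = w" using a mem_carrier[OF A] lam_one by (simp add: \<kappa>'_def)
    ultimately show ?thesis by auto
  qed
  define w where "w = csqrt (\<kappa> (a \<otimes> a))"
  have w: "w * w = \<kappa> (a \<otimes> a)" unfolding w_def by (simp flip: power2_eq_square)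
  then have w': "(- w) * (- w) = \<kappa> (a \<otimes> a)" by simp
  obtain \<mu>1 \<mu>2 where \<mu>: "\<mu>1 \<in> lin_ext G B A \<kappa>" "\<mu>1 a = w" "\<mu>2 \<in> lin_ext G B A \<kappa>" "\<mu>2 a = - w"
    using ext[OF w] ext[OF w'] by blast
  have "w \<noteq> 0" using lin_ext_facts(5)[OF \<mu>(1) a(1)] \<mu>(2) by simp
  then have "w \<noteq> - w" by (auto simp: eq_neg_iff_add_eq_0 simp flip: mult_2)
  then have "\<mu>1 a \<noteq> \<mu>2 a" using \<mu> by simp
  then have "\<mu>1 g \<noteq> \<mu>2 g"
    using lin_ext_pow[OF \<mu>(1) g(1), of "2 ^ j"] lin_ext_pow[OF \<mu>(3) g(1), of "2 ^ j"]
    by (auto simp: a_def)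
  then show ?thesis using \<mu> by blast
qed

text \<open>The quotient of two extensions is a character trivial on \<open>B\<close>. Outside
  \<open>A\<close> everything is zero, and division by zero returns zero, as \<open>lin_ext\<close>
  demands.\<close>

lemma lin_ext_twist:
  assumes "\<mu> \<in> lin_ext G B A \<kappa>" "\<mu>1 \<in> lin_ext G B A \<kappa>" "\<mu>2 \<in> lin_ext G B A \<kappa>"
  shows "(\<lambda>x. \<mu> x * \<mu>1 x / \<mu>2 x) \<in> lin_ext G B A \<kappa>"
  unfolding lin_ext_def
proof (intro CollectI conjI allI ballI impI)
  fix b assume b: "b \<in> B"
  then show "\<mu> b * \<mu>1 b / \<mu>2 b = \<kappa> b"
    using assms[THEN lin_ext_facts(2), OF b] lin_ext_facts(5)[OF assms(3)] BA by auto
qed (use assms[THEN lin_ext_facts(1)] assms[THEN lin_ext_facts(3)] in auto)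

text \<open>Multiplication by \<open>\<mu>1 / \<mu>2\<close> permutes the extensions and scales
  their sum at \<open>g\<close> by a factor different from 1.\<close>

lemma lin_ext_sum:
  assumes g: "g \<in> A"
  shows "(\<Sum>\<mu>\<in>lin_ext G B A \<kappa>. \<mu> g) = (if g \<in> B then of_nat (card (lin_ext G B A \<kappa>)) * \<kappa> g else 0)"
proof (cases "g \<in> B")
  case True
  then have "(\<Sum>\<mu>\<in>lin_ext G B A \<kappa>. \<mu> g) = (\<Sum>\<mu>\<in>lin_ext G B A \<kappa>. \<kappa> g)"
    using lin_ext_facts(2) by (intro sum.cong) auto
  then show ?thesis using True by simp
next
  case False
  obtain \<mu>1 \<mu>2 where \<mu>: "\<mu>1 \<in> lin_ext G B A \<kappa>" "\<mu>2 \<in> lin_ext G B A \<kappa>" "\<mu>1 g \<noteq> \<mu>2 g"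
    using lin_ext_separates[OF g False] by blast
  have twist_back: "\<mu>' x * \<mu>a x / \<mu>b x * \<mu>b x / \<mu>a x = \<mu>' x"
    if "\<mu>' \<in> lin_ext G B A \<kappa>" "\<mu>a \<in> lin_ext G B A \<kappa>" "\<mu>b \<in> lin_ext G B A \<kappa>" for \<mu>' \<mu>a \<mu>b x
    using lin_ext_facts(5)[OF that(2), of x] lin_ext_facts(5)[OF that(3), of x] lin_ext_facts(3)[OF that(1), of x]
    by (cases "x \<in> A") auto
  have "bij_betw (\<lambda>\<mu> x. \<mu> x * \<mu>1 x / \<mu>2 x) (lin_ext G B A \<kappa>) (lin_ext G B A \<kappa>)"
    by (rule bij_betwI[where g = "\<lambda>\<mu> x. \<mu> x * \<mu>2 x / \<mu>1 x"])
      (use \<mu> twist_back lin_ext_twist in auto)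
  then have "(\<Sum>\<mu>\<in>lin_ext G B A \<kappa>. \<mu> g) = (\<Sum>\<mu>\<in>lin_ext G B A \<kappa>. \<mu> g * \<mu>1 g / \<mu>2 g)"
    by (rule sum.reindex_bij_betw[symmetric])
  also have "\<dots> = (\<Sum>\<mu>\<in>lin_ext G B A \<kappa>. \<mu> g) * (\<mu>1 g / \<mu>2 g)"
    by (simp add: sum_distrib_right sum_divide_distrib)
  finally have "(\<mu>1 g / \<mu>2 g - 1) * (\<Sum>\<mu>\<in>lin_ext G B A \<kappa>. \<mu> g) = 0"
    by (simp add: left_diff_distrib mult.commute)
  then show ?thesis using False \<mu>(3) lin_ext_facts(5)[OF \<mu>(2) g] by auto
qed

text \<open>Double counting of \<open>\<mu> a / \<mu>0 a\<close>: summing over \<open>a\<close>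
  first leaves \<open>card A\<close> from \<open>\<mu> = \<mu>0\<close>, summing over the extensions
  first leaves their number for each element of \<open>B\<close>.\<close>

lemma lin_ext_card: "card (lin_ext G B A \<kappa>) * card B = card A"
proof -
  let ?X = "lin_ext G B A \<kappa>"
  obtain \<mu>0 where \<mu>0: "\<mu>0 \<in> ?X" using lin_ext_exists[OF A B BA com mult lcom] by blast
  have in1: "(\<Sum>a\<in>A. \<mu> a / \<mu>0 a) = (if \<mu> = \<mu>0 then of_nat (card A) else 0)" if \<mu>: "\<mu> \<in> ?X" for \<mu>
  proof (cases "\<mu> = \<mu>0")
    case True
    then show ?thesis using lin_ext_facts(5)[OF \<mu>0] by simp
  next
    case False
    then obtain x where x: "\<mu> x \<noteq> \<mu>0 x" by blast
    then have xA: "x \<in> A" using lin_ext_facts(3)[OF \<mu>0] lin_ext_facts(3)[OF \<mu>] by metis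
    have "bij_betw (\<lambda>w. x \<otimes> w) A A"
      by (rule bij_betwI[where g = "\<lambda>w. inv x \<otimes> w"])
        (use xA A mem_carrier[OF A] in \<open>auto simp: subgroup.m_closed subgroup.m_inv_closed inv_mult_cancel\<close>)
    then have "(\<Sum>a\<in>A. \<mu> a / \<mu>0 a) = (\<Sum>a\<in>A. \<mu> (x \<otimes> a) / \<mu>0 (x \<otimes> a))"
      by (rule sum.reindex_bij_betw[symmetric])
    also have "\<dots> = (\<mu> x / \<mu>0 x) * (\<Sum>a\<in>A. \<mu> a / \<mu>0 a)"
      using xA by (simp add: lin_ext_facts(1)[OF \<mu>] lin_ext_facts(1)[OF \<mu>0] sum_distrib_left)
    finally have "(\<mu> x / \<mu>0 x - 1) * (\<Sum>a\<in>A. \<mu> a / \<mu>0 a) = 0" by (simp add: left_diff_distrib)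
    then show ?thesis using x False lin_ext_facts(5)[OF \<mu>0 xA] by auto
  qed
  have k0: "\<kappa> b \<noteq> 0" if "b \<in> B" for b
    using lin_ext_facts(5)[OF \<mu>0, of b] lin_ext_facts(2)[OF \<mu>0 that] BA that by auto
  have "of_nat (card A) = (\<Sum>\<mu>\<in>?X. if \<mu> = \<mu>0 then of_nat (card A) else (0::complex))"
    using \<mu>0 finite_lin_ext by simp
  also have "\<dots> = (\<Sum>\<mu>\<in>?X. \<Sum>a\<in>A. \<mu> a / \<mu>0 a)" by (intro sum.cong) (auto simp: in1)
  also have "\<dots> = (\<Sum>a\<in>A. (\<Sum>\<mu>\<in>?X. \<mu> a) / \<mu>0 a)"
    by (subst sum.swap) (simp add: sum_divide_distrib)
  also have "\<dots> = (\<Sum>a\<in>A. if a \<in> B then of_nat (card ?X) else 0)"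
    using k0 lin_ext_facts(2)[OF \<mu>0] by (intro sum.cong) (auto simp: lin_ext_sum)
  also have "\<dots> = (\<Sum>a\<in>B. of_nat (card ?X))"
    by (subst sum.inter_filter[symmetric])
      (use finite_subgroup[OF A] BA in \<open>auto intro!: arg_cong[of _ _ card]\<close>)
  also have "\<dots> = complex_of_nat (card ?X * card B)" by simp
  finally show ?thesis by (metis of_nat_eq_iff)
qed

end

end

section \<open>Irreducible characters of 2-groups of class two\<close>

locale class2_two_group = class2_group G + two_group G for G (structure)
begin

lemma finite_center: "finite (center G)"
  using finite_subgroup[OF subgroup_center] .

text \<open>The dual group of the centre, written as the extensions of the trivial character of the
  trivial subgroup so that the facts on \<open>lin_ext\<close> apply.\<close>

definition center_dual :: "('a \<Rightarrow> complex) set" where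
  "center_dual = lin_ext G {\<one>} (center G) (\<lambda>_. 1)"

definition radical :: "('a \<Rightarrow> complex) \<Rightarrow> 'a set" where
  "radical \<kappa> = {g \<in> carrier G. \<forall>h\<in>carrier G. \<kappa> (commut G g h) = 1}"

lemma trivial_subgroup: "subgroup {\<one>} G"
  by (rule subgroupI) auto

lemma center_dual_facts:
  assumes "\<kappa> \<in> center_dual"
  shows "\<And>a b. a \<in> center G \<Longrightarrow> b \<in> center G \<Longrightarrow> \<kappa> (a \<otimes> b) = \<kappa> a * \<kappa> b" "\<kappa> \<one> = 1"
    "\<And>a. a \<in> center G \<Longrightarrow> \<kappa> a \<noteq> 0"
proof -
  show m: "\<And>a b. a \<in> center G \<Longrightarrow> b \<in> center G \<Longrightarrow> \<kappa> (a \<otimes> b) = \<kappa> a * \<kappa> b" and one: "\<kappa> \<one> = 1"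
    using assms by (simp_all add: center_dual_def lin_ext_def)
  fix a assume a: "a \<in> center G"
  have "\<kappa> a * \<kappa> (inv a) = 1"
    using m[OF a center_inv[OF a]] center_sub[OF a] one by simp
  then show "\<kappa> a \<noteq> 0" by auto
qed

context
  fixes \<kappa>
  assumes \<kappa>: "\<kappa> \<in> center_dual"
begin

lemma kappa_mult_left:
  assumes "g \<in> carrier G" "h \<in> carrier G" "k \<in> carrier G"
  shows "\<kappa> (commut G (g \<otimes> h) k) = \<kappa> (commut G g k) * \<kappa> (commut G h k)"
  using assms center_dual_facts(1)[OF \<kappa>] by (simp add: commut_mult_left commut_center)

lemma kappa_mult_right:
  assumes "g \<in> carrier G" "h \<in> carrier G" "k \<in> carrier G"
  shows "\<kappa> (commut G k (g \<otimes> h)) = \<kappa> (commut G k g) * \<kappa> (commut G k h)"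
  using assms center_dual_facts(1)[OF \<kappa>] by (simp add: commut_mult_right commut_center)

lemma kappa_one: "g \<in> carrier G \<Longrightarrow> z \<in> center G \<Longrightarrow> \<kappa> (commut G g z) = 1"
  "g \<in> carrier G \<Longrightarrow> z \<in> center G \<Longrightarrow> \<kappa> (commut G z g) = 1"
  using center_dual_facts(2)[OF \<kappa>] by (simp_all add: commut_central)

lemma kappa_flip:
  assumes "g \<in> carrier G" "h \<in> carrier G"
  shows "\<kappa> (commut G g h) = 1 \<longleftrightarrow> \<kappa> (commut G h g) = 1"
proof -
  have "\<kappa> (commut G g h) * \<kappa> (commut G h g) = \<kappa> (commut G g h \<otimes> inv (commut G g h))"
    using center_dual_facts(1)[OF \<kappa> commut_center[OF assms] center_inv[OF commut_center[OF assms]]]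
    unfolding commut_inv[OF assms] by simp
  also have "\<dots> = 1" using assms center_dual_facts(2)[OF \<kappa>] by simp
  finally show ?thesis by auto
qed

lemma center_radical: "center G \<subseteq> radical \<kappa>"
  using kappa_one by (auto simp: radical_def center_sub)

lemma subgroup_radical: "subgroup (radical \<kappa>) G"
proof (rule subgroupI)
  show "radical \<kappa> \<noteq> {}" using center_radical center_one by blast
  fix a assume a: "a \<in> radical \<kappa>"
  have "\<kappa> (commut G (inv a) g) = 1" if g: "g \<in> carrier G" for g
    using a g kappa_mult_left[of a "inv a" g] kappa_one(2)[OF g center_one] by (auto simp: radical_def)
  then show "inv a \<in> radical \<kappa>" using a by (simp add: radical_def)
qed (auto simp: radical_def kappa_mult_left)

lemma radical_ext_conditions:
  "\<And>a b. a \<in> radical \<kappa> \<Longrightarrow> b \<in> radical \<kappa> \<Longrightarrow> commut G a b \<in> center G"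
  "\<And>a b. a \<in> center G \<Longrightarrow> b \<in> center G \<Longrightarrow> \<kappa> (a \<otimes> b) = \<kappa> a * \<kappa> b"
  "\<And>a b. a \<in> radical \<kappa> \<Longrightarrow> b \<in> radical \<kappa> \<Longrightarrow> \<kappa> (commut G a b) = 1"
  using center_dual_facts(1)[OF \<kappa>] by (auto simp: radical_def commut_center)

lemma kappa_sum:
  assumes H: "subgroup H G" and g: "g \<in> carrier G"
  shows "(\<Sum>x\<in>H. \<kappa> (commut G g x)) = (if \<forall>x\<in>H. \<kappa> (commut G g x) = 1 then of_nat (card H) else 0)"
proof (cases "\<forall>x\<in>H. \<kappa> (commut G g x) = 1")
  case False
  then obtain y where y: "y \<in> H" "\<kappa> (commut G g y) \<noteq> 1" by blast
  have "bij_betw (\<lambda>w. y \<otimes> w) H H"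
    by (rule bij_betwI[where g = "\<lambda>w. inv y \<otimes> w"])
      (use y H mem_carrier[OF H] in \<open>auto simp: subgroup.m_closed subgroup.m_inv_closed inv_mult_cancel\<close>)
  then have "(\<Sum>x\<in>H. \<kappa> (commut G g x)) = (\<Sum>x\<in>H. \<kappa> (commut G g (y \<otimes> x)))"
    by (rule sum.reindex_bij_betw[symmetric])
  also have "\<dots> = (\<Sum>x\<in>H. \<kappa> (commut G g y) * \<kappa> (commut G g x))"
    using y g mem_carrier[OF H] by (intro sum.cong) (auto simp: kappa_mult_right)
  also have "\<dots> = \<kappa> (commut G g y) * (\<Sum>x\<in>H. \<kappa> (commut G g x))" by (rule sum_distrib_left[symmetric])
  finally have "(\<kappa> (commut G g y) - 1) * (\<Sum>x\<in>H. \<kappa> (commut G g x)) = 0"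
    by (simp add: left_diff_distrib)
  then have "(\<Sum>x\<in>H. \<kappa> (commut G g x)) = 0" using y by simp
  then show ?thesis unfolding if_not_P[OF False] .
qed simp

text \<open>A maximal isotropic subgroup is its own orthogonal complement, hence has index
  \<open>d\<close> in \<open>G\<close> and contains the radical with index \<open>d\<close>.\<close>

lemma maximal_isotropic:
  obtains M where "subgroup M G" "radical \<kappa> \<subseteq> M" "\<And>a b. a \<in> M \<Longrightarrow> b \<in> M \<Longrightarrow> \<kappa> (commut G a b) = 1"
    "\<And>g. g \<in> carrier G \<Longrightarrow> (\<And>a. a \<in> M \<Longrightarrow> \<kappa> (commut G a g) = 1) \<Longrightarrow> g \<in> M"
    "card M ^ 2 = card (radical \<kappa>) * card (carrier G)"
proof -
  define Q where "Q M \<longleftrightarrow> subgroup M G \<and> radical \<kappa> \<subseteq> M \<and> (\<forall>a\<in>M. \<forall>b\<in>M. \<kappa> (commut G a b) = 1)" for M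
  have "Q (radical \<kappa>)" using subgroup_radical radical_ext_conditions(3) by (simp add: Q_def)
  moreover have "\<forall>M. Q M \<longrightarrow> card M < Suc (card (carrier G))"
    using fin subgroup.subset by (auto simp: Q_def less_Suc_eq_le intro!: card_mono)
  ultimately have "\<exists>M. Q M \<and> (\<forall>N. Q N \<longrightarrow> card N \<le> card M)" by (rule ex_has_greatest_nat[of Q _ card])
  then obtain M where M: "Q M" and max: "\<And>N. Q N \<Longrightarrow> card N \<le> card M" by auto
  have sub: "subgroup M G" and RM: "radical \<kappa> \<subseteq> M"
    and iso: "\<And>a b. a \<in> M \<Longrightarrow> b \<in> M \<Longrightarrow> \<kappa> (commut G a b) = 1"
    using M by (auto simp: Q_def)
  have perp: "g \<in> M" if g: "g \<in> carrier G" and orth: "\<And>a. a \<in> M \<Longrightarrow> \<kappa> (commut G a g) = 1" for g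
  proof (rule ccontr)
    assume "g \<notin> M"
    then obtain j :: nat where j: "g [^] (2 ^ j :: nat) \<notin> M"
        "g [^] (2 ^ j :: nat) \<otimes> g [^] (2 ^ j :: nat) \<in> M"
      using square_in_subgroup[OF sub g] by blast
    \<comment> \<open>Adjoining \<open>a\<close> keeps \<open>M\<close> isotropic, as
      \<open>a\<close> is a power of \<open>g\<close> and so orthogonal to \<open>M\<close>, and is
      orthogonal to itself. This contradicts maximality.\<close>
    define a where "a = g [^] (2 ^ j :: nat)"
    have ac: "a \<in> carrier G" using g by (simp add: a_def)
    have a: "a \<notin> M" "a \<otimes> a \<in> M" using j by (simp_all add: a_def)
    have am: "\<kappa> (commut G m a) = 1" if m: "m \<in> M" for m
    proof -
      have "\<kappa> (commut G m (g [^] k)) = 1" for k :: nat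
        by (induction k) (use m mem_carrier[OF sub m] g orth kappa_one(1)[OF mem_carrier[OF sub m] center_one] in \<open>auto simp: kappa_mult_right\<close>)
      then show ?thesis by (simp add: a_def)
    qed
    have ma: "\<kappa> (commut G a m) = 1" if m: "m \<in> M" for m
      using am[OF m] kappa_flip[OF ac mem_carrier[OF sub m]] by simp
    have com: "commut G x y \<in> M" if "x \<in> carrier G" "y \<in> carrier G" for x y
      using commut_center[OF that] center_radical RM by blast
    have "subgroup (M \<union> (\<lambda>b. a \<otimes> b) ` M) G"
      by (rule double_subgroup[OF subgroup_self sub subgroup.subset[OF sub] com ac a(2)])
    moreover have "\<kappa> (commut G u v) = 1"
      if u: "u \<in> M \<union> (\<lambda>b. a \<otimes> b) ` M" and v: "v \<in> M \<union> (\<lambda>b. a \<otimes> b) ` M" for u v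
    proof -
      have 1: "\<kappa> (commut G u m) = 1" if m: "m \<in> M" for m
        using u m mem_carrier[OF sub] ac by (auto simp: kappa_mult_left iso ma)
      have 2: "\<kappa> (commut G u a) = 1"
        using u mem_carrier[OF sub] ac by (auto simp: kappa_mult_left am center_dual_facts(2)[OF \<kappa>])
      have uc: "u \<in> carrier G" using u mem_carrier[OF sub] ac by auto
      show ?thesis using v 1 2 uc mem_carrier[OF sub] ac by (auto simp: kappa_mult_right)
    qed
    ultimately have "Q (M \<union> (\<lambda>b. a \<otimes> b) ` M)" using RM by (auto simp: Q_def)
    then have le: "card (M \<union> (\<lambda>b. a \<otimes> b) ` M) \<le> card M" by (rule max)
    have "a = a \<otimes> \<one>" using ac by simp
    then have "a \<in> (\<lambda>b. a \<otimes> b) ` M" using subgroup.one_closed[OF sub] by blast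
    then have "M \<subset> M \<union> (\<lambda>b. a \<otimes> b) ` M" using a(1) by blast
    then have "card M < card (M \<union> (\<lambda>b. a \<otimes> b) ` M)"
      using finite_subgroup[OF sub] by (intro psubset_card_mono) auto
    then show False using le by simp
  qed
  \<comment> \<open>This double sum is evaluated in both orders. Summed over \<open>g\<close> first,
    only \<open>a\<close> in the radical survives; summed over \<open>a\<close> first, only
    \<open>g\<close> in \<open>M\<close>, which is its own complement. Comparison gives the order of
    \<open>M\<close>.\<close>
  have "(\<Sum>a\<in>M. \<Sum>g\<in>carrier G. \<kappa> (commut G a g)) = (\<Sum>a\<in>M. if a \<in> radical \<kappa> then of_nat (card (carrier G)) else 0)"
    by (intro sum.cong) (auto simp: kappa_sum[OF subgroup_self] mem_carrier[OF sub] radical_def)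
  also have "\<dots> = (\<Sum>a\<in>radical \<kappa>. of_nat (card (carrier G)))"
    by (subst sum.inter_filter[symmetric])
      (use finite_subgroup[OF sub] RM in \<open>auto intro!: arg_cong[of _ _ card]\<close>)
  finally have 1: "(\<Sum>a\<in>M. \<Sum>g\<in>carrier G. \<kappa> (commut G a g)) = of_nat (card (radical \<kappa>) * card (carrier G))"
    by simp
  have inner: "(\<Sum>a\<in>M. \<kappa> (commut G a g)) = (if g \<in> M then of_nat (card M) else 0)" if g: "g \<in> carrier G" for g
  proof (cases "g \<in> M")
    case True
    then show ?thesis by (simp add: iso)
  next
    case False
    then obtain y where y: "y \<in> M" "\<kappa> (commut G y g) \<noteq> 1" using perp[OF g] by blast
    have "bij_betw (\<lambda>w. y \<otimes> w) M M"
      by (rule bij_betwI[where g = "\<lambda>w. inv y \<otimes> w"])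
        (use y sub mem_carrier[OF sub] in \<open>auto simp: subgroup.m_closed subgroup.m_inv_closed inv_mult_cancel\<close>)
    then have "(\<Sum>x\<in>M. \<kappa> (commut G x g)) = (\<Sum>x\<in>M. \<kappa> (commut G (y \<otimes> x) g))"
      by (rule sum.reindex_bij_betw[symmetric])
    also have "\<dots> = (\<Sum>x\<in>M. \<kappa> (commut G y g) * \<kappa> (commut G x g))"
      using y g mem_carrier[OF sub] by (intro sum.cong) (auto simp: kappa_mult_left)
    also have "\<dots> = \<kappa> (commut G y g) * (\<Sum>x\<in>M. \<kappa> (commut G x g))" by (rule sum_distrib_left[symmetric])
  finally have "(\<kappa> (commut G y g) - 1) * (\<Sum>x\<in>M. \<kappa> (commut G x g)) = 0"
      by (simp add: left_diff_distrib)
    then show ?thesis using y False by simp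
  qed
  have "(\<Sum>a\<in>M. \<Sum>g\<in>carrier G. \<kappa> (commut G a g)) = (\<Sum>g\<in>carrier G. if g \<in> M then of_nat (card M) else 0)"
    by (subst sum.swap, intro sum.cong) (auto simp: inner)
  also have "\<dots> = (\<Sum>g\<in>M. of_nat (card M))"
    by (subst sum.inter_filter[symmetric])
      (use fin mem_carrier[OF sub] in \<open>auto intro!: arg_cong[of _ _ card]\<close>)
  finally have "complex_of_nat (card M ^ 2) = of_nat (card (radical \<kappa>) * card (carrier G))"
    unfolding 1 by (simp add: power2_eq_square)
  then have "card M ^ 2 = card (radical \<kappa>) * card (carrier G)" by (simp only: of_nat_eq_iff)
  then show thesis by (intro that[OF sub RM iso perp])
qed

end

text \<open>Representatives are numbered because they become matrix indices. The choice
  \<open>f\<close> is constant on cosets, since the predicate behind it depends only on the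
  coset.\<close>

lemma left_transversal:
  assumes M: "subgroup M G"
  obtains t :: "nat \<Rightarrow> 'a" and d where "\<And>i. i < d \<Longrightarrow> t i \<in> carrier G"
    "\<And>g. g \<in> carrier G \<Longrightarrow> \<exists>!i. i < d \<and> inv (t i) \<otimes> g \<in> M"
proof -
  define f where "f g = (SOME h. h \<in> carrier G \<and> inv h \<otimes> g \<in> M)" for g
  have f: "f g \<in> carrier G" "inv (f g) \<otimes> g \<in> M" if g: "g \<in> carrier G" for g
  proof -
    have "g \<in> carrier G \<and> inv g \<otimes> g \<in> M" using g subgroup.one_closed[OF M] by simp
    then have "f g \<in> carrier G \<and> inv (f g) \<otimes> g \<in> M" unfolding f_def by (rule someI)
    then show "f g \<in> carrier G" "inv (f g) \<otimes> g \<in> M" by auto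
  qed
  have eq: "f g = f g'" if g: "g \<in> carrier G" "g' \<in> carrier G" and h: "h \<in> carrier G" "inv h \<otimes> g \<in> M" "inv h \<otimes> g' \<in> M" for g g' h
  proof -
    have gg: "inv g \<otimes> g' \<in> M" "inv g' \<otimes> g \<in> M"
    proof -
      have "inv (inv h \<otimes> g) \<otimes> (inv h \<otimes> g') = inv g \<otimes> g'" "inv (inv h \<otimes> g') \<otimes> (inv h \<otimes> g) = inv g' \<otimes> g"
        using g h by (simp_all add: inv_mult_group m_assoc inv_mult_cancel)
      then show "inv g \<otimes> g' \<in> M" "inv g' \<otimes> g \<in> M"
        using h M by (metis subgroup.m_closed subgroup.m_inv_closed)+
    qed
    have "inv k \<otimes> g \<in> M \<longleftrightarrow> inv k \<otimes> g' \<in> M" if k: "k \<in> carrier G" for k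
    proof -
      have "inv k \<otimes> g' = (inv k \<otimes> g) \<otimes> (inv g \<otimes> g')" "inv k \<otimes> g = (inv k \<otimes> g') \<otimes> (inv g' \<otimes> g)"
        using g k by (simp_all add: m_assoc inv_mult_cancel)
      then show ?thesis using gg M by (metis subgroup.m_closed)
    qed
    then show ?thesis unfolding f_def by metis
  qed
  define T where "T = f ` carrier G"
  have "finite T" using fin by (simp add: T_def)
  then obtain t where t: "bij_betw t {0..<card T} T" using ex_bij_betw_nat_finite by blast
  show thesis
  proof (rule that[of "card T" t])
    fix i assume "i < card T"
    then have "t i \<in> T" using t by (auto simp: bij_betw_def)
    then show "t i \<in> carrier G" using f by (auto simp: T_def)
  next
    fix g assume g: "g \<in> carrier G"
    then have "f g \<in> t ` {0..<card T}" using t by (auto simp: bij_betw_def T_def)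
    then obtain i where i: "i < card T" "t i = f g" by auto
    show "\<exists>!i. i < card T \<and> inv (t i) \<otimes> g \<in> M"
    proof (rule ex1I[of _ i])
      show "i < card T \<and> inv (t i) \<otimes> g \<in> M" using i f[OF g] by simp
      fix j assume j: "j < card T \<and> inv (t j) \<otimes> g \<in> M"
      then have "t j \<in> T" using t by (auto simp: bij_betw_def)
      then obtain g0 where g0: "g0 \<in> carrier G" "t j = f g0" by (auto simp: T_def)
      have "f g0 = f g" by (rule eq[OF g0(1) g f(1)[OF g0(1)] f(2)[OF g0(1)]]) (use j g0 in simp)
      then have "t j = t i" using i g0 by simp
      then show "j = i" using t i(1) j by (auto simp: bij_betw_def inj_on_def)
    qed
  qed
qed

end

section \<open>Induced representations and their irreducibility\<close>

lemma subspace_vec_closed: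
  assumes "VectorSpace.subspace class_ring W (module_vec TYPE(complex) n)"
  shows "0\<^sub>v n \<in> W" "W \<subseteq> carrier_vec n" "\<And>v w. v \<in> W \<Longrightarrow> w \<in> W \<Longrightarrow> v + w \<in> W"
    "\<And>c v. v \<in> W \<Longrightarrow> c \<cdot>\<^sub>v v \<in> W"
proof -
  note s = VectorSpace.subspace.submod[OF assms]
  show "0\<^sub>v n \<in> W" using submodule.zero_closed[OF s] by (simp add: module_vec_simps)
  show "W \<subseteq> carrier_vec n" using submodule.subset[OF s] by (simp add: module_vec_simps)
  show "\<And>v w. v \<in> W \<Longrightarrow> w \<in> W \<Longrightarrow> v + w \<in> W"
    using submodule.m_closed[OF s] by (simp add: module_vec_simps)
  show "\<And>c v. v \<in> W \<Longrightarrow> c \<cdot>\<^sub>v v \<in> W"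
    using submodule.smult_closed[OF s] by (simp add: module_vec_simps)
qed

lemma unit_vecs_generate:
  assumes W: "VectorSpace.subspace class_ring W (module_vec TYPE(complex) n)"
    and u: "\<And>i. i < n \<Longrightarrow> unit_vec n i \<in> W"
  shows "W = carrier_vec n"
proof
  note cl = subspace_vec_closed[OF W]
  show "W \<subseteq> carrier_vec n" by (rule cl(2))
  show "carrier_vec n \<subseteq> W"
  proof
    fix v :: "complex vec" assume v: "v \<in> carrier_vec n"
    have "vec n (\<lambda>i. if i < k then v $ i else 0) \<in> W" if "k \<le> n" for k
      using that
    proof (induction k)
      case 0
      have "vec n (\<lambda>i. if i < 0 then v $ i else 0) = 0\<^sub>v n" by (rule eq_vecI) auto
      then show ?case using cl(1) by simp
    next
      case (Suc k)
      have "vec n (\<lambda>i. if i < Suc k then v $ i else 0) =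
          vec n (\<lambda>i. if i < k then v $ i else 0) + v $ k \<cdot>\<^sub>v unit_vec n k"
        using Suc.prems by (intro eq_vecI) (auto simp: less_Suc_eq)
      then show ?case using Suc cl(3) cl(4) u by simp
    qed
    from this[of n] have "vec n (\<lambda>i. if i < n then v $ i else 0) \<in> W" by simp
    also have "vec n (\<lambda>i. if i < n then v $ i else 0) = v" using v by (intro eq_vecI) auto
    finally show "v \<in> W" .
  qed
qed

context class2_two_group
begin

text \<open>The representation is induced from a linear extension \<open>\<nu>\<close> of
  \<open>\<mu>\<close> to a maximal isotropic \<open>M\<close>. It is irreducible because
  \<open>M\<close> acts by diagonal matrices with pairwise distinct characters while
  \<open>G\<close> moves the coordinate lines transitively. The degree is the index of
  \<open>M\<close>.\<close>

lemma irreducible_character_exists: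
  assumes \<kappa>: "\<kappa> \<in> center_dual" and \<mu>: "\<mu> \<in> lin_ext G (center G) (radical \<kappa>) \<kappa>"
  shows "\<exists>d>0. d ^ 2 * card (radical \<kappa>) = card (carrier G) \<and>
    restrict (\<lambda>g. of_nat d * \<mu> g) (carrier G) \<in> irreducible_characters G"
proof -
  obtain M where M: "subgroup M G" and RM: "radical \<kappa> \<subseteq> M"
    and iso: "\<And>a b. a \<in> M \<Longrightarrow> b \<in> M \<Longrightarrow> \<kappa> (commut G a b) = 1"
    and perp: "\<And>g. g \<in> carrier G \<Longrightarrow> (\<And>a. a \<in> M \<Longrightarrow> \<kappa> (commut G a g) = 1) \<Longrightarrow> g \<in> M"
    and cM: "card M ^ 2 = card (radical \<kappa>) * card (carrier G)"
  proof (rule maximal_isotropic[OF \<kappa>])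
    fix M assume "subgroup M G" "radical \<kappa> \<subseteq> M" "\<And>a b. a \<in> M \<Longrightarrow> b \<in> M \<Longrightarrow> \<kappa> (commut G a b) = 1"
      "\<And>g. g \<in> carrier G \<Longrightarrow> (\<And>a. a \<in> M \<Longrightarrow> \<kappa> (commut G a g) = 1) \<Longrightarrow> g \<in> M"
      "card M ^ 2 = card (radical \<kappa>) * card (carrier G)"
    then show thesis by (rule that)
  qed
  note R = subgroup_radical[OF \<kappa>]
  have ZR: "center G \<subseteq> radical \<kappa>" by (rule center_radical[OF \<kappa>])
  have Mc: "m \<in> carrier G" if "m \<in> M" for m using mem_carrier[OF M that] .
  have \<mu>mult: "\<mu> (a \<otimes> b) = \<mu> a * \<mu> b" if "a \<in> radical \<kappa>" "b \<in> radical \<kappa>" for a b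
    using \<mu> that by (simp add: lin_ext_def)
  have \<mu>\<kappa>: "\<mu> z = \<kappa> z" if "z \<in> center G" for z using \<mu> that by (simp add: lin_ext_def)
  have \<mu>0: "\<mu> x = 0" if "x \<notin> radical \<kappa>" for x using \<mu> that by (simp add: lin_ext_def)
  have comM: "commut G a b \<in> center G" if "a \<in> carrier G" "b \<in> carrier G" for a b
    using commut_center[OF that] .
  have "lin_ext G (radical \<kappa>) M \<mu> \<noteq> {}"
  proof (rule lin_ext_exists[OF M R RM])
    fix a b assume ab: "a \<in> M" "b \<in> M"
    show "commut G a b \<in> radical \<kappa>" using comM[OF Mc[OF ab(1)] Mc[OF ab(2)]] ZR by blast
    show "\<mu> (commut G a b) = 1" using comM[OF Mc[OF ab(1)] Mc[OF ab(2)]] \<mu>\<kappa> iso[OF ab] by simp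
  qed (rule \<mu>mult)
  then obtain \<nu> where \<nu>: "\<nu> \<in> lin_ext G (radical \<kappa>) M \<mu>" by blast
  have \<nu>mult: "\<nu> (a \<otimes> b) = \<nu> a * \<nu> b" if "a \<in> M" "b \<in> M" for a b
    using \<nu> that by (simp add: lin_ext_def)
  have \<nu>\<mu>: "\<nu> x = \<mu> x" if "x \<in> radical \<kappa>" for x using \<nu> that by (simp add: lin_ext_def)
  have \<nu>0: "\<nu> x = 0" if "x \<notin> M" for x using \<nu> that by (simp add: lin_ext_def)
  have \<nu>\<kappa>: "\<nu> z = \<kappa> z" if "z \<in> center G" for z using \<nu>\<mu> \<mu>\<kappa> ZR that by auto
  have \<nu>1: "\<nu> \<one> = 1" using \<nu>\<kappa>[OF center_one] center_dual_facts(2)[OF \<kappa>] by simp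
  have \<nu>nz: "\<nu> m \<noteq> 0" if m: "m \<in> M" for m
    using \<nu>mult[OF m subgroup.m_inv_closed[OF M m]] \<nu>1 Mc[OF m] by auto
  \<comment> \<open>Extension by zero makes this valid for every \<open>u\<close>, because right
    multiplication by \<open>M\<close> neither enters nor leaves \<open>M\<close>.\<close>
  have \<nu>right: "\<nu> (u \<otimes> m) = \<nu> u * \<nu> m" if u: "u \<in> carrier G" and m: "m \<in> M" for u m
  proof (cases "u \<in> M")
    case True
    then show ?thesis using \<nu>mult m by simp
  next
    case False
    have "u \<otimes> m \<notin> M"
    proof
      assume "u \<otimes> m \<in> M"
      then have "u \<otimes> m \<otimes> inv m \<in> M" using M m by (simp add: subgroup.m_closed subgroup.m_inv_closed)
      then show False using False u Mc[OF m] by (simp add: m_assoc)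
    qed
    then show ?thesis using False by (simp add: \<nu>0)
  qed
  obtain t :: "nat \<Rightarrow> 'a" and d where t: "\<And>i. i < d \<Longrightarrow> t i \<in> carrier G"
    and tu: "\<And>g. g \<in> carrier G \<Longrightarrow> \<exists>!i. i < d \<and> inv (t i) \<otimes> g \<in> M"
  proof (rule left_transversal[OF M])
    fix t :: "nat \<Rightarrow> 'a" and d
    assume "\<And>i. i < d \<Longrightarrow> t i \<in> carrier G"
      "\<And>g. g \<in> carrier G \<Longrightarrow> \<exists>!i. i < d \<and> inv (t i) \<otimes> g \<in> M"
    then show thesis by (rule that)
  qed
  have tij: "inv (t i) \<otimes> t j \<in> M \<longleftrightarrow> i = j" if ij: "i < d" "j < d" for i j
  proof -
    have "inv (t j) \<otimes> t j \<in> M" using t[OF ij(2)] subgroup.one_closed[OF M] by simp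
    then show ?thesis using tu[OF t[OF ij(2)]] ij by blast
  qed
  have ex1: "\<exists>k<d. inv (t k) \<otimes> g \<in> M \<and> (\<forall>l<d. l \<noteq> k \<longrightarrow> inv (t l) \<otimes> g \<notin> M)" if g: "g \<in> carrier G" for g
    using tu[OF g] by blast
  \<comment> \<open>The induced matrices. Since \<open>\<nu>\<close> is zero exactly outside
    \<open>M\<close>, for \<open>g\<close> in the group each column has exactly one non-zero
    entry.\<close>
  define \<rho> where "\<rho> g = mat d d (\<lambda>(i, j). \<nu> (inv (t i) \<otimes> g \<otimes> t j))" for g
  have \<rho>c: "\<rho> g \<in> carrier_mat d d" for g by (simp add: \<rho>_def)
  have \<rho>e: "\<rho> g $$ (i, j) = \<nu> (inv (t i) \<otimes> g \<otimes> t j)" if "i < d" "j < d" for g i j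
    using that by (simp add: \<rho>_def)
  have \<rho>mult: "\<rho> (g \<otimes> h) = \<rho> g * \<rho> h" if gh: "g \<in> carrier G" "h \<in> carrier G" for g h
  proof (rule eq_matI)
    fix i j assume "i < dim_row (\<rho> g * \<rho> h)" "j < dim_col (\<rho> g * \<rho> h)"
    then have ij: "i < d" "j < d" by (simp_all add: \<rho>_def)
    obtain k where k: "k < d" "inv (t k) \<otimes> (h \<otimes> t j) \<in> M"
      and ku: "\<forall>l<d. l \<noteq> k \<longrightarrow> inv (t l) \<otimes> (h \<otimes> t j) \<notin> M"
      using ex1[of "h \<otimes> t j"] gh t[OF ij(2)] by auto
    have "(\<rho> g * \<rho> h) $$ (i, j) = (\<Sum>l<d. \<rho> g $$ (i, l) * \<rho> h $$ (l, j))"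
      using ij by (simp add: \<rho>_def scalar_prod_def atLeast0LessThan)
    also have "\<dots> = (\<Sum>l<d. if l = k then \<rho> g $$ (i, k) * \<rho> h $$ (k, j) else 0)"
    proof (rule sum.cong)
      fix l assume l: "l \<in> {..<d}"
      have "\<rho> h $$ (l, j) = 0" if "l \<noteq> k"
        using ku l that ij t gh by (simp add: \<rho>e \<nu>0 m_assoc)
      then show "\<rho> g $$ (i, l) * \<rho> h $$ (l, j) = (if l = k then \<rho> g $$ (i, k) * \<rho> h $$ (k, j) else 0)" by simp
    qed simp
    also have "\<dots> = \<rho> g $$ (i, k) * \<rho> h $$ (k, j)" using k by simp
    also have "\<dots> = \<nu> (inv (t i) \<otimes> g \<otimes> t k) * \<nu> (inv (t k) \<otimes> (h \<otimes> t j))"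
      using ij k t gh by (simp add: \<rho>e m_assoc)
    also have "\<dots> = \<nu> (inv (t i) \<otimes> g \<otimes> t k \<otimes> (inv (t k) \<otimes> (h \<otimes> t j)))"
      using k ij t gh by (intro \<nu>right[symmetric]) auto
    also have "inv (t i) \<otimes> g \<otimes> t k \<otimes> (inv (t k) \<otimes> (h \<otimes> t j)) = inv (t i) \<otimes> (g \<otimes> h) \<otimes> t j"
      using t[OF k(1)] t[OF ij(1)] t[OF ij(2)] gh by (simp add: m_assoc inv_mult_cancel)
    finally show "\<rho> (g \<otimes> h) $$ (i, j) = (\<rho> g * \<rho> h) $$ (i, j)" using ij by (simp add: \<rho>e)
  qed (simp_all add: \<rho>_def)
  have \<rho>1: "\<rho> \<one> = 1\<^sub>m d"
  proof (rule eq_matI)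
    fix i j assume "i < dim_row (1\<^sub>m d)" "j < dim_col (1\<^sub>m d)"
    then have ij: "i < d" "j < d" by simp_all
    have "inv (t i) \<otimes> \<one> \<otimes> t j = inv (t i) \<otimes> t j" using t ij by simp
    then show "\<rho> \<one> $$ (i, j) = 1\<^sub>m d $$ (i, j)"
      using tij[OF ij] ij \<nu>1 \<nu>0 t[OF ij(1)] by (cases "i = j") (simp_all add: \<rho>e)
  qed (simp_all add: \<rho>_def)
  have rep: "representation G d \<rho>"
    unfolding representation_def
  proof (rule homI)
    fix g assume g: "g \<in> carrier G"
    have "\<rho> g * \<rho> (inv g) = 1\<^sub>m d" "\<rho> (inv g) * \<rho> g = 1\<^sub>m d"
      using \<rho>mult[of g "inv g"] \<rho>mult[of "inv g" g] g \<rho>1 by simp_all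
    then show "\<rho> g \<in> carrier (units_of (ring_mat TYPE(complex) d ()))"
      using \<rho>c unfolding units_of_def Units_def by (auto simp: ring_mat_simps)
  qed (simp add: units_of_def ring_mat_simps \<rho>mult)
  have dpos: "d > 0" using tu[OF one_closed] by auto
  have diag: "inv (t i) \<otimes> g \<otimes> t i = g \<otimes> commut G g (t i)" if "i < d" "g \<in> carrier G" for i g
    using conj_eq_commut[OF that(2) t[OF that(1)]] .
  have MZ: "g \<otimes> z \<in> M \<longleftrightarrow> g \<in> M" if g: "g \<in> carrier G" and z: "z \<in> center G" for g z
    using \<nu>right[OF g, of z] \<nu>nz \<nu>0 ZR RM z by (metis mult_eq_0_iff subsetD)
  have \<nu>Z: "\<nu> (g \<otimes> z) = \<nu> g * \<kappa> z" if g: "g \<in> carrier G" and z: "z \<in> center G" for g z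
    using \<nu>right[OF g, of z] ZR RM z \<nu>\<kappa>[OF z] by auto
  have \<rho>diag: "\<rho> g $$ (i, i) = \<nu> g * \<kappa> (commut G g (t i))" if "i < d" "g \<in> carrier G" for i g
    using that t by (simp add: \<rho>e diag \<nu>Z comM)
  have \<rho>off: "\<rho> m $$ (i, j) = 0" if m: "m \<in> M" and ij: "i < d" "j < d" "i \<noteq> j" for m i j
  proof -
    have "inv (t i) \<otimes> m \<otimes> t j = inv (t i) \<otimes> (m \<otimes> t j)" using t ij Mc[OF m] by (simp add: m_assoc)
    also have "m \<otimes> t j = t j \<otimes> m \<otimes> commut G m (t j)" by (rule commut_swap[OF Mc[OF m] t[OF ij(2)]])
    also have "inv (t i) \<otimes> (t j \<otimes> m \<otimes> commut G m (t j)) = inv (t i) \<otimes> t j \<otimes> (m \<otimes> commut G m (t j))"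
      using t ij Mc[OF m] by (simp add: m_assoc)
    finally have "\<rho> m $$ (i, j) = \<nu> (inv (t i) \<otimes> t j) * \<nu> (m \<otimes> commut G m (t j))"
      using ij t Mc[OF m] MZ[OF Mc[OF m] comM[OF Mc[OF m] t[OF ij(2)]]] m by (simp add: \<rho>e \<nu>right)
    then show ?thesis using tij[OF ij(1,2)] ij \<nu>0 by simp
  qed
  \<comment> \<open>Equal characters at \<open>i\<close> and \<open>j\<close> would make
    \<open>inv (t i) \<otimes> t j\<close> orthogonal to \<open>M\<close>, hence an element of
    \<open>M\<close>, and the two representatives would share a coset.\<close>
  have separate: "\<exists>m\<in>M. \<kappa> (commut G m (t i)) \<noteq> \<kappa> (commut G m (t j))" if ij: "i < d" "j < d" "i \<noteq> j" for i j
  proof (rule ccontr)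
    assume no: "\<not> ?thesis"
    have "inv (t i) \<otimes> t j \<in> M"
    proof (rule perp)
      show "inv (t i) \<otimes> t j \<in> carrier G" using t ij by simp
      fix m assume m: "m \<in> M"
      have "\<kappa> (commut G m (t j)) = \<kappa> (commut G m (t i \<otimes> (inv (t i) \<otimes> t j)))"
        using t[OF ij(1)] t[OF ij(2)] by (simp add: inv_mult_cancel)
      also have "\<dots> = \<kappa> (commut G m (t i)) * \<kappa> (commut G m (inv (t i) \<otimes> t j))"
        using t ij Mc[OF m] by (intro kappa_mult_right[OF \<kappa>]) auto
      finally have e: "\<kappa> (commut G m (t j)) = \<kappa> (commut G m (t i)) * \<kappa> (commut G m (inv (t i) \<otimes> t j))" .
      have "\<kappa> (commut G m (t j)) = \<kappa> (commut G m (t i))" using no m by simp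
      then show "\<kappa> (commut G m (inv (t i) \<otimes> t j)) = 1"
        using e center_dual_facts(3)[OF \<kappa> comM[OF Mc[OF m] t[OF ij(1)]]] by simp
    qed
    then show False using tij ij by blast
  qed
  have irr: "irreducible_representation G d \<rho>"
    unfolding irreducible_representation_def
  proof (intro conjI rep dpos allI impI)
    fix W assume W: "VectorSpace.subspace class_ring W (module_vec TYPE(complex) d)"
      and inv: "\<forall>g\<in>carrier G. \<forall>w\<in>W. \<rho> g *\<^sub>v w \<in> W"
    note cl = subspace_vec_closed[OF W]
    show "W = {0\<^sub>v d} \<or> W = carrier_vec d"
    proof (cases "W = {0\<^sub>v d}")
      case False
      define supp where "supp w = {i. i < d \<and> w $ i \<noteq> 0}" for w :: "complex vec"
      have fs: "finite (supp w)" for w by (simp add: supp_def)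
      \<comment> \<open>A non-zero vector of \<open>W\<close> with smallest support will turn out to
        be a multiple of a unit vector.\<close>
      have "\<exists>w. w \<in> W \<and> w \<noteq> 0\<^sub>v d" using False cl(1) by blast
      then obtain w where w: "w \<in> W" "w \<noteq> 0\<^sub>v d"
        and min: "\<And>v. card (supp v) < card (supp w) \<Longrightarrow> \<not> (v \<in> W \<and> v \<noteq> 0\<^sub>v d)"
        using exists_least_iff[of "\<lambda>n. \<exists>w. (w \<in> W \<and> w \<noteq> 0\<^sub>v d) \<and> card (supp w) = n"] by blast
      have wd: "w \<in> carrier_vec d" using w cl(2) by blast
      obtain i where i: "i < d" "w $ i \<noteq> 0"
      proof -
        have "\<exists>i<d. w $ i \<noteq> 0"
        proof (rule ccontr)
          assume "\<not> ?thesis"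
          then have "w = 0\<^sub>v d" using wd by (intro eq_vecI) auto
          then show False using w by simp
        qed
        then show thesis using that by blast
      qed
      have single: "w $ j = 0" if j: "j < d" "j \<noteq> i" for j
      proof (rule ccontr)
        assume wj: "w $ j \<noteq> 0"
        obtain m where m: "m \<in> M" "\<kappa> (commut G m (t i)) \<noteq> \<kappa> (commut G m (t j))"
          using separate[of i j] i j by auto
        define c where "c k = \<rho> m $$ (k, k)" for k
        have cij: "c i \<noteq> c j" using m i j \<rho>diag Mc[OF m(1)] \<nu>nz[OF m(1)] by (simp add: c_def)
        \<comment> \<open>Subtracting the eigenvalue at \<open>i\<close> kills coordinate
          \<open>i\<close> and keeps coordinate \<open>j\<close>, so \<open>v\<close> is non-zero
          with smaller support.\<close>
        define v where "v = \<rho> m *\<^sub>v w + (- c i) \<cdot>\<^sub>v w"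
        have vW: "v \<in> W" unfolding v_def using inv w cl Mc[OF m(1)] by blast
        have vk: "v $ k = (c k - c i) * w $ k" if k: "k < d" for k
        proof -
          have "(\<rho> m *\<^sub>v w) $ k = (\<Sum>l<d. \<rho> m $$ (k, l) * w $ l)"
            using k wd \<rho>c[of m] by (simp add: scalar_prod_def atLeast0LessThan)
          also have "\<dots> = (\<Sum>l<d. if l = k then c k * w $ k else 0)"
            by (rule sum.cong) (use \<rho>off[OF m(1) k] in \<open>auto simp: c_def\<close>)
          also have "\<dots> = c k * w $ k" using k by simp
          finally show ?thesis using k wd by (simp add: v_def algebra_simps)
        qed
        have "supp v \<subseteq> supp w - {i}" using vk by (auto simp: supp_def)
        moreover have "i \<in> supp w" using i by (simp add: supp_def)
        ultimately have "supp v \<subset> supp w" by blast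
        then have "card (supp v) < card (supp w)" using fs by (intro psubset_card_mono)
        moreover have "v $ j \<noteq> 0" using vk[OF j(1)] cij wj by simp
        then have "v \<noteq> 0\<^sub>v d" using j by auto
        ultimately show False using min vW by blast
      qed
      have "unit_vec d j \<in> W" if j: "j < d" for j
      proof -
        \<comment> \<open>This element carries the coordinate line of \<open>i\<close> to that of
          \<open>j\<close>.\<close>
        define g where "g = t j \<otimes> inv (t i)"
        have g: "g \<in> carrier G" using t j i by (simp add: g_def)
        have "\<rho> g *\<^sub>v w = w $ i \<cdot>\<^sub>v unit_vec d j"
        proof (rule eq_vecI)
          fix k assume "k < dim_vec (w $ i \<cdot>\<^sub>v unit_vec d j)"
          then have k: "k < d" by simp
          have "(\<rho> g *\<^sub>v w) $ k = (\<Sum>l<d. \<rho> g $$ (k, l) * w $ l)"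
            using k wd \<rho>c[of g] by (simp add: scalar_prod_def atLeast0LessThan)
          also have "\<dots> = (\<Sum>l<d. if l = i then \<rho> g $$ (k, i) * w $ i else 0)"
            by (rule sum.cong) (use single in auto)
          also have "\<dots> = \<rho> g $$ (k, i) * w $ i" using i by simp
          also have "\<rho> g $$ (k, i) = \<nu> (inv (t k) \<otimes> t j)"
            using k i j t by (simp add: \<rho>e g_def m_assoc)
          also have "\<dots> = (if k = j then 1 else 0)"
            using tij[OF k j] \<nu>0 \<nu>1 t[OF j] by auto
          finally show "(\<rho> g *\<^sub>v w) $ k = (w $ i \<cdot>\<^sub>v unit_vec d j) $ k" using k j by simp
        qed (use \<rho>c[of g] in simp)
        then have "w $ i \<cdot>\<^sub>v unit_vec d j \<in> W" using inv g w by metis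
        then have "(1 / w $ i) \<cdot>\<^sub>v (w $ i \<cdot>\<^sub>v unit_vec d j) \<in> W" by (rule cl(4))
        then show ?thesis using i by (simp add: smult_smult_assoc)
      qed
      then show ?thesis using unit_vecs_generate[OF W] by blast
    qed simp
  qed
  have bij: "bij_betw (\<lambda>(i, m). t i \<otimes> m) ({..<d} \<times> M) (carrier G)"
    unfolding bij_betw_def
  proof
    show "inj_on (\<lambda>(i, m). t i \<otimes> m) ({..<d} \<times> M)"
    proof (rule inj_onI)
      fix u v assume uv: "u \<in> {..<d} \<times> M" "v \<in> {..<d} \<times> M"
        and e: "(\<lambda>(i, m). t i \<otimes> m) u = (\<lambda>(i, m). t i \<otimes> m) v"
      obtain i m j m' where im: "u = (i, m)" "v = (j, m')" by (metis prod.collapse)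
      have ij: "i < d" "j < d" "m \<in> M" "m' \<in> M" and e: "t i \<otimes> m = t j \<otimes> m'" using uv e by (auto simp: im)
      have "inv (t i) \<otimes> (t i \<otimes> m) \<in> M" "inv (t j) \<otimes> (t j \<otimes> m') \<in> M"
        using ij t Mc by (simp_all add: inv_mult_cancel)
      then have "i = j" using tu[of "t i \<otimes> m"] e ij t Mc by (metis m_closed)
      then show "u = v" using e ij t Mc by (simp add: im)
    qed
    show "(\<lambda>(i, m). t i \<otimes> m) ` ({..<d} \<times> M) = carrier G"
    proof (intro equalityI subsetI)
      fix g assume g: "g \<in> carrier G"
      then obtain k where k: "k < d" "inv (t k) \<otimes> g \<in> M" using ex1 by blast
      have "g = t k \<otimes> (inv (t k) \<otimes> g)" using g t[OF k(1)] by (simp add: inv_mult_cancel)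
      then show "g \<in> (\<lambda>(i, m). t i \<otimes> m) ` ({..<d} \<times> M)"
        using k by (intro image_eqI[of _ _ "(k, inv (t k) \<otimes> g)"]) auto
    qed (use t Mc in auto)
  qed
  have dM: "d * card M = card (carrier G)"
    using bij_betw_same_card[OF bij] by (simp add: card_cartesian_product)
  have cMpos: "card M > 0" using finite_subgroup[OF M] subgroup.one_closed[OF M] by (auto simp: card_gt_0_iff)
  have gpos: "card (carrier G) > 0" using fin by (auto simp: card_gt_0_iff)
  have "d ^ 2 * card M ^ 2 = card (carrier G) ^ 2" by (simp add: dM flip: power_mult_distrib)
  then have "d ^ 2 * (card (radical \<kappa>) * card (carrier G)) = card (carrier G) ^ 2" by (simp only: cM)
  then have "(d ^ 2 * card (radical \<kappa>)) * card (carrier G) = card (carrier G) * card (carrier G)"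
    by (simp only: power2_eq_square mult.assoc)
  then have dR: "d ^ 2 * card (radical \<kappa>) = card (carrier G)" using gpos by (simp only: mult_cancel2) simp
  \<comment> \<open>The trace is \<open>\<nu> g\<close> times the sum of
    \<open>\<kappa> (commut G g (t i))\<close>. For \<open>g\<close> in \<open>M\<close> this sum
    times \<open>card M\<close> is the sum over the whole group, so it is \<open>d\<close> on the
    radical and 0 elsewhere.\<close>
  have tr: "mat_trace (\<rho> g) = of_nat d * \<mu> g" if g: "g \<in> carrier G" for g
  proof -
    have "mat_trace (\<rho> g) = (\<Sum>i<d. \<nu> g * \<kappa> (commut G g (t i)))"
      using \<rho>c[of g] g by (simp add: mat_trace_def \<rho>diag)
    then have 1: "mat_trace (\<rho> g) = \<nu> g * (\<Sum>i<d. \<kappa> (commut G g (t i)))" by (simp add: sum_distrib_left)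
    show ?thesis
    proof (cases "g \<in> M")
      case False
      then show ?thesis using 1 \<nu>0 \<mu>0 RM by auto
    next
      case True
      have "(\<Sum>x\<in>carrier G. \<kappa> (commut G g x)) = (\<Sum>(i, m)\<in>{..<d} \<times> M. \<kappa> (commut G g (t i \<otimes> m)))"
        by (subst sum.reindex_bij_betw[OF bij, symmetric]) (simp add: case_prod_unfold)
      also have "\<dots> = (\<Sum>(i, m)\<in>{..<d} \<times> M. \<kappa> (commut G g (t i)))"
        by (intro sum.cong) (auto simp: kappa_mult_right[OF \<kappa>] t Mc g iso True)
      also have "\<dots> = of_nat (card M) * (\<Sum>i<d. \<kappa> (commut G g (t i)))"
        by (simp add: sum_distrib_left flip: sum.cartesian_product)
      finally have s: "of_nat (card M) * (\<Sum>i<d. \<kappa> (commut G g (t i))) = (if g \<in> radical \<kappa> then of_nat (card (carrier G)) else 0)"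
        using kappa_sum[OF \<kappa> subgroup_self g] g by (simp add: radical_def)
      show ?thesis
      proof (cases "g \<in> radical \<kappa>")
        case True
        have "of_nat (card M) * (\<Sum>i<d. \<kappa> (commut G g (t i))) = (of_nat (card M) * of_nat d :: complex)"
          using s True dM by (metis mult.commute of_nat_mult)
        then have "(\<Sum>i<d. \<kappa> (commut G g (t i))) = of_nat d" using cMpos by simp
        then show ?thesis using 1 \<nu>\<mu>[OF True] by simp
      next
        case False
        then have "(\<Sum>i<d. \<kappa> (commut G g (t i))) = 0" using s cMpos by simp
        then show ?thesis using 1 \<mu>0[OF False] by simp
      qed
    qed
  qed
  have "restrict (\<lambda>g. of_nat d * \<mu> g) (carrier G) = restrict (\<lambda>g. mat_trace (\<rho> g)) (carrier G)"
    using tr by (intro restrict_ext) simp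
  then have "restrict (\<lambda>g. of_nat d * \<mu> g) (carrier G) \<in> irreducible_characters G"
    unfolding irreducible_characters_def using irr by blast
  then show ?thesis using dpos dR by blast
qed

end

section \<open>Decomposition of the power-counting function\<close>

context class2_two_group
begin

context
  fixes \<kappa> \<mu>
  assumes \<kappa>: "\<kappa> \<in> center_dual" and \<mu>: "\<mu> \<in> lin_ext G (center G) (radical \<kappa>) \<kappa>"
begin

lemma radical_char_mult: "a \<in> radical \<kappa> \<Longrightarrow> b \<in> radical \<kappa> \<Longrightarrow> \<mu> (a \<otimes> b) = \<mu> a * \<mu> b"
  using \<mu> by (simp add: lin_ext_def)

lemma radical_char_zero: "x \<notin> radical \<kappa> \<Longrightarrow> \<mu> x = 0"
  using \<mu> by (simp add: lin_ext_def)

lemma radical_char_center: "z \<in> center G \<Longrightarrow> \<mu> z = \<kappa> z"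
  using \<mu> by (simp add: lin_ext_def)

lemma radical_char_one: "\<mu> \<one> = 1"
  using radical_char_center[OF center_one] center_dual_facts(2)[OF \<kappa>] by simp

text \<open>The values of \<open>\<mu>\<close> on the radical are roots of unity, for which
  conjugation is inversion.\<close>

lemma radical_char_cnj:
  assumes x: "x \<in> radical \<kappa>"
  shows "cnj (\<mu> x) = \<mu> (inv x)"
proof -
  note R = subgroup_radical[OF \<kappa>]
  have xc: "x \<in> carrier G" using mem_carrier[OF R x] .
  have pw: "\<mu> (x [^] k) = \<mu> x ^ k" for k :: nat
    by (induction k) (use x subgroup_pow[OF R x] in \<open>simp_all add: radical_char_mult radical_char_one\<close>)
  have "card (carrier G) \<noteq> 0" using fin by auto
  moreover have "\<mu> x ^ card (carrier G) = 1"
    using pw[of "card (carrier G)"] pow_order_eq_1[OF xc] radical_char_one by (simp add: Coset.order_def)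
  ultimately have e: "norm (\<mu> x) ^ card (carrier G) = 1 ^ card (carrier G)" and pos: "card (carrier G) > 0"
    by (simp_all flip: norm_power)
  have nm: "norm (\<mu> x) = 1" by (rule power_eq_imp_eq_base[OF e norm_ge_zero zero_le_one pos])
  have "\<mu> x * cnj (\<mu> x) = of_real ((norm (\<mu> x))\<^sup>2)" by (rule complex_norm_square[symmetric])
  then have 1: "\<mu> x * cnj (\<mu> x) = 1" unfolding nm by simp
  have "\<mu> x * \<mu> (inv x) = 1"
    using radical_char_mult[OF x subgroup.m_inv_closed[OF R x]] xc radical_char_one by simp
  then have "\<mu> x * cnj (\<mu> x) = \<mu> x * \<mu> (inv x)" using 1 by simp
  moreover have "\<mu> x \<noteq> 0" using 1 by auto
  ultimately show ?thesis by simp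
qed

text \<open>The kernel of \<open>\<mu>\<close> need not be central but is normal: conjugation
  changes \<open>h\<close> by a commutator, on which \<open>\<kappa>\<close> is 1 because
  \<open>h\<close> lies in the radical.\<close>

lemma radical_quotient:
  obtains P :: "nat monoid" and \<theta> where "\<theta> \<in> epi G P" "radical_epi G P \<theta> (radical \<kappa>) \<mu>"
proof -
  note R = subgroup_radical[OF \<kappa>] and ZR = center_radical[OF \<kappa>]
  have Rc: "x \<in> carrier G" if "x \<in> radical \<kappa>" for x using mem_carrier[OF R that] .
  define K where "K = {a \<in> radical \<kappa>. \<mu> a = 1}"
  have "subgroup K G"
  proof (rule subgroupI)
    show "K \<noteq> {}" using radical_char_one subgroup.one_closed[OF R] by (auto simp: K_def)
    fix a assume a: "a \<in> K"
    have "\<mu> (inv a) = 1" using a radical_char_cnj[of a] by (simp add: K_def)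
    then show "inv a \<in> K" using a subgroup.m_inv_closed[OF R] by (simp add: K_def)
  qed (auto simp: K_def Rc subgroup.m_closed[OF R] radical_char_mult)
  moreover have "x \<otimes> h \<otimes> inv x \<in> K" if x: "x \<in> carrier G" and h: "h \<in> K" for x h
  proof -
    have hR: "h \<in> radical \<kappa>" and h1: "\<mu> h = 1" using h by (simp_all add: K_def)
    have c: "commut G h (inv x) \<in> center G" using commut_center[OF Rc[OF hR]] x by simp
    have e: "x \<otimes> h \<otimes> inv x = h \<otimes> commut G h (inv x)"
      using conj_eq_commut[OF Rc[OF hR], of "inv x"] x by simp
    have "\<kappa> (commut G h (inv x)) = 1" using hR x by (simp add: radical_def)
    then have "\<mu> (h \<otimes> commut G h (inv x)) = 1"
      using radical_char_mult[OF hR, of "commut G h (inv x)"] c ZR h1 radical_char_center[OF c] by auto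
    moreover have "h \<otimes> commut G h (inv x) \<in> radical \<kappa>" using hR c ZR subgroup.m_closed[OF R] by blast
    ultimately show ?thesis by (simp add: e K_def)
  qed
  ultimately have Kn: "K \<lhd> G" by (simp add: normal_inv_iff)
  obtain P :: "nat monoid" and \<theta> where P: "group P" "\<theta> \<in> epi G P"
    and ker: "\<And>a. a \<in> carrier G \<Longrightarrow> \<theta> a = \<one>\<^bsub>P\<^esub> \<longleftrightarrow> a \<in> K"
  proof (rule quotient_to_nat[OF Kn fin])
    fix P :: "nat monoid" and \<theta>
    assume "group P" "\<theta> \<in> epi G P" "\<And>a. a \<in> carrier G \<Longrightarrow> \<theta> a = \<one>\<^bsub>P\<^esub> \<longleftrightarrow> a \<in> K"
    then show thesis by (rule that)
  qed
  interpret P: group P by (rule P(1))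
  have "radical_epi G P \<theta> (radical \<kappa>) \<mu>"
  proof (unfold_locales)
    show "\<theta> \<in> hom G P" using P(2) by (simp add: epi_def)
    show "finite (carrier G)" by (rule fin)
    show "radical \<kappa> \<subseteq> carrier G" using Rc by blast
    show "\<And>x y. x \<in> radical \<kappa> \<Longrightarrow> y \<in> radical \<kappa> \<Longrightarrow> x \<otimes> y \<in> radical \<kappa>"
      using subgroup.m_closed[OF R] .
    show "\<one> \<in> radical \<kappa>" using subgroup.one_closed[OF R] .
    show "\<And>x. x \<in> radical \<kappa> \<Longrightarrow> inv x \<in> radical \<kappa>" using subgroup.m_inv_closed[OF R] .
    show "center G \<subseteq> radical \<kappa>" by (rule ZR)
    show "\<mu> \<one> = 1" by (rule radical_char_one)
    show "\<theta> ` carrier G = carrier P" using P(2) by (simp add: epi_def)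
    show "\<And>a b. a \<in> radical \<kappa> \<Longrightarrow> b \<in> radical \<kappa> \<Longrightarrow> \<mu> (a \<otimes> b) = \<mu> a * \<mu> b"
      by (rule radical_char_mult)
    fix a assume a: "a \<in> carrier G"
    show "a \<in> radical \<kappa> \<longleftrightarrow> (\<forall>b\<in>carrier G. \<mu> (commut G a b) = 1)"
      using a by (simp add: radical_def radical_char_center commut_center)
    show "\<theta> a = \<one>\<^bsub>P\<^esub> \<longleftrightarrow> a \<in> radical \<kappa> \<and> \<mu> a = 1" using ker[OF a] by (simp add: K_def)
  qed
  then show thesis by (rule that[OF P(2)])
qed

end

text \<open>On the radical, \<open>cnj (\<mu> x) * \<mu> g = \<mu> (g \<otimes> inv x)\<close>.
  Summation over all extensions of \<open>\<kappa>\<close> leaves only arguments in the centre,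
  where \<open>\<mu>\<close> is \<open>\<kappa>\<close>.\<close>

lemma radical_block_sum:
  assumes \<kappa>: "\<kappa> \<in> center_dual" and g: "g \<in> carrier G"
  shows "(\<Sum>\<mu>\<in>lin_ext G (center G) (radical \<kappa>) \<kappa>. cnj (gauss_sum G (radical \<kappa>) \<mu> n) * \<mu> g) / of_nat (card (radical \<kappa>))
    = (\<Sum>h\<in>carrier G. if g \<in> radical \<kappa> \<and> g \<otimes> inv (h [^] n) \<in> center G
        then \<kappa> (g \<otimes> inv (h [^] n)) / of_nat (card (center G)) else 0)"
proof -
  let ?X = "lin_ext G (center G) (radical \<kappa>) \<kappa>" and ?R = "radical \<kappa>"
  note R = subgroup_radical[OF \<kappa>] and ZR = center_radical[OF \<kappa>] and cond = radical_ext_conditions[OF \<kappa>]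
  have Rpos: "card ?R > 0"
    using finite_subgroup[OF R] subgroup.one_closed[OF R] by (auto simp: card_gt_0_iff)
  have Zpos: "card (center G) > 0"
    using finite_center center_one by (metis card_gt_0_iff empty_iff)
  have cX: "card ?X * card (center G) = card ?R"
    by (rule lin_ext_card[OF R subgroup_center ZR]) (use cond in auto)
  have sX: "(\<Sum>\<mu>\<in>?X. \<mu> u) = (if u \<in> center G then of_nat (card ?X) * \<kappa> u else 0)" if "u \<in> ?R" for u
    by (rule lin_ext_sum[OF R subgroup_center ZR]) (use cond that in auto)
  have summand: "cnj (\<mu> x) * \<mu> g = (if g \<in> ?R \<and> x \<in> ?R then \<mu> (g \<otimes> inv x) else 0)" if \<mu>: "\<mu> \<in> ?X" for \<mu> x
    using radical_char_zero[OF \<kappa> \<mu>] radical_char_cnj[OF \<kappa> \<mu>, of x]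
      radical_char_mult[OF \<kappa> \<mu>, of g "inv x"] subgroup.m_inv_closed[OF R, of x]
    by (auto simp: mult.commute)
  have gs: "gauss_sum G ?R \<mu> n = (\<Sum>h\<in>carrier G. \<mu> (h [^] n))" if \<mu>: "\<mu> \<in> ?X" for \<mu>
    unfolding gauss_sum_def
    by (rule sum.mono_neutral_left) (use fin radical_char_zero[OF \<kappa> \<mu>] in auto)
  have in_iff: "x \<in> ?R" if "g \<in> ?R" "x \<in> carrier G" "g \<otimes> inv x \<in> center G" for x
  proof -
    have "inv (g \<otimes> inv x) \<otimes> g = x" using that g by (simp add: inv_mult_group m_assoc)
    moreover have "inv (g \<otimes> inv x) \<otimes> g \<in> ?R"
      using that ZR center_inv by (intro subgroup.m_closed[OF R]) auto
    ultimately show ?thesis by simp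
  qed
  have "(\<Sum>\<mu>\<in>?X. cnj (gauss_sum G ?R \<mu> n) * \<mu> g) = (\<Sum>\<mu>\<in>?X. \<Sum>h\<in>carrier G. cnj (\<mu> (h [^] n)) * \<mu> g)"
    by (rule sum.cong) (auto simp: gs sum_distrib_right)
  also have "\<dots> = (\<Sum>h\<in>carrier G. \<Sum>\<mu>\<in>?X. cnj (\<mu> (h [^] n)) * \<mu> g)" by (rule sum.swap)
  also have "\<dots> = (\<Sum>h\<in>carrier G. if g \<in> ?R \<and> g \<otimes> inv (h [^] n) \<in> center G
      then of_nat (card ?X) * \<kappa> (g \<otimes> inv (h [^] n)) else 0)"
  proof (rule sum.cong)
    fix h assume h: "h \<in> carrier G"
    let ?x = "h [^] n"
    have "(\<Sum>\<mu>\<in>?X. cnj (\<mu> ?x) * \<mu> g) = (\<Sum>\<mu>\<in>?X. if g \<in> ?R \<and> ?x \<in> ?R then \<mu> (g \<otimes> inv ?x) else 0)"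
      by (rule sum.cong) (auto simp: summand)
    also have "\<dots> = (if g \<in> ?R \<and> ?x \<in> ?R then (\<Sum>\<mu>\<in>?X. \<mu> (g \<otimes> inv ?x)) else 0)"
      by (cases "g \<in> ?R \<and> ?x \<in> ?R") (simp_all only: if_True if_False sum.neutral_const simp_thms)
    also have "\<dots> = (if g \<in> ?R \<and> g \<otimes> inv ?x \<in> center G then of_nat (card ?X) * \<kappa> (g \<otimes> inv ?x) else 0)"
    proof (cases "g \<in> ?R \<and> ?x \<in> ?R")
      case True
      then have "g \<otimes> inv ?x \<in> ?R" using subgroup.m_inv_closed[OF R] subgroup.m_closed[OF R] by simp
      then show ?thesis using True sX by simp
    next
      case False
      have "\<not> (g \<in> ?R \<and> g \<otimes> inv ?x \<in> center G)" using False in_iff[of ?x] h by auto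
      then show ?thesis unfolding if_not_P[OF False] by (rule if_not_P[symmetric])
    qed
    finally show "(\<Sum>\<mu>\<in>?X. cnj (\<mu> ?x) * \<mu> g) =
      (if g \<in> ?R \<and> g \<otimes> inv ?x \<in> center G then of_nat (card ?X) * \<kappa> (g \<otimes> inv ?x) else 0)" .
  qed simp
  finally have "(\<Sum>\<mu>\<in>?X. cnj (gauss_sum G ?R \<mu> n) * \<mu> g) / of_nat (card ?R) =
    (\<Sum>h\<in>carrier G. (if g \<in> ?R \<and> g \<otimes> inv (h [^] n) \<in> center G
      then of_nat (card ?X) * \<kappa> (g \<otimes> inv (h [^] n)) else 0) / of_nat (card ?R))"
    by (simp only: sum_divide_distrib)
  also have "\<dots> = (\<Sum>h\<in>carrier G. if g \<in> ?R \<and> g \<otimes> inv (h [^] n) \<in> center G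
        then \<kappa> (g \<otimes> inv (h [^] n)) / of_nat (card (center G)) else 0)"
  proof (rule sum.cong)
    fix h
    have Xpos: "card ?X > 0" using cX Rpos by (cases "card ?X") auto
    have "of_nat (card ?X) * w / of_nat (card ?R) = w / complex_of_nat (card (center G))" for w
      unfolding cX[symmetric] using Xpos Zpos by simp
    then show "(if g \<in> ?R \<and> g \<otimes> inv (h [^] n) \<in> center G
      then of_nat (card ?X) * \<kappa> (g \<otimes> inv (h [^] n)) else 0) / of_nat (card ?R) =
      (if g \<in> ?R \<and> g \<otimes> inv (h [^] n) \<in> center G
        then \<kappa> (g \<otimes> inv (h [^] n)) / of_nat (card (center G)) else 0)" by simp
  qed simp
  finally show ?thesis .
qed

lemma finite_center_dual: "finite center_dual"
  unfolding center_dual_def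
  by (rule finite_lin_ext[OF subgroup_center trivial_subgroup])
    (auto simp: commut_central center_sub)

text \<open>For fixed \<open>g\<close> the commutators with \<open>g\<close> form a subgroup
  \<open>D\<close>, and \<open>g\<close> lies in the radical of \<open>\<kappa>\<close> exactly when
  \<open>\<kappa>\<close> is trivial on \<open>D\<close>. The sum is orthogonality for the centre
  modulo \<open>D\<close>.\<close>

lemma center_dual_sum:
  assumes g: "g \<in> carrier G" and u: "u \<in> center G"
  defines "D \<equiv> (\<lambda>x. commut G g x) ` carrier G"
  shows "(\<Sum>\<kappa>\<in>center_dual. if g \<in> radical \<kappa> then \<kappa> u / of_nat (card (center G)) else 0) =
      (if u \<in> D then 1 / of_nat (card D) else 0)"
    and "subgroup D G" "D \<subseteq> center G"
proof -
  show DZ: "D \<subseteq> center G" using g by (auto simp: D_def commut_center)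
  show D: "subgroup D G"
  proof (rule subgroupI)
    show "D \<subseteq> carrier G" by (rule subset_trans[OF DZ]) (rule subsetI, erule center_sub)
    show "D \<noteq> {}" by (auto simp: D_def)
  next
    fix a assume "a \<in> D"
    then obtain x where x: "x \<in> carrier G" "a = commut G g x" by (auto simp: D_def)
    have "commut G g (inv x) \<otimes> commut G g x = \<one>"
      using commut_mult_right[OF g, of "inv x" x] x g by (simp add: commut_central)
    then have "inv a = commut G g (inv x)" using x g by (simp add: inv_equality)
    then show "inv a \<in> D" using x by (auto simp: D_def)
  next
    fix a b assume "a \<in> D" "b \<in> D"
    then obtain x y where "x \<in> carrier G" "a = commut G g x" "y \<in> carrier G" "b = commut G g y" by (auto simp: D_def)
    then show "a \<otimes> b \<in> D" unfolding D_def using g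
      by (intro image_eqI[of _ _ "x \<otimes> y"]) (simp_all add: commut_mult_right)
  qed
  let ?L = "lin_ext G D (center G) (\<lambda>_. 1)"
  have "\<one> \<in> D" using subgroup.one_closed[OF D] .
  then have L: "{\<kappa> \<in> center_dual. g \<in> radical \<kappa>} = ?L"
    using g by (auto simp: center_dual_def lin_ext_def radical_def D_def)
  have cond: "commut G a b \<in> D" if "a \<in> center G" "b \<in> center G" for a b
    using that \<open>\<one> \<in> D\<close> by (simp add: commut_central center_sub)
  have cL: "card ?L * card D = card (center G)"
    by (rule lin_ext_card[OF subgroup_center D DZ]) (use cond in auto)
  have sL: "(\<Sum>\<kappa>\<in>?L. \<kappa> u) = (if u \<in> D then of_nat (card ?L) * 1 else 0)"
    by (rule lin_ext_sum[OF subgroup_center D DZ]) (use cond u in auto)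
  have Zpos: "card (center G) > 0"
    using finite_center center_one by (metis card_gt_0_iff empty_iff)
  then have Lpos: "card ?L > 0" and Dpos: "card D > 0" using cL by (auto intro: Nat.gr0I)
  have "(\<Sum>\<kappa>\<in>center_dual. if g \<in> radical \<kappa> then \<kappa> u / of_nat (card (center G)) else 0) =
      (\<Sum>\<kappa>\<in>{\<kappa> \<in> center_dual. g \<in> radical \<kappa>}. \<kappa> u / of_nat (card (center G)))"
    by (rule sum.inter_filter[OF finite_center_dual, symmetric])
  also have "\<dots> = (if u \<in> D then of_nat (card ?L) else 0) / of_nat (card (center G))"
    unfolding L by (simp add: sL flip: sum_divide_distrib)
  also have "\<dots> = (if u \<in> D then 1 / of_nat (card D) else 0)"
    unfolding cL[symmetric] using Lpos Dpos by simp
  finally show "(\<Sum>\<kappa>\<in>center_dual. if g \<in> radical \<kappa> then \<kappa> u / of_nat (card (center G)) else 0) =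
      (if u \<in> D then 1 / of_nat (card D) else 0)" .
qed

lemma power_count_conj:
  assumes g: "g \<in> carrier G" and x: "x \<in> carrier G"
  shows "power_count G n (g \<otimes> commut G g x) = power_count G n g"
proof -
  have pw: "(inv y \<otimes> h \<otimes> y) [^] k = inv y \<otimes> h [^] k \<otimes> y" if "h \<in> carrier G" "y \<in> carrier G" for h y and k :: nat
    using that by (induction k) (simp_all add: m_assoc inv_mult_cancel)
  have "bij_betw (\<lambda>h. inv x \<otimes> h \<otimes> x) {h \<in> carrier G. h [^] n = g} {h \<in> carrier G. h [^] n = inv x \<otimes> g \<otimes> x}"
  proof (rule bij_betwI[where g = "\<lambda>h. x \<otimes> h \<otimes> inv x"])
    show "(\<lambda>h. inv x \<otimes> h \<otimes> x) \<in> {h \<in> carrier G. h [^] n = g} \<rightarrow> {h \<in> carrier G. h [^] n = inv x \<otimes> g \<otimes> x}"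
      using x pw by auto
    show "(\<lambda>h. x \<otimes> h \<otimes> inv x) \<in> {h \<in> carrier G. h [^] n = inv x \<otimes> g \<otimes> x} \<rightarrow> {h \<in> carrier G. h [^] n = g}"
      using x g pw[of _ "inv x"] by (auto simp: m_assoc inv_mult_cancel)
  qed (use x in \<open>auto simp: m_assoc inv_mult_cancel\<close>)
  then have "card {h \<in> carrier G. h [^] n = g} = card {h \<in> carrier G. h [^] n = inv x \<otimes> g \<otimes> x}"
    by (rule bij_betw_same_card)
  then show ?thesis using conj_eq_commut[OF g x] by (simp add: power_count_def)
qed

text \<open>After both summations over characters the right side is the average of the power count
  over the coset \<open>g D\<close>. This coset is the conjugacy class of \<open>g\<close>, on which
  the count is constant.\<close>

lemma power_count_formula:
  assumes g: "g \<in> carrier G"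
  shows "complex_of_nat (power_count G n g) = (\<Sum>\<kappa>\<in>center_dual.
    (\<Sum>\<mu>\<in>lin_ext G (center G) (radical \<kappa>) \<kappa>. cnj (gauss_sum G (radical \<kappa>) \<mu> n) * \<mu> g) / of_nat (card (radical \<kappa>)))"
proof -
  define D where "D = (\<lambda>x. commut G g x) ` carrier G"
  note cds = center_dual_sum[OF g, folded D_def]
  have D: "subgroup D G" and DZ: "D \<subseteq> center G" using cds(2,3)[OF center_one] by auto
  let ?u = "\<lambda>h. g \<otimes> inv (h [^] n)"
  have Dfin: "finite D" by (rule finite_subgroup[OF D])
  have Dpos: "card D > 0" using Dfin subgroup.one_closed[OF D] by (auto simp: card_gt_0_iff)
  have "(\<Sum>\<kappa>\<in>center_dual.
    (\<Sum>\<mu>\<in>lin_ext G (center G) (radical \<kappa>) \<kappa>. cnj (gauss_sum G (radical \<kappa>) \<mu> n) * \<mu> g) / of_nat (card (radical \<kappa>)))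
    = (\<Sum>\<kappa>\<in>center_dual. \<Sum>h\<in>carrier G. if g \<in> radical \<kappa> \<and> ?u h \<in> center G
        then \<kappa> (?u h) / of_nat (card (center G)) else 0)"
    by (rule sum.cong) (auto simp only: radical_block_sum g)
  also have "\<dots> = (\<Sum>h\<in>carrier G. \<Sum>\<kappa>\<in>center_dual. if g \<in> radical \<kappa> \<and> ?u h \<in> center G
        then \<kappa> (?u h) / of_nat (card (center G)) else 0)" by (rule sum.swap)
  also have "\<dots> = (\<Sum>h\<in>carrier G. if ?u h \<in> D then 1 / of_nat (card D) else 0)"
  proof (rule sum.cong)
    fix h assume "h \<in> carrier G"
    show "(\<Sum>\<kappa>\<in>center_dual. if g \<in> radical \<kappa> \<and> ?u h \<in> center G
        then \<kappa> (?u h) / of_nat (card (center G)) else 0) = (if ?u h \<in> D then 1 / of_nat (card D) else 0)"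
    proof (cases "?u h \<in> center G")
      case True
      then show ?thesis using cds(1)[OF True] by simp
    next
      case False
      then have "?u h \<notin> D" using DZ by auto
      then show ?thesis using False by simp
    qed
  qed simp
  also have "\<dots> = (\<Sum>h\<in>{h \<in> carrier G. ?u h \<in> D}. 1 / of_nat (card D))"
    by (rule sum.inter_filter[OF fin, symmetric])
  also have "\<dots> = of_nat (card {h \<in> carrier G. ?u h \<in> D}) / of_nat (card D)" by simp
  also have "card {h \<in> carrier G. ?u h \<in> D} = (\<Sum>c\<in>D. \<Sum>h | h \<in> {h \<in> carrier G. ?u h \<in> D} \<and> ?u h = c. 1)"
  proof -
    have "(\<Sum>c\<in>D. \<Sum>h | h \<in> {h \<in> carrier G. ?u h \<in> D} \<and> ?u h = c. 1 :: nat) = (\<Sum>h\<in>{h \<in> carrier G. ?u h \<in> D}. 1)"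
      by (rule sum.group) (use fin Dfin in auto)
    then show ?thesis by simp
  qed
  also have "\<dots> = (\<Sum>c\<in>D. power_count G n g)"
  proof (rule sum.cong)
    fix c assume c: "c \<in> D"
    have cc: "c \<in> center G" using c DZ by auto
    \<comment> \<open>\<open>D\<close> is a subgroup, so \<open>inv c\<close> is again a commutator
      with \<open>g\<close>, and \<open>g \<otimes> inv c\<close> is a conjugate of
      \<open>g\<close>.\<close>
    have "inv c \<in> D" using subgroup.m_inv_closed[OF D c] .
    then obtain x where x: "x \<in> carrier G" "inv c = commut G g x" by (auto simp: D_def)
    have iff: "?u h = c \<longleftrightarrow> h [^] n = g \<otimes> inv c" if h: "h \<in> carrier G" for h
    proof
      assume "?u h = c"
      then have "c \<otimes> h [^] n = g" using g h by (auto simp: m_assoc)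
      then have "g \<otimes> inv c = c \<otimes> h [^] n \<otimes> inv c" by simp
      also have "\<dots> = h [^] n \<otimes> c \<otimes> inv c" using center_comm[OF cc, of "h [^] n"] h by simp
      finally show "h [^] n = g \<otimes> inv c" using h center_sub[OF cc] by (simp add: m_assoc)
    next
      assume "h [^] n = g \<otimes> inv c"
      then have "?u h = g \<otimes> (c \<otimes> inv g)" using g center_sub[OF cc] by (simp add: inv_mult_group)
      also have "\<dots> = c" using center_comm[OF cc, of "inv g"] g center_sub[OF cc] by (simp add: inv_mult_cancel)
      finally show "?u h = c" .
    qed
    have "{h. h \<in> {h \<in> carrier G. ?u h \<in> D} \<and> ?u h = c} = {h \<in> carrier G. h [^] n = g \<otimes> inv c}"
      using iff c by auto
    then show "(\<Sum>h | h \<in> {h \<in> carrier G. ?u h \<in> D} \<and> ?u h = c. 1) = power_count G n g"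
      using power_count_conj[OF g x(1)] x(2) by (simp add: power_count_def)
  qed simp
  finally show ?thesis using Dpos by simp
qed

end

text \<open>A family takes the place of a set: multiplicities of equal characters are added, so
  distinct pairs \<open>(\<kappa>, \<mu>)\<close> do not have to be shown to give distinct
  characters.\<close>

lemma is_characterI:
  assumes "finite I" "\<And>i. i \<in> I \<Longrightarrow> \<chi> i \<in> irreducible_characters G"
    and eq: "\<And>g. g \<in> carrier G \<Longrightarrow> f g = (\<Sum>i\<in>I. of_nat (m i :: nat) * \<chi> i g)"
  shows "is_character G f"
  unfolding is_character_def
proof (intro exI[of _ "\<chi> ` I"] exI[of _ "\<lambda>\<psi>. \<Sum>i | i \<in> I \<and> \<chi> i = \<psi>. m i"] conjI ballI)
  fix g assume "g \<in> carrier G"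
  then have "f g = (\<Sum>\<psi>\<in>\<chi> ` I. \<Sum>i | i \<in> I \<and> \<chi> i = \<psi>. of_nat (m i) * \<chi> i g)"
    using eq sum.image_gen[OF assms(1), of "\<lambda>i. of_nat (m i) * \<chi> i g" \<chi>] by simp
  also have "\<dots> = (\<Sum>\<psi>\<in>\<chi> ` I. of_nat (\<Sum>i | i \<in> I \<and> \<chi> i = \<psi>. m i) * \<psi> g)"
  proof (rule sum.cong)
    fix \<psi>
    have "(\<Sum>i | i \<in> I \<and> \<chi> i = \<psi>. of_nat (m i) * \<chi> i g) = (\<Sum>i | i \<in> I \<and> \<chi> i = \<psi>. of_nat (m i) * \<psi> g)"
      by (rule sum.cong) auto
    then show "(\<Sum>i | i \<in> I \<and> \<chi> i = \<psi>. of_nat (m i) * \<chi> i g) = of_nat (\<Sum>i | i \<in> I \<and> \<chi> i = \<psi>. m i) * \<psi> g"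
      by (simp add: sum_distrib_right)
  qed simp
  finally show "f g = (\<Sum>\<psi>\<in>\<chi> ` I. of_nat (\<Sum>i | i \<in> I \<and> \<chi> i = \<psi>. m i) * \<psi> g)" .
qed (use assms in auto)

text \<open>Each pair \<open>(\<kappa>, \<mu>)\<close> contributes \<open>d \<mu>\<close> with
  multiplicity \<open>j\<close>. The multiplicity can fail to be a natural number only through a
  negative Gauss sum of \<open>P\<close>, and this would make \<open>P\<close> one of the excluded
  images.\<close>

lemma (in class2_two_group) character_if_no_epi:
  assumes r: "r \<ge> 1"
    and no: "\<not> (\<exists>rs (P :: nat monoid) f. sorted rs \<and> (\<forall>s\<in>set rs. 1 \<le> s \<and> s \<le> r) \<and>
          DQ_product rs r P \<and> f \<in> epi G P)"
  shows "is_character G (\<lambda>g. of_nat (power_count G (2 ^ r) g))"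
proof -
  let ?n = "2 ^ r :: nat"
  let ?X = "\<lambda>\<kappa>. lin_ext G (center G) (radical \<kappa>) \<kappa>"
  define I where "I = (SIGMA \<kappa>:center_dual. ?X \<kappa>)"
  have ex: "\<exists>d j :: nat. restrict (\<lambda>g. of_nat d * snd i g) (carrier G) \<in> irreducible_characters G \<and>
      cnj (gauss_sum G (radical (fst i)) (snd i) ?n) / of_nat (card (radical (fst i))) = of_nat j * of_nat d"
    if i: "i \<in> I" for i
  proof -
    obtain \<kappa> \<mu> where i': "i = (\<kappa>, \<mu>)" by (cases i)
    have \<kappa>: "\<kappa> \<in> center_dual" and \<mu>: "\<mu> \<in> ?X \<kappa>" using i by (auto simp: I_def i')
    obtain d where d: "d > 0" "d ^ 2 * card (radical \<kappa>) = card (carrier G)"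
      "restrict (\<lambda>g. of_nat d * \<mu> g) (carrier G) \<in> irreducible_characters G"
      using irreducible_character_exists[OF \<kappa> \<mu>] by blast
    obtain P :: "nat monoid" and \<theta> where \<theta>: "\<theta> \<in> epi G P" and re: "radical_epi G P \<theta> (radical \<kappa>) \<mu>"
      by (rule radical_quotient[OF \<kappa> \<mu>])
    interpret re: radical_epi G P \<theta> "radical \<kappa>" \<mu> by (rule re)
    have "\<not> (\<exists>p>0. gauss_sum P (center P) re.push ?n = - complex_of_real p)"
    proof
      assume "\<exists>p>0. gauss_sum P (center P) re.push ?n = - complex_of_real p"
      then obtain p where p: "gauss_sum P (center P) re.push ?n = - complex_of_real p" "p > 0" by auto
      show False using DQ_product_exists[OF re.faithful_push r p] \<theta> no by blast
    qed
    then obtain j :: nat where j: "of_nat d * cnj (gauss_sum G (radical \<kappa>) \<mu> ?n) = of_nat (card (carrier G)) * of_nat j"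
      using re.gauss_sum_multiplicity[OF r d(2)] by blast
    have Rpos: "card (radical \<kappa>) > 0"
      using d(2) fin by (cases "card (radical \<kappa>)") auto
    have "complex_of_nat d * cnj (gauss_sum G (radical \<kappa>) \<mu> ?n) = of_nat d * (of_nat d * of_nat (card (radical \<kappa>)) * of_nat j)"
      unfolding j d(2)[symmetric] by (simp add: power2_eq_square)
    then have "cnj (gauss_sum G (radical \<kappa>) \<mu> ?n) = of_nat d * of_nat (card (radical \<kappa>)) * of_nat j"
      using d(1) by simp
    then have "cnj (gauss_sum G (radical \<kappa>) \<mu> ?n) / of_nat (card (radical \<kappa>)) = of_nat j * of_nat d"
      using Rpos by simp
    then show ?thesis using d(3) by (auto simp: i')
  qed
  then obtain d j :: "('a \<Rightarrow> complex) \<times> ('a \<Rightarrow> complex) \<Rightarrow> nat" where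
    dj: "\<And>i. i \<in> I \<Longrightarrow> restrict (\<lambda>g. of_nat (d i) * snd i g) (carrier G) \<in> irreducible_characters G"
      "\<And>i. i \<in> I \<Longrightarrow> cnj (gauss_sum G (radical (fst i)) (snd i) ?n) / of_nat (card (radical (fst i))) = of_nat (j i) * of_nat (d i)"
    by metis
  have finX: "finite (?X \<kappa>)" if "\<kappa> \<in> center_dual" for \<kappa>
    by (rule finite_lin_ext[OF subgroup_radical[OF that] subgroup_center center_radical[OF that]])
      (use radical_ext_conditions[OF that] in auto)
  show ?thesis
  proof (rule is_characterI)
    show "finite I" unfolding I_def using finite_center_dual finX by blast
    show "restrict (\<lambda>g. of_nat (d i) * snd i g) (carrier G) \<in> irreducible_characters G" if "i \<in> I" for i
      using dj(1)[OF that] .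
    fix g assume g: "g \<in> carrier G"
    have "complex_of_nat (power_count G ?n g) = (\<Sum>\<kappa>\<in>center_dual. \<Sum>\<mu>\<in>?X \<kappa>.
        cnj (gauss_sum G (radical \<kappa>) \<mu> ?n) / of_nat (card (radical \<kappa>)) * \<mu> g)"
      unfolding power_count_formula[OF g] by (simp add: sum_divide_distrib)
    also have "\<dots> = (\<Sum>(\<kappa>, \<mu>)\<in>I. cnj (gauss_sum G (radical \<kappa>) \<mu> ?n) / of_nat (card (radical \<kappa>)) * \<mu> g)"
      unfolding I_def by (rule sum.Sigma) (use finite_center_dual finX in auto)
    also have "\<dots> = (\<Sum>i\<in>I. of_nat (j i) * restrict (\<lambda>g. of_nat (d i) * snd i g) (carrier G) g)"
    proof (rule sum.cong)
      fix i assume i: "i \<in> I"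
      show "(case i of (\<kappa>, \<mu>) \<Rightarrow> cnj (gauss_sum G (radical \<kappa>) \<mu> ?n) / of_nat (card (radical \<kappa>)) * \<mu> g) =
        of_nat (j i) * restrict (\<lambda>g. of_nat (d i) * snd i g) (carrier G) g"
        by (simp only: case_prod_unfold dj(2)[OF i] restrict_apply g if_True mult.assoc)
    qed simp
    finally show "complex_of_nat (power_count G ?n g) =
        (\<Sum>i\<in>I. of_nat (j i) * restrict (\<lambda>g. of_nat (d i) * snd i g) (carrier G) g)" .
  qed
qed

theorem theorem5p6:
  fixes G :: "('a, 'b) monoid_scheme" and r :: nat
  assumes "group G"
    and "finite (carrier G)"
    and "\<exists>k. Coset.order G = 2 ^ k"
    and "has_nilpotency_class G 2"
    and "r \<ge> 1"
  shows "is_character G (\<lambda>g. of_nat (power_count G (2 ^ r) g)) \<longleftrightarrow>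
    \<not> (\<exists>rs (P :: nat monoid) f.
          sorted rs \<and> (\<forall>s\<in>set rs. 1 \<le> s \<and> s \<le> r) \<and>
          DQ_product rs r P \<and> f \<in> epi G P)"
proof
  interpret class2_group G by (rule class2_group_of_nilpotency[OF assms(1,4)])
  interpret class2_two_group G by unfold_locales (use assms in auto)
  assume "is_character G (\<lambda>g. of_nat (power_count G (2 ^ r) g))"
  then show "\<not> (\<exists>rs (P :: nat monoid) f.
          sorted rs \<and> (\<forall>s\<in>set rs. 1 \<le> s \<and> s \<le> r) \<and>
          DQ_product rs r P \<and> f \<in> epi G P)"
    using no_epi_if_character[OF class2_group_axioms assms(2)] DQ_product_negative_gauss assms(5) by blast
next
  interpret class2_group G by (rule class2_group_of_nilpotency[OF assms(1,4)])
  interpret class2_two_group G by unfold_locales (use assms in auto)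
  assume "\<not> (\<exists>rs (P :: nat monoid) f.
          sorted rs \<and> (\<forall>s\<in>set rs. 1 \<le> s \<and> s \<le> r) \<and>
          DQ_product rs r P \<and> f \<in> epi G P)"
  then show "is_character G (\<lambda>g. of_nat (power_count G (2 ^ r) g))"
    by (rule character_if_no_epi[OF assms(5)])
qed

end
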